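(* Let $r\in(0,\infty)$, $s\in(0,\infty]$ with $r<s$, and $p,q\in(r,s)$. Let $v$ be a weight on $\mathbf{R}^d$ with $v\in A_{p,(r,s)}$ and let $X=L^{p,q}_v(\mathbf{R}^d)$. Then \[ M:X_{r,s}\to X_{r,s},\qquad M:(X_{r,s})'\to(X_{r,s})' \] are bounded.
   Context: Conventions: $\frac1\infty=0$. A weight is a measurable function with $0<v<\infty$ a.e. $Q$ runs over cubes in $\mathbf{R}^d$ with sides parallel to the axes; $Mf=\sup_Q\big(\frac1{|Q|}\int_Q|f|\big)\mathbf{1}_Q$. $v\in A_{p,(r,s)}$ iff $\sup_Q|Q|^{-(\frac1r-\frac1s)}\|v\mathbf{1}_Q\|_{L^{\frac1{\frac1p-\frac1s}}}\|v^{-1}\mathbf{1}_Q\|_{L^{\frac1{\frac1r-\frac1p}}}<\infty$. The weighted Lorentz space $L^{p,q}_v(\mathbf{R}^d)$ consists of the measurable $f$ with $\|f\|_{L^{p,q}_v}=p^{1/q}\big\|\lambda(v^p(\{|f|>\lambda\}))^{1/p}\big\|_{L^q((0,\infty);d\lambda/\lambda)}<\infty$, where $v^p(E)=\int_Ev^p\,dx$; spaces are considered up to equivalent (quasi-)norm. For a quasi-Banach function space $X$ (a quasi-normed space of measurable functions with the ideal, Fatou and saturation properties): the Köthe dual is $X'=\{g\in L^0: fg\in L^1\ \forall f\in X\}$ with $\|g\|_{X'}=\sup_{\|f\|_X=1}\|fg\|_{L^1}$ (with respect to Lebesgue measure); for $t\in(0,\infty)$, $X^t=\{f:|f|^{1/t}\in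 X\}$ with $\|f\|_{X^t}=\||f|^{1/t}\|_X^t$; and $X_{r,s}=\big[[(X^r)']^{(s/r)'}\big]'$, where $(s/r)'=\frac1{1-r/s}$. *)

theory Defs
  imports "HOL-Analysis.Analysis" "HOL-Probability.Essential_Supremum"
begin

(* Powers on [0,\<infinity>]; only used with exponent a > 0, so that \<infinity>^a = \<infinity>. *)
definition ennpowr :: "ennreal \<Rightarrow> real \<Rightarrow> ennreal" where
  "ennpowr x a = (if x = \<infinity> then \<infinity> else ennreal (enn2real x powr a))"

definition Lnorm :: "'a measure \<Rightarrow> ereal \<Rightarrow> ('a \<Rightarrow> ennreal) \<Rightarrow> ennreal" where
  "Lnorm \<mu> e f =
     (if e = \<infinity> then esssup \<mu> f
      else ennpowr (\<integral>\<^sup>+x. ennpowr (f x) (real_of_ereal e) \<partial>\<mu>) (1 / real_of_ereal e))"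

(* The measure d\<lambda>/\<lambda> on (0,\<infinity>), extended by zero to the real line. *)
definition dlambda_over_lambda :: "real measure" where
  "dlambda_over_lambda = density lborel (\<lambda>t. ennreal (1 / t) * indicator {0<..} t)"

definition weight :: "('a::euclidean_space \<Rightarrow> real) \<Rightarrow> bool" where
  "weight v \<longleftrightarrow> v \<in> borel_measurable lebesgue \<and> (AE x in lebesgue. 0 < v x)"

definition cubes :: "(real^'n) set set" where
  "cubes = {cbox a (a + (\<chi> i. l)) | a l. 0 < l}"

(* The Hardy--Littlewood maximal function; f need not be locally integrable, in which case
   the value may be \<infinity>. *)
definition maximal_fun :: "(real^'n \<Rightarrow> complex) \<Rightarrow> real^'n \<Rightarrow> ennreal" where
  "maximal_fun f x =
     (SUP Q\<in>cubes. (\<integral>\<^sup>+y\<in>Q. ennreal (cmod (f y)) \<partial>lebesgue) / emeasure lebesgue Q * indicator Q x)"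

(* In ereal, 1/\<infinity> = 0 and 1/0 = \<infinity>, so the endpoint cases give the L^\<infinity> norm. *)
definition A_const :: "ereal \<Rightarrow> ereal \<Rightarrow> ereal \<Rightarrow> (real^'n \<Rightarrow> real) \<Rightarrow> ennreal" where
  "A_const p r s v =
     (SUP Q\<in>cubes. ennreal (measure lebesgue Q powr (- real_of_ereal (1/r - 1/s)))
        * Lnorm lebesgue (1 / (1/p - 1/s)) (\<lambda>x. ennreal (v x) * indicator Q x)
        * Lnorm lebesgue (1 / (1/r - 1/p)) (\<lambda>x. ennreal (inverse (v x)) * indicator Q x))"

definition A_class :: "ereal \<Rightarrow> ereal \<Rightarrow> ereal \<Rightarrow> (real^'n \<Rightarrow> real) set" where
  "A_class p r s = {v. weight v \<and> A_const p r s v < \<infinity>}"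

(* A space of measurable functions together with its (quasi-)norm. Elements are
   representatives; functions equal almost everywhere are not identified. *)
record 'a fun_space =
  elems :: "('a \<Rightarrow> complex) set"
  qnorm :: "('a \<Rightarrow> complex) \<Rightarrow> ennreal"

definition lorentz_norm ::
    "real \<Rightarrow> real \<Rightarrow> ('a::euclidean_space \<Rightarrow> real) \<Rightarrow> ('a \<Rightarrow> complex) \<Rightarrow> ennreal" where
  "lorentz_norm p q v f =
     ennreal (p powr (1/q)) *
     Lnorm dlambda_over_lambda (ereal q)
       (\<lambda>t. ennreal t *
          ennpowr (\<integral>\<^sup>+x\<in>{x. cmod (f x) > t}. ennreal (v x powr p) \<partial>lebesgue) (1/p))"

definition lorentz_space ::
    "real \<Rightarrow> real \<Rightarrow> ('a::euclidean_space \<Rightarrow> real) \<Rightarrow> 'a fun_space" where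
  "lorentz_space p q v =
     \<lparr>elems = {f \<in> borel_measurable lebesgue. lorentz_norm p q v f < \<infinity>},
      qnorm = lorentz_norm p q v\<rparr>"

definition koethe_dual :: "'a::euclidean_space fun_space \<Rightarrow> 'a fun_space" where
  "koethe_dual X =
     \<lparr>elems = {g \<in> borel_measurable lebesgue.
                 \<forall>f\<in>elems X. integrable lebesgue (\<lambda>x. f x * g x)},
      qnorm = (\<lambda>g. SUP f\<in>{f \<in> elems X. qnorm X f = 1}.
                 \<integral>\<^sup>+x. ennreal (cmod (f x * g x)) \<partial>lebesgue)\<rparr>"

definition abs_powr :: "('a \<Rightarrow> complex) \<Rightarrow> real \<Rightarrow> 'a \<Rightarrow> complex" where
  "abs_powr f a = (\<lambda>x. complex_of_real (cmod (f x) powr a))"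

definition space_power :: "'a::euclidean_space fun_space \<Rightarrow> real \<Rightarrow> 'a fun_space" where
  "space_power X t =
     \<lparr>elems = {f \<in> borel_measurable lebesgue. abs_powr f (1/t) \<in> elems X},
      qnorm = (\<lambda>f. ennpowr (qnorm X (abs_powr f (1/t))) t)\<rparr>"

(* X_{r,s} = [[(X^r)']^{(s/r)'}]', with (s/r)' = 1/(1 - r/s). *)
definition space_rs :: "'a::euclidean_space fun_space \<Rightarrow> real \<Rightarrow> ereal \<Rightarrow> 'a fun_space" where
  "space_rs X r s =
     koethe_dual (space_power (koethe_dual (space_power X r))
                    (1 / (1 - real_of_ereal (ereal r / s))))"

(* For an operator T with values in [0,\<infinity>]: T f is finite almost everywhere and, as an
   element of X, has norm bounded by a constant times that of f. *)
definition bounded_on :: "(('a::euclidean_space \<Rightarrow> complex) \<Rightarrow> 'a \<Rightarrow> ennreal) \<Rightarrow> 'a fun_space \<Rightarrow> bool" where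
  "bounded_on T X \<longleftrightarrow>
     (\<exists>C::real. \<forall>f\<in>elems X.
        (AE x in lebesgue. T f x < \<infinity>) \<and>
        (\<lambda>x. complex_of_real (enn2real (T f x))) \<in> elems X \<and>
        qnorm X (\<lambda>x. complex_of_real (enn2real (T f x))) \<le> ennreal C * qnorm X f)"

end

theory Submission
  imports Defs
begin

text \<open>
  Write \<open>w = v\<^sup>p\<close>, \<open>\<gamma> = (s/r)'\<close>, \<open>\<alpha> = 1/(1/p - 1/s)\<close>, \<open>\<beta> = 1/(1/r - 1/p)\<close>. Since all exponents that occur lie
  strictly between \<open>1\<close> and \<open>\<infinity>\<close>, Lorentz duality identifies \<open>X\<^bsub>r,s\<^esub>\<close> with
  \<open>{f. f w\<^bsup>\<gamma>-1\<^esup> \<in> L\<^bsup>A,B\<^esup>(w)}\<close>, where \<open>A = 1 + \<alpha>/\<beta>\<close>, and its dual with \<open>{f. f w\<^bsup>-\<gamma>\<^esup> \<in> L\<^bsup>A',B'\<^esup>(w)}\<close>.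
  In the diagonal case \<open>B = A\<close> these are weighted Lebesgue spaces whose weights \<open>v\<^sup>\<alpha>\<close> and \<open>v\<^bsup>-\<beta>\<^esup>\<close> lie in the
  Muckenhoupt classes \<open>A\<^sub>A\<close> and \<open>A\<^bsub>A'\<^esub>\<close>; this is exactly the hypothesis on \<open>v\<close>. By the reverse Hoelder
  inequality the hypothesis is open in the exponents, so \<open>M\<close> is also bounded on the diagonal spaces with exponents
  \<open>A \<plusminus> \<eta>\<close> and the same \<open>w\<close>, and Marcinkiewicz interpolation gives the Lorentz spaces in between.
\<close>

section \<open>Powers of extended nonnegative reals\<close>

text \<open>The diagonal spaces do not form a scale of Lebesgue spaces over one weight. Asking for f
  m in L^t(w) with m = v^c means that M acts on L^t with the weight v^(p + c t), which moves with t.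
  Away from the diagonal exponent both exponents of v are therefore perturbed, and the hypothesis
  has to be relaxed on both sides; what is interpolated over the fixed measure w dx is not M but its
  conjugate by m. Membership in a Koethe dual means integrability of all products, whereas its norm
  is a supremum over a unit sphere. Identifying the dual thus takes, besides two norm estimates, an
  argument that integrable products force a finite norm. Since q/p may be less than 1, convexity and
  triangle inequalities are not at hand; sums are controlled by geometric decay instead, half of
  which is spent on each exchange of a sum with a power. All spaces are compared through
  distribution functions sampled at the powers of a base, because there a power of a space is an
  exact change of parameters.\<close>

lemma ennpowr_top [simp]: "ennpowr \<infinity> a = \<infinity>" "ennpowr top a = top"
  by (auto simp: ennpowr_def infinity_ennreal_def)

lemma ennpowr_ennreal: "0 \<le> x \<Longrightarrow> ennpowr (ennreal x) a = ennreal (x powr a)"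
  by (simp add: ennpowr_def)

lemma ennpowr_0 [simp]: "ennpowr 0 a = 0"
  by (simp add: ennpowr_def)

lemma ennpowr_1 [simp]: "ennpowr 1 a = 1"
  by (simp add: ennpowr_def)

lemma ennpowr_one [simp]: "ennpowr x 1 = x"
  by (cases x) (auto simp: ennpowr_ennreal)

lemma ennpowr_ennpowr: "ennpowr (ennpowr x a) b = ennpowr x (a * b)"
  by (cases x) (auto simp: ennpowr_ennreal powr_powr)

lemma ennpowr_inverse: "a \<noteq> 0 \<Longrightarrow> ennpowr (ennpowr x a) (1/a) = x"
  "a \<noteq> 0 \<Longrightarrow> ennpowr (ennpowr x (1/a)) a = x"
  by (simp_all add: ennpowr_ennpowr)

lemma ennpowr_eq_0_iff [simp]: "ennpowr x a = 0 \<longleftrightarrow> x = 0"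
  by (cases x) (auto simp: ennpowr_ennreal ennreal_eq_0_iff)

lemma ennpowr_eq_top_iff [simp]: "ennpowr x a = top \<longleftrightarrow> x = top"
  by (cases x) (auto simp: ennpowr_ennreal)

lemma ennpowr_less_top_iff [simp]: "ennpowr x a < top \<longleftrightarrow> x < top"
  by (simp add: less_top[symmetric])

lemma ennpowr_mono: "x \<le> y \<Longrightarrow> 0 \<le> a \<Longrightarrow> ennpowr x a \<le> ennpowr y a"
  by (cases x; cases y) (auto simp: ennpowr_ennreal top_unique intro!: ennreal_leI powr_mono2)

lemma ennpowr_mono_iff: "0 < a \<Longrightarrow> ennpowr x a \<le> ennpowr y a \<longleftrightarrow> x \<le> y"
  using ennpowr_mono[of x y a] ennpowr_mono[of "ennpowr x a" "ennpowr y a" "1/a"]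
  by (auto simp: ennpowr_inverse)

lemma ennpowr_less_iff: "0 < a \<Longrightarrow> ennpowr x a < ennpowr y a \<longleftrightarrow> x < y"
  using ennpowr_mono_iff[of a y x] by (simp flip: not_le)

lemma ennpowr_le_iff: "0 < a \<Longrightarrow> ennpowr x a \<le> y \<longleftrightarrow> x \<le> ennpowr y (1/a)"
  using ennpowr_mono_iff[of a x "ennpowr y (1/a)"] by (simp add: ennpowr_inverse)

lemma ennpowr_mult: "0 < a \<Longrightarrow> ennpowr (x * y) a = ennpowr x a * ennpowr y a"
proof (cases "x = 0 \<or> y = 0 \<or> x = top \<or> y = top")
  case False
  then show "ennpowr (x * y) a = ennpowr x a * ennpowr y a"
    by (cases x; cases y) (auto simp: ennpowr_ennreal powr_mult simp flip: ennreal_mult)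
qed (auto simp: ennreal_mult_top ennreal_top_mult)

lemma ennpowr_add: "x \<noteq> 0 \<Longrightarrow> ennpowr x (a + b) = ennpowr x a * ennpowr x b"
  by (cases x) (auto simp: ennpowr_ennreal powr_add simp flip: ennreal_mult)

text \<open>For a > 0 the power is an order isomorphism with inverse exponent 1/a, and
  \<open>ennpowr_le_iff\<close> is the adjunction that carries suprema through.\<close>

lemma ennpowr_SUP:
  assumes "0 < a" shows "ennpowr (SUP i\<in>I. f i) a = (SUP i\<in>I. ennpowr (f i) a)"
proof (rule antisym)
  show "(SUP i\<in>I. ennpowr (f i) a) \<le> ennpowr (SUP i\<in>I. f i) a"
    using assms by (intro SUP_least ennpowr_mono SUP_upper) auto
  show "ennpowr (SUP i\<in>I. f i) a \<le> (SUP i\<in>I. ennpowr (f i) a)"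
    unfolding ennpowr_le_iff[OF assms]
    by (intro SUP_least) (simp add: ennpowr_le_iff[OF assms, symmetric], intro SUP_upper)
qed

lemma borel_measurable_ennpowr [measurable]:
  assumes [measurable]: "f \<in> borel_measurable M"
  shows "(\<lambda>x. ennpowr (f x) a) \<in> borel_measurable M"
  unfolding ennpowr_def by measurable

lemma ennpowr_indicator: "ennpowr (f * indicator A x) a = ennpowr f a * indicator A x"
  by (auto simp: indicator_def)

text \<open>A substitute for convexity of \<open>x \<mapsto> x\<^sup>\<beta>\<close> that also covers \<open>\<beta> < 1\<close>: a sum
  \<open>\<Sum> s t x\<close> is at most \<open>\<Sum> s\<close> times the supremum of \<open>t x\<close>, and powers commute with suprema.\<close>

lemma ennpowr_sum_le:
  fixes s t x :: "'i \<Rightarrow> ennreal"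
  assumes "0 < \<beta>"
  shows "ennpowr (\<integral>\<^sup>+j. s j * t j * x j \<partial>count_space I) \<beta>
    \<le> ennpowr (\<integral>\<^sup>+j. s j \<partial>count_space I) \<beta> * (\<integral>\<^sup>+j. ennpowr (t j * x j) \<beta> \<partial>count_space I)"
proof -
  let ?S = "SUP j\<in>I. t j * x j"
  have "(\<integral>\<^sup>+j. s j * t j * x j \<partial>count_space I) \<le> (\<integral>\<^sup>+j. s j * ?S \<partial>count_space I)"
    unfolding mult.assoc by (intro nn_integral_mono mult_left_mono SUP_upper) auto
  also have "\<dots> = (\<integral>\<^sup>+j. s j \<partial>count_space I) * ?S"
    by (intro nn_integral_multc) auto
  finally have "ennpowr (\<integral>\<^sup>+j. s j * t j * x j \<partial>count_space I) \<beta>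
      \<le> ennpowr (\<integral>\<^sup>+j. s j \<partial>count_space I) \<beta> * ennpowr ?S \<beta>"
    using assms by (simp add: ennpowr_mono flip: ennpowr_mult)
  also have "ennpowr ?S \<beta> \<le> (\<integral>\<^sup>+j. ennpowr (t j * x j) \<beta> \<partial>count_space I)"
    unfolding ennpowr_SUP[OF assms] by (intro SUP_least nn_integral_ge_point)
  finally show ?thesis by (simp add: mult_left_mono)
qed

section \<open>Young and Hoelder inequalities on [0,\<infinity>]\<close>

text \<open>The factors 1/p and 1/q are dropped. This costs the factor 2 in
  \<open>Hoelder_ennreal\<close>, which is harmless where only boundedness is at stake.\<close>

lemma Young_ennreal:
  fixes x y :: ennreal
  assumes "1 < p" "1 < q" "1 / p + 1 / q = (1::real)"
  shows "x * y \<le> ennpowr x p + ennpowr y q"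
proof (cases "x = 0 \<or> y = 0 \<or> x = top \<or> y = top")
  case False
  then obtain a b where ab: "x = ennreal a" "y = ennreal b" "0 \<le> a" "0 \<le> b"
    by (cases x; cases y) auto
  have "a * b \<le> a powr p / p + b powr q / q"
    using Youngs_inequality assms ab by blast
  also have "\<dots> \<le> a powr p + b powr q"
    using assms by (intro add_mono) (simp_all add: divide_le_eq mult_left_le_one_le mult_le_cancel_left1)
  finally show ?thesis
    using ab by (simp add: ennpowr_ennreal flip: ennreal_mult ennreal_plus)
qed auto

lemma ennpowr_cancel:
  assumes "0 < x" "p \<noteq> 0"
  shows "ennpowr (ennreal (x powr (-1/p))) p * ennreal x = 1"
    and "ennpowr (ennreal x) (1/p) * ennreal (x powr (-1/p)) = 1"
proof -
  have "(x powr (-1/p)) powr p * x = 1"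
    using assms by (subst powr_powr) (simp add: powr_minus)
  then show "ennpowr (ennreal (x powr (-1/p))) p * ennreal x = 1"
    using assms by (subst ennpowr_ennreal) (simp_all flip: ennreal_mult)
  have "x powr (1/p) * x powr (-1/p) = 1"
    using assms by (subst powr_add[symmetric]) simp
  then show "ennpowr (ennreal x) (1/p) * ennreal (x powr (-1/p)) = 1"
    using assms by (subst ennpowr_ennreal) (simp_all flip: ennreal_mult)
qed

text \<open>Rescale both factors so that their power integrals become 1 and integrate Young's
  inequality. Rescaling requires these integrals to be positive and finite, so the values 0 and
  \<infinity> are treated apart.\<close>

lemma Hoelder_ennreal:
  fixes f g :: "'a \<Rightarrow> ennreal"
  assumes pq: "1 < p" "1 < q" "1 / p + 1 / q = (1::real)"
    and [measurable]: "f \<in> borel_measurable M" "g \<in> borel_measurable M"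
  shows "(\<integral>\<^sup>+x. f x * g x \<partial>M)
    \<le> 2 * (ennpowr (\<integral>\<^sup>+x. ennpowr (f x) p \<partial>M) (1/p) * ennpowr (\<integral>\<^sup>+x. ennpowr (g x) q \<partial>M) (1/q))"
    (is "_ \<le> 2 * (ennpowr ?F _ * ennpowr ?G _)")
proof (cases "?F = 0 \<or> ?G = 0")
  case True
  then have "AE x in M. f x * g x = 0"
    by (auto simp: nn_integral_0_iff_AE)
  then have "(\<integral>\<^sup>+x. f x * g x \<partial>M) = (\<integral>\<^sup>+x. 0 \<partial>M)"
    by (rule nn_integral_cong_AE)
  then show ?thesis by simp
next
  case nz: False
  show ?thesis
  proof (cases "?F = top \<or> ?G = top")
    case True
    with nz show ?thesis by (auto simp: ennreal_top_mult ennreal_mult_top)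
  next
    case False
    with nz obtain F G where FG: "?F = ennreal F" "?G = ennreal G" "0 < F" "0 < G"
      by (cases ?F; cases ?G) (auto simp: ennreal_eq_0_iff)
    define a where "a = ennreal (F powr (-1/p))"
    define b where "b = ennreal (G powr (-1/q))"
    have ab: "ennpowr a p * ?F = 1" "ennpowr b q * ?G = 1"
      unfolding FG(1,2) a_def b_def using FG(3,4) pq by (intro ennpowr_cancel; linarith)+
    have "(\<integral>\<^sup>+x. (a * f x) * (b * g x) \<partial>M) \<le> (\<integral>\<^sup>+x. ennpowr a p * ennpowr (f x) p + ennpowr b q * ennpowr (g x) q \<partial>M)"
      using pq by (intro nn_integral_mono) (simp add: Young_ennreal flip: ennpowr_mult)
    also have "\<dots> = 2"
      by (subst nn_integral_add) (auto simp: nn_integral_cmult ab)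
    also have "(\<integral>\<^sup>+x. (a * f x) * (b * g x) \<partial>M) = (\<integral>\<^sup>+x. (a * b) * (f x * g x) \<partial>M)"
      by (simp only: mult_ac)
    also have "\<dots> = a * b * (\<integral>\<^sup>+x. f x * g x \<partial>M)"
      by (rule nn_integral_cmult) measurable
    finally have *: "a * b * (\<integral>\<^sup>+x. f x * g x \<partial>M) \<le> 2" .
    \<comment> \<open>Undoes the rescaling: a and b are the reciprocals of the two norms.\<close>
    have "ennpowr ?F (1/p) * a = 1" "ennpowr ?G (1/q) * b = 1"
      unfolding FG(1,2) a_def b_def using FG(3,4) pq by (intro ennpowr_cancel; linarith)+
    then have "(\<integral>\<^sup>+x. f x * g x \<partial>M)
        = (ennpowr ?F (1/p) * a) * (ennpowr ?G (1/q) * b) * (\<integral>\<^sup>+x. f x * g x \<partial>M)"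
      by (simp only: mult_1)
    also have "\<dots> = ennpowr ?F (1/p) * ennpowr ?G (1/q) * (a * b * (\<integral>\<^sup>+x. f x * g x \<partial>M))"
      by (simp only: mult_ac)
    also have "\<dots> \<le> ennpowr ?F (1/p) * ennpowr ?G (1/q) * 2"
      using * by (intro mult_left_mono) auto
    finally show ?thesis by (simp add: mult_ac)
  qed
qed

section \<open>A discrete Lorentz functional\<close>

abbreviation lev :: "real \<Rightarrow> int \<Rightarrow> ennreal" where
  "lev b k \<equiv> ennreal (b powr real_of_int k)"

abbreviation levp :: "real \<Rightarrow> int \<Rightarrow> real \<Rightarrow> ennreal" where
  "levp b k a \<equiv> ennreal (b powr (real_of_int k * a))"

text \<open>Sums are integrals for counting measure, so that exchanging two sums, or a sum and an
  integral, is Tonelli's theorem with no convergence condition.\<close>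

abbreviation csum :: "('i \<Rightarrow> ennreal) \<Rightarrow> ennreal" (binder "\<Sum>\<^sup>+" 10) where
  "csum f \<equiv> (\<integral>\<^sup>+i. f i \<partial>count_space UNIV)"

text \<open>Up to constants this is the \<open>q\<close>-th power of the norm of \<open>L\<^sup>p\<^sup>,\<^sup>q(M)\<close>, for every base
  \<open>b > 1\<close>. The base is kept variable because the powers of a space change it.\<close>

definition dlor :: "real \<Rightarrow> real \<Rightarrow> real \<Rightarrow> 'a measure \<Rightarrow> ('a \<Rightarrow> ennreal) \<Rightarrow> ennreal" where
  "dlor b p q M \<phi> = (\<Sum>\<^sup>+k. levp b k q *
     ennpowr (emeasure M {x \<in> space M. lev b k < \<phi> x}) (q / p))"

lemma dlor_mono_AE:
  assumes "AE x in M. \<phi> x \<le> \<psi> x" "\<psi> \<in> borel_measurable M" "0 < p" "0 < q"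
  shows "dlor b p q M \<phi> \<le> dlor b p q M \<psi>"
  unfolding dlor_def
proof (intro nn_integral_mono mult_left_mono ennpowr_mono emeasure_mono_AE)
  fix k :: int
  show "AE x in M. x \<in> {x \<in> space M. lev b k < \<phi> x} \<longrightarrow> x \<in> {x \<in> space M. lev b k < \<psi> x}"
    using assms(1) by (rule eventually_mono) auto
  show "{x \<in> space M. lev b k < \<psi> x} \<in> sets M"
    using assms(2) by measurable
qed (use assms in auto)

lemma dlor_cong_AE:
  assumes "AE x in M. \<phi> x = \<psi> x" "\<phi> \<in> borel_measurable M" "\<psi> \<in> borel_measurable M" "0 < p" "0 < q"
  shows "dlor b p q M \<phi> = dlor b p q M \<psi>"
  using assms by (intro antisym dlor_mono_AE) (auto elim: eventually_mono)

text \<open>The index 0 is counted in both series, hence an inequality; it serves to prove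
  finiteness only.\<close>

lemma nn_integral_int_le_suminf:
  fixes f :: "int \<Rightarrow> ennreal"
  shows "(\<Sum>\<^sup>+k. f k) \<le> (\<Sum>n. f (int n)) + (\<Sum>n. f (- int n))"
proof -
  have r: "(\<Sum>\<^sup>+k. f k * indicator (range g) k) = (\<Sum>n. f (g n))" if "inj g"
    for g :: "nat \<Rightarrow> int"
  proof -
    have "(\<Sum>\<^sup>+k. f k * indicator (range g) k) = (\<integral>\<^sup>+k. f k \<partial>count_space (range g))"
      by (simp add: nn_integral_count_space_indicator)
    also have "\<dots> = (\<Sum>\<^sup>+n. f (g n))"
      using that by (intro nn_integral_bij_count_space[symmetric]) (simp add: bij_betw_def)
    finally show ?thesis by (simp add: nn_integral_count_space_nat)
  qed
  have "(\<Sum>\<^sup>+k. f k)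
      \<le> (\<Sum>\<^sup>+k. f k * indicator (range int) k + f k * indicator (range (\<lambda>n. - int n)) k)"
  proof (intro nn_integral_mono)
    fix k :: int
    have "k \<in> range int \<or> k \<in> range (\<lambda>n. - int n)"
      by (cases "0 \<le> k") (auto intro: rev_image_eqI[of "nat k"] rev_image_eqI[of "nat (- k)"])
    then show "f k \<le> f k * indicator (range int) k + f k * indicator (range (\<lambda>n. - int n)) k"
      by (auto simp: indicator_def)
  qed
  also have "\<dots> = (\<Sum>n. f (int n)) + (\<Sum>n. f (- int n))"
    by (subst nn_integral_add) (auto simp: r inj_def)
  finally show ?thesis .
qed

text \<open>The two-sided geometric series, by which every exponentially decaying kernel is summed.
  Its value stays opaque: it is finite, at least 1, and insensitive to a shift of the index.\<close>

definition geosum :: "real \<Rightarrow> real \<Rightarrow> ennreal" where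
  "geosum b \<epsilon> = (\<Sum>\<^sup>+(k::int). ennreal (b powr (- \<epsilon> * \<bar>real_of_int k\<bar>)))"

lemma geosum_less_top:
  assumes "1 < b" "0 < \<epsilon>" shows "geosum b \<epsilon> < top"
proof -
  have "(\<Sum>n. ennreal (b powr (- \<epsilon> * real n))) < top"
  proof -
    have e: "b powr (- \<epsilon> * real n) = (b powr (- \<epsilon>)) ^ n" for n
      using assms by (subst powr_powr[symmetric], subst powr_realpow) auto
    have "b powr (- \<epsilon>) < 1"
      using assms by (simp add: powr_less_one)
    then have "summable (\<lambda>n. b powr (- \<epsilon> * real n))"
      unfolding e by (intro summable_geometric) auto
    then show ?thesis
      by (simp add: suminf_ennreal_eq[OF _ summable_sums])
  qed
  moreover have "geosum b \<epsilon> \<le> (\<Sum>n. ennreal (b powr (- \<epsilon> * real n))) + (\<Sum>n. ennreal (b powr (- \<epsilon> * real n)))"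
    unfolding geosum_def by (rule order_trans[OF nn_integral_int_le_suminf]) simp
  ultimately show ?thesis
    by (metis (no_types, lifting) ennreal_add_less_top le_less_trans)
qed

lemma nn_integral_int_shift:
  fixes f :: "int \<Rightarrow> ennreal"
  shows "(\<Sum>\<^sup>+k. f (k + n)) = (\<Sum>\<^sup>+k. f k)"
  by (rule nn_integral_bij_count_space) (rule bij_betw_byWitness[where f'="\<lambda>k. k - n"], auto)

lemma geosum_shift:
  "(\<Sum>\<^sup>+(k::int). ennreal (b powr (- \<epsilon> * \<bar>real_of_int k - real_of_int n\<bar>))) = geosum b \<epsilon>"
  unfolding geosum_def
  using nn_integral_int_shift[where f="\<lambda>k. ennreal (b powr (- \<epsilon> * \<bar>real_of_int k\<bar>))" and n="-n"] by simp

lemma geosum_ge_1: "0 < b \<Longrightarrow> 1 \<le> geosum b \<epsilon>"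
  unfolding geosum_def
  using nn_integral_ge_point[of 0 UNIV "\<lambda>k::int. ennreal (b powr (- \<epsilon> * \<bar>real_of_int k\<bar>))"] by simp

section \<open>Layers between consecutive powers of the base\<close>

text \<open>The half-open layer b^K < x \<le> b^(K+1) fits the strict superlevel sets in
  \<open>dlor\<close>; hence K is the ceiling of the logarithm minus one.\<close>

lemma level_exists:
  assumes "1 < b" "0 < x" "x < top"
  obtains K where "lev b K < x" "x \<le> ennreal (b powr (real_of_int K + 1))"
proof -
  obtain r where r: "x = ennreal r" "0 < r"
    using assms by (cases x) auto
  let ?K = "\<lceil>log b r\<rceil> - 1"
  have "real_of_int ?K < log b r" "log b r \<le> real_of_int ?K + 1"
    by linarith+
  then have "b powr real_of_int ?K < r" "r \<le> b powr (real_of_int ?K + 1)"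
    using assms(1) r(2) powr_less_iff[of b r "real_of_int ?K"] le_powr_iff[of b r "real_of_int ?K + 1"] by blast+
  then show ?thesis using r by (intro that[of ?K]) (auto simp only: ennreal_less_iff ennreal_leI powr_ge_zero)
qed

lemma level_less_iff:
  "1 < b \<Longrightarrow> ennreal (b powr x) < ennreal (b powr y) \<longleftrightarrow> x < y"
  by (simp add: ennreal_less_iff)

text \<open>The terms below x decrease geometrically from the top level K, so their sum is a
  multiple of b^(K a), which is at most x^a.\<close>

lemma layer_sum_le:
  assumes "1 < b" "0 < a"
  shows "(\<Sum>\<^sup>+(k::int). levp b k a * (if lev b k < x then 1 else 0))
    \<le> geosum b a * ennpowr x a"
proof -
  consider "x = 0" | "x = top" | "0 < x" "x < top"
    by (metis less_top zero_less_iff_neq_zero)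
  then show ?thesis
  proof cases
    case 2
    have "geosum b a \<noteq> 0" using geosum_ge_1[of b a] assms by auto
    with 2 show ?thesis by (simp add: ennreal_mult_top)
  next
    case 3
    then obtain K where K: "lev b K < x" "x \<le> ennreal (b powr (real_of_int K + 1))"
      using level_exists assms by blast
    have "(\<Sum>\<^sup>+(k::int). levp b k a * (if lev b k < x then 1 else 0))
       \<le> (\<Sum>\<^sup>+(k::int). levp b K a * ennreal (b powr (- a * \<bar>real_of_int k - real_of_int K\<bar>)))"
    proof (intro nn_integral_mono)
      fix k :: int
      show "levp b k a * (if lev b k < x then 1 else 0)
          \<le> levp b K a * ennreal (b powr (- a * \<bar>real_of_int k - real_of_int K\<bar>))"
      proof (cases "lev b k < x")
        case True
        with K have "lev b k < ennreal (b powr (real_of_int K + 1))" by simp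
        then have "real_of_int k < real_of_int K + 1" using assms by (simp only: level_less_iff)
        then have "k \<le> K" by linarith
        then have "k * a = K * a + - a * \<bar>real_of_int k - real_of_int K\<bar>"
          by (simp add: abs_if algebra_simps)
        then show ?thesis
          using True by (simp only: powr_add if_True mult_1_right ennreal_mult powr_ge_zero order_refl)
      qed simp
    qed
    also have "\<dots> = levp b K a * geosum b a"
      by (subst nn_integral_cmult) (simp_all only: geosum_shift borel_measurable_count_space)
    also have "levp b K a = ennpowr (lev b K) a"
      by (simp add: ennpowr_ennreal powr_powr)
    also have "\<dots> * geosum b a \<le> ennpowr x a * geosum b a"
      using K assms by (intro mult_right_mono ennpowr_mono) auto
    finally show ?thesis by (simp only: mult.commute)
  qed simp
qed

text \<open>Serves the value \<infinity>, which lies above all levels and belongs to no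
  layer.\<close>

lemma nn_integral_int_unbounded:
  fixes m :: int and f :: "int \<Rightarrow> ennreal"
  assumes "1 < b" "0 < a" "\<And>j. m \<le> j \<Longrightarrow> levp b j a \<le> f j"
  shows "(\<Sum>\<^sup>+j. f j) = top"
proof (rule ccontr)
  assume "\<not> ?thesis"
  then obtain r where r: "(\<Sum>\<^sup>+j. f j) = ennreal r" "0 \<le> r"
    by (cases "\<integral>\<^sup>+j. f j \<partial>count_space UNIV") auto
  define j where "j = max m (\<lceil>log b (r + 1) / a\<rceil>)"
  have "log b (r + 1) / a \<le> j"
    by (simp add: j_def) linarith
  then have "log b (r + 1) \<le> j * a"
    using assms by (simp add: divide_le_eq)
  then have "r + 1 \<le> b powr (real_of_int j * a)"
    using assms r by (subst le_powr_iff) auto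
  then have "ennreal (r + 1) \<le> levp b j a" by (intro ennreal_leI)
  also have "\<dots> \<le> f j" by (rule assms(3)) (simp add: j_def)
  also have "\<dots> \<le> ennreal r" unfolding r(1)[symmetric] by (rule nn_integral_ge_point) simp
  finally show False using r by simp
qed

text \<open>One term suffices: if x lies in layer K, then b^((K+1) a) dominates x^a, and b^k < x
  forces k \<le> K. Keeping only the indices j \<ge> k lets the large part of a function be measured
  by its distribution function above the splitting height.\<close>

lemma layer_high:
  assumes "1 < b" "0 < a" "lev b k < x"
  shows "ennpowr x a \<le> (\<Sum>\<^sup>+(j::int). ennreal (b powr ((real_of_int j + 1) * a)) *
    (if k \<le> j \<and> lev b j < x then 1 else 0))"
proof (cases "x = top")
  case True
  have "(\<Sum>\<^sup>+(j::int). ennreal (b powr ((real_of_int j + 1) * a)) *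
    (if k \<le> j \<and> lev b j < x then 1 else 0)) = top"
    using assms True
    by (intro nn_integral_int_unbounded[of b a k]) (auto intro!: ennreal_leI powr_mono simp: algebra_simps)
  then show ?thesis by simp
next
  case False
  then obtain K where K: "lev b K < x" "x \<le> ennreal (b powr (real_of_int K + 1))"
    using level_exists assms by (metis less_top not_gr_zero not_less_zero)
  have "lev b k < ennreal (b powr (real_of_int K + 1))"
    using assms K by simp
  then have "real_of_int k < real_of_int K + 1" using assms by (simp only: level_less_iff)
  then have "k \<le> K" by linarith
  have "ennpowr x a \<le> ennpowr (ennreal (b powr (real_of_int K + 1))) a"
    using K assms by (intro ennpowr_mono) auto
  also have "\<dots> = ennreal (b powr ((real_of_int K + 1) * a)) * (if k \<le> K \<and> lev b K < x then 1 else 0)"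
    using K \<open>k \<le> K\<close> by (simp add: ennpowr_ennreal powr_powr)
  also have "\<dots> \<le> (\<Sum>\<^sup>+(j::int). ennreal (b powr ((real_of_int j + 1) * a)) *
    (if k \<le> j \<and> lev b j < x then 1 else 0))"
    by (rule nn_integral_ge_point) simp
  finally show ?thesis .
qed

text \<open>The companion for the small part of a function: x \<le> b^k forces K < k.\<close>

lemma layer_low:
  assumes "1 < b" "0 < a" "x \<le> lev b k"
  shows "ennpowr x a \<le> (\<Sum>\<^sup>+(j::int). ennreal (b powr ((real_of_int j + 1) * a)) *
    (if j < k \<and> lev b j < x then 1 else 0))"
proof (cases "x = 0")
  case False
  moreover have "x < top" using assms(3) by (simp add: le_less_trans)
  ultimately obtain K where K: "lev b K < x" "x \<le> ennreal (b powr (real_of_int K + 1))"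
    using level_exists assms by (metis zero_less_iff_neq_zero)
  have "lev b K < lev b k"
    using assms K by simp
  then have "K < k" using assms by (simp add: level_less_iff)
  have "ennpowr x a \<le> ennpowr (ennreal (b powr (real_of_int K + 1))) a"
    using K assms by (intro ennpowr_mono) auto
  also have "\<dots> = ennreal (b powr ((real_of_int K + 1) * a)) * (if K < k \<and> lev b K < x then 1 else 0)"
    using K \<open>K < k\<close> by (simp add: ennpowr_ennreal powr_powr)
  also have "\<dots> \<le> (\<Sum>\<^sup>+(j::int). ennreal (b powr ((real_of_int j + 1) * a)) *
    (if j < k \<and> lev b j < x then 1 else 0))"
    by (rule nn_integral_ge_point) simp
  finally show ?thesis .
qed simp

lemma layer_sum_ge:
  assumes "1 < b" "0 < a"
  shows "ennpowr x a \<le> ennreal (b powr a) * (\<Sum>\<^sup>+(j::int). levp b j a *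
    (if lev b j < x then 1 else 0))"
proof (cases "x = 0")
  case False
  then obtain k :: int where "lev b k < x"
  proof (cases "x = top")
    case False
    with \<open>x \<noteq> 0\<close> that show ?thesis
      using level_exists[of b x] assms by (metis less_top zero_less_iff_neq_zero)
  qed (use that[of 0] in auto)
  then have "ennpowr x a \<le> (\<Sum>\<^sup>+(j::int). ennreal (b powr ((real_of_int j + 1) * a)) *
    (if k \<le> j \<and> lev b j < x then 1 else 0))"
    using assms by (intro layer_high)
  also have "\<dots> \<le> (\<Sum>\<^sup>+(j::int). ennreal (b powr a) * (levp b j a *
    (if lev b j < x then 1 else 0)))"
    by (intro nn_integral_mono) (auto simp: algebra_simps powr_add simp flip: ennreal_mult)
  also have "\<dots> = ennreal (b powr a) * (\<Sum>\<^sup>+(j::int). levp b j a *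
    (if lev b j < x then 1 else 0))"
    by (rule nn_integral_cmult) simp
  finally show ?thesis .
qed simp

text \<open>Tonelli for the layers; \<open>P\<close> keeps those on one side of a splitting
  height.\<close>

lemma nn_integral_level_sum:
  fixes c :: "int \<Rightarrow> ennreal"
  assumes [measurable]: "\<phi> \<in> borel_measurable M"
  shows "(\<integral>\<^sup>+x. (\<Sum>\<^sup>+(j::int). c j * (if P j \<and> lev b j < \<phi> x then 1 else 0)) \<partial>M)
    = (\<Sum>\<^sup>+j. c j * (if P j then 1 else 0) * emeasure M {x \<in> space M. lev b j < \<phi> x})"
proof -
  have "(\<integral>\<^sup>+x. (\<Sum>\<^sup>+(j::int). c j * (if P j \<and> lev b j < \<phi> x then 1 else 0)) \<partial>M)
     = (\<Sum>\<^sup>+j. (\<integral>\<^sup>+x. c j * (if P j then 1 else 0) * indicator {x \<in> space M. lev b j < \<phi> x} x \<partial>M))"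
    by (subst nn_integral_count_space_nn_integral)
       (auto intro!: nn_integral_cong simp: indicator_def)
  also have "\<dots> = (\<Sum>\<^sup>+j. c j * (if P j then 1 else 0) * emeasure M {x \<in> space M. lev b j < \<phi> x})"
    by (intro nn_integral_cong nn_integral_cmult_indicator) auto
  finally show ?thesis .
qed

lemma borel_measurable_nn_integral_count_space:
  fixes f :: "'i::countable \<Rightarrow> 'a \<Rightarrow> ennreal"
  assumes "\<And>i. f i \<in> borel_measurable M"
  shows "(\<lambda>x. \<integral>\<^sup>+i. f i x \<partial>count_space UNIV) \<in> borel_measurable M"
proof -
  interpret sigma_finite_measure "count_space (UNIV :: 'i set)"
    by (rule sigma_finite_measure_count_space)
  have "(\<lambda>z. f (snd z) (fst z)) \<in> borel_measurable (M \<Otimes>\<^sub>M count_space (UNIV :: 'i set))"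
  proof (rule measurable_compose_countable'[where I=UNIV and g=snd])
    fix i
    show "(\<lambda>z. f i (fst z)) \<in> borel_measurable (M \<Otimes>\<^sub>M count_space (UNIV :: 'i set))"
      by (rule measurable_compose[OF measurable_fst assms])
  qed auto
  then show ?thesis
    by (intro borel_measurable_nn_integral[of "\<lambda>x i. f i x" M]) (simp add: case_prod_beta')
qed

text \<open>For q = p the outer power disappears, and summing the layers pointwise gives the p-th
  power of the function. This is the passage between Lebesgue bounds and the interpolation
  theorem.\<close>

lemma dlor_diag:
  assumes "1 < b" "0 < p" and [measurable]: "\<phi> \<in> borel_measurable M"
  shows "dlor b p p M \<phi> \<le> geosum b p * (\<integral>\<^sup>+x. ennpowr (\<phi> x) p \<partial>M)"
    and "(\<integral>\<^sup>+x. ennpowr (\<phi> x) p \<partial>M) \<le> ennreal (b powr p) * dlor b p p M \<phi>"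
proof -
  have eq: "dlor b p p M \<phi> = (\<integral>\<^sup>+x. (\<Sum>\<^sup>+(j::int). levp b j p *
      (if lev b j < \<phi> x then 1 else 0)) \<partial>M)"
    using nn_integral_level_sum[OF assms(3), of "\<lambda>j. levp b j p" "\<lambda>_. True" b] assms(2)
    unfolding dlor_def by simp
  have meas: "(\<lambda>x. \<integral>\<^sup>+(j::int). levp b j p *
      (if lev b j < \<phi> x then 1 else 0) \<partial>count_space UNIV) \<in> borel_measurable M"
  proof (rule borel_measurable_nn_integral_count_space)
    fix j :: int
    show "(\<lambda>x. levp b j p *
      (if lev b j < \<phi> x then 1 else 0)) \<in> borel_measurable M"
      by measurable
  qed
  have "dlor b p p M \<phi> \<le> (\<integral>\<^sup>+x. geosum b p * ennpowr (\<phi> x) p \<partial>M)"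
    unfolding eq by (rule nn_integral_mono) (rule layer_sum_le[OF assms(1,2)])
  also have "\<dots> = geosum b p * (\<integral>\<^sup>+x. ennpowr (\<phi> x) p \<partial>M)"
    by (rule nn_integral_cmult) measurable
  finally show "dlor b p p M \<phi> \<le> geosum b p * (\<integral>\<^sup>+x. ennpowr (\<phi> x) p \<partial>M)" .
  have "(\<integral>\<^sup>+x. ennpowr (\<phi> x) p \<partial>M) \<le> (\<integral>\<^sup>+x. ennreal (b powr p) * (\<Sum>\<^sup>+(j::int). levp b j p *
      (if lev b j < \<phi> x then 1 else 0)) \<partial>M)"
    by (rule nn_integral_mono) (rule layer_sum_ge[OF assms(1,2)])
  also have "\<dots> = ennreal (b powr p) * dlor b p p M \<phi>"
    unfolding eq by (rule nn_integral_cmult) (rule meas)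
  finally show "(\<integral>\<^sup>+x. ennpowr (\<phi> x) p \<partial>M) \<le> ennreal (b powr p) * dlor b p p M \<phi>" .
qed

section \<open>Marcinkiewicz interpolation\<close>

definition weak_type :: "'a measure \<Rightarrow> (('a \<Rightarrow> ennreal) \<Rightarrow> 'a \<Rightarrow> ennreal) \<Rightarrow> real \<Rightarrow> bool" where
  "weak_type M T p \<longleftrightarrow> (\<exists>C<top. \<forall>f\<in>borel_measurable M. \<forall>l>0.
     ennreal (l powr p) * emeasure M {x \<in> space M. ennreal l < T f x}
       \<le> C * (\<integral>\<^sup>+x. ennpowr (f x) p \<partial>M))"

text \<open>Chebyshev's inequality.\<close>

lemma weak_type_strong:
  assumes "0 < p" "C < top"
    and T: "\<And>f. f \<in> borel_measurable M \<Longrightarrow> T f \<in> borel_measurable M"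
    and strong: "\<And>f. f \<in> borel_measurable M \<Longrightarrow>
      (\<integral>\<^sup>+x. ennpowr (T f x) p \<partial>M) \<le> C * (\<integral>\<^sup>+x. ennpowr (f x) p \<partial>M)"
  shows "weak_type M T p"
  unfolding weak_type_def
proof (intro exI[of _ C] conjI ballI allI impI)
  fix f :: "'a \<Rightarrow> ennreal" and l :: real
  assume f: "f \<in> borel_measurable M" and "0 < l"
  have [measurable]: "T f \<in> borel_measurable M" using T f by blast
  have "ennreal (l powr p) * emeasure M {x \<in> space M. ennreal l < T f x}
      = (\<integral>\<^sup>+x. ennreal (l powr p) * indicator {x \<in> space M. ennreal l < T f x} x \<partial>M)"
    by (rule nn_integral_cmult_indicator[symmetric]) measurable
  also have "\<dots> \<le> (\<integral>\<^sup>+x. ennpowr (T f x) p \<partial>M)"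
  proof (rule nn_integral_mono)
    fix x
    have "ennreal l < T f x \<Longrightarrow> ennpowr (ennreal l) p \<le> ennpowr (T f x) p"
      using assms(1) by (intro ennpowr_mono) auto
    then show "ennreal (l powr p) * indicator {x \<in> space M. ennreal l < T f x} x \<le> ennpowr (T f x) p"
      using \<open>0 < l\<close> by (auto simp: indicator_def ennpowr_ennreal)
  qed
  also note strong[OF f]
  finally show "ennreal (l powr p) * emeasure M {x \<in> space M. ennreal l < T f x}
       \<le> C * (\<integral>\<^sup>+x. ennpowr (f x) p \<partial>M)" .
qed fact

lemma ennreal_powr_add: "ennreal (b powr (x + y)) = ennreal (b powr x) * ennreal (b powr y)"
  by (simp add: powr_add ennreal_mult)

text \<open>The distribution function of \<open>T f\<close> is estimated by a convolution of that of \<open>f\<close> with an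
  exponentially decaying kernel: split \<open>f\<close> at the height \<open>b\<^sup>k\<close>.\<close>

lemma marcinkiewicz_kernel:
  assumes b: "1 < b" and p: "0 < p0" "p0 < A" "A < p1"
    and T: "\<And>f. f \<in> borel_measurable M \<Longrightarrow> T f \<in> borel_measurable M"
    and sub: "\<And>f g x. f \<in> borel_measurable M \<Longrightarrow> g \<in> borel_measurable M \<Longrightarrow>
      T (\<lambda>x. f x + g x) x \<le> T f x + T g x"
    and weak: "weak_type M T p0" "weak_type M T p1"
  obtains D \<epsilon> where "D < top" "0 < \<epsilon>"
    "\<And>f k. f \<in> borel_measurable M \<Longrightarrow>
      levp b k A * emeasure M {x \<in> space M. lev b k < T f x}
      \<le> (\<Sum>\<^sup>+j. D * ennreal (b powr (- (2 * \<epsilon>) * \<bar>real_of_int j - real_of_int k\<bar>)) *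
          (levp b j A * emeasure M {x \<in> space M. lev b j < f x}))"
proof -
  obtain C0 where C0: "C0 < top" "\<And>f l. f \<in> borel_measurable M \<Longrightarrow> 0 < l \<Longrightarrow>
      ennreal (l powr p0) * emeasure M {x \<in> space M. ennreal l < T f x}
       \<le> C0 * (\<integral>\<^sup>+x. ennpowr (f x) p0 \<partial>M)"
    using weak(1) unfolding weak_type_def by blast
  obtain C1 where C1: "C1 < top" "\<And>f l. f \<in> borel_measurable M \<Longrightarrow> 0 < l \<Longrightarrow>
      ennreal (l powr p1) * emeasure M {x \<in> space M. ennreal l < T f x}
       \<le> C1 * (\<integral>\<^sup>+x. ennpowr (f x) p1 \<partial>M)"
    using weak(2) unfolding weak_type_def by blast
  \<comment> \<open>2^p pays for halving the level, b^p for the upper ends b^(j+1) of the layers.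
    The decay rate 2\<epsilon> is the smaller distance of A to p0 and p1; it is split into two
    halves because one of them is spent on summability later.\<close>
  define D where "D = ennreal (2 powr p0) * ennreal (b powr p0) * C0 + ennreal (2 powr p1) * ennreal (b powr p1) * C1"
  define \<epsilon> where "\<epsilon> = min (A - p0) (p1 - A) / 2"
  have "D < top" using C0(1) C1(1) by (simp add: D_def ennreal_mult_less_top)
  moreover have "0 < \<epsilon>" using p by (simp add: \<epsilon>_def)
  moreover have "levp b k A * emeasure M {x \<in> space M. lev b k < T f x}
      \<le> (\<Sum>\<^sup>+j. D * ennreal (b powr (- (2 * \<epsilon>) * \<bar>real_of_int j - real_of_int k\<bar>)) *
          (levp b j A * emeasure M {x \<in> space M. lev b j < f x}))"
    if f[measurable]: "f \<in> borel_measurable M" for f k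
  proof -
    define d where "d j = emeasure M {x \<in> space M. lev b j < f x}" for j :: int
    define f0 where "f0 x = (if lev b k < f x then f x else 0)" for x
    define f1 where "f1 x = (if lev b k < f x then 0 else f x)" for x
    have [measurable]: "f0 \<in> borel_measurable M" "f1 \<in> borel_measurable M"
      unfolding f0_def f1_def by measurable
    have [measurable]: "T f0 \<in> borel_measurable M" "T f1 \<in> borel_measurable M"
      by (rule T; measurable)+
    \<comment> \<open>Where T f exceeds b^k, T of the large part or T of the small part exceeds half
      of it, by sublinearity.\<close>
    define l where "l = b powr real_of_int k / 2"
    have l: "0 < l" using b by (simp add: l_def)
    have lp: "ennreal (l powr p) * ennreal (2 powr p) = levp b k p" for p
      by (simp add: l_def powr_divide powr_powr flip: ennreal_mult)
    have split: "emeasure M {x \<in> space M. lev b k < T f x}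
       \<le> emeasure M {x \<in> space M. ennreal l < T f0 x} + emeasure M {x \<in> space M. ennreal l < T f1 x}"
    proof -
      have eq: "(\<lambda>x. f0 x + f1 x) = f" by (auto simp: f0_def f1_def)
      have "T f x \<le> T f0 x + T f1 x" for x
        using sub[of f0 f1 x] by (simp add: eq)
      moreover have "lev b k = ennreal l + ennreal l"
        by (simp add: l_def flip: ennreal_plus)
      ultimately have "ennreal l < T f0 x \<or> ennreal l < T f1 x" if "lev b k < T f x" for x
        using that add_mono[of "T f0 x" "ennreal l" "T f1 x" "ennreal l"] by (metis leD not_le_imp_less order_trans)
      then have "{x \<in> space M. lev b k < T f x}
          \<subseteq> {x \<in> space M. ennreal l < T f0 x} \<union> {x \<in> space M. ennreal l < T f1 x}"
        by blast
      then have "emeasure M {x \<in> space M. lev b k < T f x}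
          \<le> emeasure M ({x \<in> space M. ennreal l < T f0 x} \<union> {x \<in> space M. ennreal l < T f1 x})"
        by (rule emeasure_mono) measurable
      also have "\<dots> \<le> emeasure M {x \<in> space M. ennreal l < T f0 x} + emeasure M {x \<in> space M. ennreal l < T f1 x}"
        by (rule emeasure_subadditive) measurable
      finally show ?thesis .
    qed
    have I0: "(\<integral>\<^sup>+x. ennpowr (f0 x) p0 \<partial>M)
        \<le> (\<Sum>\<^sup>+j. ennreal (b powr ((real_of_int j + 1) * p0)) * (if k \<le> j then 1 else 0) * d j)"
      unfolding d_def nn_integral_level_sum[OF f, symmetric]
      using layer_high[OF b p(1), of k] by (intro nn_integral_mono) (auto simp: f0_def)
    have I1: "(\<integral>\<^sup>+x. ennpowr (f1 x) p1 \<partial>M)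
        \<le> (\<Sum>\<^sup>+j. ennreal (b powr ((real_of_int j + 1) * p1)) * (if j < k then 1 else 0) * d j)"
      unfolding d_def nn_integral_level_sum[OF f, symmetric]
      using layer_low[OF b, of p1 _ k] p by (intro nn_integral_mono) (auto simp: f1_def not_less)
    \<comment> \<open>Treats both parts at once: g is the part, p its exponent, \<open>P\<close> the
      layers it can occupy. The inequality \<open>exps\<close> is where the splitting pays: it holds
      for p0 < A on the layers j \<ge> k and for p1 > A on the layers j < k.\<close>
    have piece: "levp b k A * emeasure M {x \<in> space M. ennreal l < T g x}
        \<le> (\<Sum>\<^sup>+j. ennreal (2 powr p) * ennreal (b powr p) * C * ennreal (b powr (- (2 * \<epsilon>) * \<bar>real_of_int j - real_of_int k\<bar>)) *
          (levp b j A * d j))"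
      if W: "ennreal (l powr p) * emeasure M {x \<in> space M. ennreal l < T g x} \<le> C * (\<integral>\<^sup>+x. ennpowr (g x) p \<partial>M)"
      and I: "(\<integral>\<^sup>+x. ennpowr (g x) p \<partial>M)
        \<le> (\<Sum>\<^sup>+j. ennreal (b powr ((real_of_int j + 1) * p)) * (if P j then 1 else 0) * d j)"
      and exps: "\<And>j. P j \<Longrightarrow> real_of_int k * (A - p) + real_of_int j * p
        \<le> - (2 * \<epsilon>) * \<bar>real_of_int j - real_of_int k\<bar> + real_of_int j * A"
      for g p C P
    proof -
      have "levp b k A = ennreal (b powr (real_of_int k * (A - p))) * (ennreal (l powr p) * ennreal (2 powr p))"
        unfolding lp ennreal_powr_add[symmetric] by (simp add: algebra_simps)
      then have "levp b k A * emeasure M {x \<in> space M. ennreal l < T g x}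
         = ennreal (b powr (real_of_int k * (A - p))) * ennreal (2 powr p) * (ennreal (l powr p) * emeasure M {x \<in> space M. ennreal l < T g x})"
        by (simp only: mult_ac)
      also have "\<dots> \<le> ennreal (b powr (real_of_int k * (A - p))) * ennreal (2 powr p) *
          (C * (\<Sum>\<^sup>+j. ennreal (b powr ((real_of_int j + 1) * p)) * (if P j then 1 else 0) * d j))"
        by (intro mult_left_mono order_trans[OF W] I) auto
      also have "\<dots> = (\<Sum>\<^sup>+j. (ennreal (b powr (real_of_int k * (A - p))) * ennreal (2 powr p) * C) *
           (ennreal (b powr ((real_of_int j + 1) * p)) * (if P j then 1 else 0) * d j))"
        by (subst nn_integral_cmult) (simp_all only: mult.assoc borel_measurable_count_space)
      also have "\<dots> \<le> (\<Sum>\<^sup>+j. ennreal (2 powr p) * ennreal (b powr p) * C * ennreal (b powr (- (2 * \<epsilon>) * \<bar>real_of_int j - real_of_int k\<bar>)) *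
          (levp b j A * d j))"
      proof (intro nn_integral_mono)
        fix j :: int
        show "(ennreal (b powr (real_of_int k * (A - p))) * ennreal (2 powr p) * C) *
           (ennreal (b powr ((real_of_int j + 1) * p)) * (if P j then 1 else 0) * d j)
          \<le> ennreal (2 powr p) * ennreal (b powr p) * C * ennreal (b powr (- (2 * \<epsilon>) * \<bar>real_of_int j - real_of_int k\<bar>)) *
          (levp b j A * d j)"
        proof (cases "P j")
          case True
          have "ennreal (b powr (real_of_int k * (A - p))) * ennreal (b powr ((real_of_int j + 1) * p))
             = ennreal (b powr p) * ennreal (b powr (real_of_int k * (A - p) + real_of_int j * p))"
            unfolding ennreal_powr_add[symmetric] by (simp add: algebra_simps)
          also have "\<dots> \<le> ennreal (b powr p) * ennreal (b powr (- (2 * \<epsilon>) * \<bar>real_of_int j - real_of_int k\<bar> + real_of_int j * A))"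
            using exps[OF True] b by (intro mult_left_mono ennreal_leI powr_mono) auto
          finally have "ennreal (b powr (real_of_int k * (A - p))) * ennreal (b powr ((real_of_int j + 1) * p)) * (ennreal (2 powr p) * C * d j)
            \<le> ennreal (b powr p) * ennreal (b powr (- (2 * \<epsilon>) * \<bar>real_of_int j - real_of_int k\<bar> + real_of_int j * A)) * (ennreal (2 powr p) * C * d j)"
            by (rule mult_right_mono) simp
          then show ?thesis
            unfolding ennreal_powr_add if_P[OF True] mult_1_right by (simp only: mult_ac)
        qed simp
      qed
      finally show ?thesis .
    qed
    have e0: "real_of_int k * (A - p0) + real_of_int j * p0
        \<le> - (2 * \<epsilon>) * \<bar>real_of_int j - real_of_int k\<bar> + real_of_int j * A" if "k \<le> j" for j
    proof -
      have "2 * \<epsilon> * (real_of_int j - real_of_int k) \<le> (A - p0) * (real_of_int j - real_of_int k)"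
        using that by (intro mult_right_mono) (auto simp: \<epsilon>_def)
      then show ?thesis using that by (simp add: algebra_simps)
    qed
    have e1: "real_of_int k * (A - p1) + real_of_int j * p1
        \<le> - (2 * \<epsilon>) * \<bar>real_of_int j - real_of_int k\<bar> + real_of_int j * A" if "j < k" for j
    proof -
      have "2 * \<epsilon> * (real_of_int k - real_of_int j) \<le> (p1 - A) * (real_of_int k - real_of_int j)"
        using that by (intro mult_right_mono) (auto simp: \<epsilon>_def)
      then show ?thesis using that by (simp add: algebra_simps)
    qed
    have "levp b k A * emeasure M {x \<in> space M. lev b k < T f x}
      \<le> levp b k A * emeasure M {x \<in> space M. ennreal l < T f0 x}
        + levp b k A * emeasure M {x \<in> space M. ennreal l < T f1 x}"
      unfolding distrib_left[symmetric] by (intro mult_left_mono split) auto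
    also have "\<dots> \<le> (\<Sum>\<^sup>+j. ennreal (2 powr p0) * ennreal (b powr p0) * C0 * ennreal (b powr (- (2 * \<epsilon>) * \<bar>real_of_int j - real_of_int k\<bar>)) *
          (levp b j A * d j))
      + (\<Sum>\<^sup>+j. ennreal (2 powr p1) * ennreal (b powr p1) * C1 * ennreal (b powr (- (2 * \<epsilon>) * \<bar>real_of_int j - real_of_int k\<bar>)) *
          (levp b j A * d j))"
      by (intro add_mono piece[OF C0(2) I0] piece[OF C1(2) I1] e0 e1 l) measurable
    also have "\<dots> = (\<Sum>\<^sup>+j. D * ennreal (b powr (- (2 * \<epsilon>) * \<bar>real_of_int j - real_of_int k\<bar>)) *
          (levp b j A * d j))"
      by (subst nn_integral_add[symmetric]) (simp_all only: D_def distrib_right borel_measurable_count_space)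
    finally show ?thesis unfolding d_def .
  qed
  ultimately show thesis by (rule that)
qed

text \<open>A discrete Schur test with the kernel of \<open>marcinkiewicz_kernel\<close>, raised to
  the power \<beta> = B/A. Half of the decay is spent on \<open>ennpowr_sum_le\<close>; the other
  half survives the power and is summed over k.\<close>

lemma marcinkiewicz:
  assumes b: "1 < b" and p: "0 < p0" "p0 < A" "A < p1" and B: "0 < B"
    and T: "\<And>f. f \<in> borel_measurable M \<Longrightarrow> T f \<in> borel_measurable M"
    and sub: "\<And>f g x. f \<in> borel_measurable M \<Longrightarrow> g \<in> borel_measurable M \<Longrightarrow>
      T (\<lambda>x. f x + g x) x \<le> T f x + T g x"
    and weak: "weak_type M T p0" "weak_type M T p1"
  shows "\<exists>C<top. \<forall>f\<in>borel_measurable M. dlor b A B M (T f) \<le> C * dlor b A B M f"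
proof -
  obtain D \<epsilon> where D: "D < top" "0 < \<epsilon>" and ker: "\<And>f k. f \<in> borel_measurable M \<Longrightarrow>
      levp b k A * emeasure M {x \<in> space M. lev b k < T f x}
      \<le> (\<Sum>\<^sup>+j. D * ennreal (b powr (- (2 * \<epsilon>) * \<bar>real_of_int j - real_of_int k\<bar>)) *
          (levp b j A * emeasure M {x \<in> space M. lev b j < f x}))"
    using marcinkiewicz_kernel[OF b p T sub weak] by blast
  define \<beta> where "\<beta> = B / A"
  have A: "0 < A" using p by simp
  have \<beta>: "0 < \<beta>" using B A by (simp add: \<beta>_def)
  define C where "C = ennpowr (D * geosum b \<epsilon>) \<beta> * geosum b (\<epsilon> * \<beta>)"
  have "C < top"
    using D b \<beta> by (simp add: C_def ennreal_mult_less_top geosum_less_top)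
  moreover have "dlor b A B M (T f) \<le> C * dlor b A B M f" if f: "f \<in> borel_measurable M" for f
  proof -
    define d where "d j = emeasure M {x \<in> space M. lev b j < f x}" for j :: int
    define dT where "dT j = emeasure M {x \<in> space M. lev b j < T f x}" for j :: int
    define x where "x j = levp b j A * d j" for j
    have pw: "ennpowr (levp b k A * e) \<beta> = levp b k B * ennpowr e (B / A)" for k e
      using A unfolding ennpowr_mult[OF \<beta>] by (simp add: ennpowr_ennreal powr_powr \<beta>_def)
    have "dlor b A B M (T f) = (\<Sum>\<^sup>+k. ennpowr (levp b k A * dT k) \<beta>)"
      unfolding dlor_def dT_def pw ..
    also have "\<dots> \<le> (\<Sum>\<^sup>+k. ennpowr (D * geosum b \<epsilon>) \<beta> *
        (\<Sum>\<^sup>+j. ennreal (b powr (- (\<epsilon> * \<beta>) * \<bar>real_of_int j - real_of_int k\<bar>)) * ennpowr (x j) \<beta>))"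
    proof (rule nn_integral_mono)
      fix k :: int
      let ?t = "\<lambda>j. ennreal (b powr (- \<epsilon> * \<bar>real_of_int j - real_of_int k\<bar>))"
      have "ennpowr (levp b k A * dT k) \<beta>
          \<le> ennpowr (\<Sum>\<^sup>+j. D * ?t j * ?t j * x j) \<beta>"
      proof (intro ennpowr_mono)
        have "D * ?t j * ?t j = D * ennreal (b powr (- (2 * \<epsilon>) * \<bar>real_of_int j - real_of_int k\<bar>))" for j
          unfolding mult.assoc ennreal_powr_add[symmetric] by (simp add: algebra_simps)
        then show "levp b k A * dT k \<le> (\<Sum>\<^sup>+j. D * ?t j * ?t j * x j)"
          using ker[OF f, of k] by (simp only: x_def d_def dT_def)
      qed (use \<beta> in simp)
      also have "\<dots> \<le> ennpowr (\<Sum>\<^sup>+j. D * ?t j) \<beta> * (\<Sum>\<^sup>+j. ennpowr (?t j * x j) \<beta>)"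
        by (rule ennpowr_sum_le[OF \<beta>])
      also have "(\<Sum>\<^sup>+j. D * ?t j) = D * geosum b \<epsilon>"
        by (subst nn_integral_cmult) (simp_all only: geosum_shift borel_measurable_count_space)
      also have "(\<lambda>j. ennpowr (?t j * x j) \<beta>) = (\<lambda>j. ennreal (b powr (- (\<epsilon> * \<beta>) * \<bar>real_of_int j - real_of_int k\<bar>)) * ennpowr (x j) \<beta>)"
        unfolding ennpowr_mult[OF \<beta>] by (simp add: ennpowr_ennreal powr_powr mult_ac)
      finally show "ennpowr (levp b k A * dT k) \<beta> \<le> ennpowr (D * geosum b \<epsilon>) \<beta> *
        (\<Sum>\<^sup>+j. ennreal (b powr (- (\<epsilon> * \<beta>) * \<bar>real_of_int j - real_of_int k\<bar>)) * ennpowr (x j) \<beta>)" .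
    qed
    also have "\<dots> = ennpowr (D * geosum b \<epsilon>) \<beta> * (\<Sum>\<^sup>+k. (\<Sum>\<^sup>+j. ennreal (b powr (- (\<epsilon> * \<beta>) * \<bar>real_of_int j - real_of_int k\<bar>)) * ennpowr (x j) \<beta>))"
      by (rule nn_integral_cmult) simp
    also have "(\<Sum>\<^sup>+k. (\<Sum>\<^sup>+j. ennreal (b powr (- (\<epsilon> * \<beta>) * \<bar>real_of_int j - real_of_int k\<bar>)) * ennpowr (x j) \<beta>))
      = (\<integral>\<^sup>+j. (\<Sum>\<^sup>+k. ennreal (b powr (- (\<epsilon> * \<beta>) * \<bar>real_of_int j - real_of_int k\<bar>)) * ennpowr (x j) \<beta>) \<partial>count_space (UNIV :: int set))"
      by (rule nn_integral_count_space_nn_integral) auto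
    also have "\<dots> = (\<Sum>\<^sup>+j. geosum b (\<epsilon> * \<beta>) * ennpowr (x j) \<beta>)"
    proof (rule nn_integral_cong)
      fix j :: int
      show "(\<Sum>\<^sup>+k. ennreal (b powr (- (\<epsilon> * \<beta>) * \<bar>real_of_int j - real_of_int k\<bar>)) * ennpowr (x j) \<beta>) = geosum b (\<epsilon> * \<beta>) * ennpowr (x j) \<beta>"
        unfolding geosum_shift[of b "\<epsilon> * \<beta>" j, symmetric] abs_minus_commute[of "real_of_int j"]
        by (rule nn_integral_multc) simp
    qed
    also have "\<dots> = geosum b (\<epsilon> * \<beta>) * (\<Sum>\<^sup>+j. ennpowr (x j) \<beta>)"
      by (rule nn_integral_cmult) simp
    also have "(\<Sum>\<^sup>+j. ennpowr (x j) \<beta>) = dlor b A B M f"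
      unfolding dlor_def x_def d_def pw ..
    finally show ?thesis by (simp only: C_def mult.assoc)
  qed
  ultimately show ?thesis by blast
qed

section \<open>Cubes and the maximal function\<close>

definition cube :: "real^'n \<Rightarrow> real \<Rightarrow> (real^'n) set" where
  "cube a l = cbox a (a + (\<chi> i. l))"

lemma mem_cube: "x \<in> cube a l \<longleftrightarrow> (\<forall>i. a $ i \<le> x $ i \<and> x $ i \<le> a $ i + l)"
  by (simp add: cube_def mem_box_cart)

lemma cubes_eq: "cubes = {cube a l | a l. 0 < l}"
  by (simp add: cubes_def cube_def)

lemma sets_cube [measurable]: "cube a l \<in> sets lebesgue" "cube a l \<in> sets borel"
  by (auto simp: cube_def)

lemma emeasure_cube:
  fixes a :: "real^'n"
  assumes "0 \<le> l" shows "emeasure lebesgue (cube a l) = ennreal (l ^ CARD('n))"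
proof -
  have ne: "cbox a (a + (\<chi> i. l)) \<noteq> {}"
    using assms by (auto simp: interval_ne_empty_cart)
  have "emeasure lebesgue (cube a l) = emeasure lborel (cbox a (a + (\<chi> i. l)))"
    unfolding cube_def by simp
  also have "\<dots> = ennreal (measure lborel (cbox a (a + (\<chi> i. l))))"
    by (rule emeasure_eq_ennreal_measure) (simp add: emeasure_lborel_cbox_eq)
  also have "measure lborel (cbox a (a + (\<chi> i. l))) = l ^ CARD('n)"
    by (subst content_cbox_cart[OF ne]) simp
  finally show ?thesis .
qed

definition centre :: "real^'n \<Rightarrow> real \<Rightarrow> real^'n" where
  "centre a l = a + (\<chi> i. l / 2)"

lemma cube_subset_cball:
  fixes a :: "real^'n"
  shows "cube a l \<subseteq> cball (centre a l) (real CARD('n) * l)"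
proof
  fix x assume x: "x \<in> cube a l"
  then have "0 \<le> l" by (auto simp: mem_cube intro: order_trans dest!: spec[of _ undefined])
  have "norm (x - centre a l) \<le> (\<Sum>i\<in>UNIV. \<bar>(x - centre a l) $ i\<bar>)"
    by (rule norm_le_l1_cart)
  also have "\<dots> \<le> (\<Sum>i\<in>(UNIV :: 'n set). l)"
  proof (rule sum_mono)
    fix i
    have "a $ i \<le> x $ i" "x $ i \<le> a $ i + l" using x by (auto simp: mem_cube)
    then show "\<bar>(x - centre a l) $ i\<bar> \<le> l" by (simp add: centre_def abs_le_iff)
  qed
  finally show "x \<in> cball (centre a l) (real CARD('n) * l)"
    by (simp add: dist_norm norm_minus_commute)
qed

text \<open>The factor arises from passing through balls. With d the dimension, a cube of side l
  lies in a ball of radius d l by the l^1 bound of the norm, Vitali's lemma multiplies the radius by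
  5, and that ball lies in a cube of side 10 d l.\<close>

definition big_cube :: "real^'n \<Rightarrow> real \<Rightarrow> (real^'n) set" where
  "big_cube a l = cube (centre a l - (\<chi> i. 5 * (real CARD('n) * l))) (10 * real CARD('n) * l)"

lemma mem_big_cube:
  fixes a :: "real^'n"
  shows "x \<in> big_cube a l \<longleftrightarrow> (\<forall>i. \<bar>x $ i - centre a l $ i\<bar> \<le> 5 * (real CARD('n) * l))"
  by (auto simp: big_cube_def mem_cube abs_le_iff algebra_simps)

lemma cball_subset_big_cube:
  fixes a :: "real^'n"
  shows "cball (centre a l) (5 * (real CARD('n) * l)) \<subseteq> big_cube a l"
proof
  fix x assume "x \<in> cball (centre a l) (5 * (real CARD('n) * l))"
  then have "norm (x - centre a l) \<le> 5 * (real CARD('n) * l)"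
    by (simp add: dist_norm norm_minus_commute)
  moreover have "\<bar>x $ i - centre a l $ i\<bar> \<le> norm (x - centre a l)" for i
    using component_le_norm_cart[of "x - centre a l" i] by simp
  ultimately show "x \<in> big_cube a l"
    unfolding mem_big_cube by (meson order_trans)
qed

lemma cube_subset_big_cube: "0 \<le> l \<Longrightarrow> cube a l \<subseteq> big_cube a l"
  for a :: "real^'n"
proof -
  assume "0 \<le> l"
  then have "cball (centre a l) (real CARD('n) * l) \<subseteq> cball (centre a l) (5 * (real CARD('n) * l))"
    by (intro subset_cball) simp
  then show ?thesis using cube_subset_cball cball_subset_big_cube by blast
qed

text \<open>Transfer from balls: the cubes inherit disjointness from the surrounding balls, and the
  five-fold balls lie in \<open>big_cube\<close>. The common bound on the sides is a condition of
  the covering lemma.\<close>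

lemma Vitali_cubes:
  fixes F :: "((real^'n) \<times> real) set"
  assumes F: "\<And>a l. (a, l) \<in> F \<Longrightarrow> 0 < l \<and> l \<le> B"
  obtains C where "countable C" "C \<subseteq> F" "disjoint_family_on (\<lambda>(a, l). cube a l) C"
    "(\<Union>(a, l)\<in>F. cube a l) \<subseteq> (\<Union>(a, l)\<in>C. big_cube a l)"
proof -
  let ?c = "\<lambda>(a, l). centre a l" and ?r = "\<lambda>(a, l). real CARD('n) * l"
  have 1: "(\<Union>(a, l)\<in>F. cube a l) \<subseteq> (\<Union>i\<in>F. cball (?c i) (?r i))"
    using cube_subset_cball by fastforce
  have 2: "0 < ?r i \<and> ?r i \<le> real CARD('n) * B" if "i \<in> F" for i
    using F[of "fst i" "snd i"] that by (auto simp: case_prod_beta)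
  obtain C where C: "countable C" "C \<subseteq> F"
     "pairwise (\<lambda>i j. disjnt (cball (?c i) (?r i)) (cball (?c j) (?r j))) C"
     "(\<Union>(a, l)\<in>F. cube a l) \<subseteq> (\<Union>i\<in>C. cball (?c i) (5 * ?r i))"
    using Vitali_covering_lemma_cballs[OF 1 2] by blast
  show thesis
  proof (rule that[OF C(1,2)])
    show "disjoint_family_on (\<lambda>(a, l). cube a l) C"
      unfolding disjoint_family_on_def
    proof (intro ballI impI)
      fix i j assume ij: "i \<in> C" "j \<in> C" "i \<noteq> j"
      then have "cball (?c i) (?r i) \<inter> cball (?c j) (?r j) = {}"
        using C(3) unfolding pairwise_def disjnt_def by blast
      moreover have "(case i of (a, l) \<Rightarrow> cube a l) \<subseteq> cball (?c i) (?r i)" for i :: "(real^'n) \<times> real"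
        using cube_subset_cball[of "fst i" "snd i"] by (simp add: case_prod_beta)
      ultimately show "(case i of (a, l) \<Rightarrow> cube a l) \<inter> (case j of (a, l) \<Rightarrow> cube a l) = {}"
        by blast
    qed
    have "cball (?c i) (5 * ?r i) \<subseteq> (case i of (a, l) \<Rightarrow> big_cube a l)" for i :: "(real^'n) \<times> real"
      using cball_subset_big_cube[of "fst i" "snd i"] by (simp add: case_prod_beta)
    then show "(\<Union>(a, l)\<in>F. cube a l) \<subseteq> (\<Union>(a, l)\<in>C. big_cube a l)"
      using C(4) by blast
  qed
qed

lemma nn_integral_count_space_disjoint:
  fixes f :: "'a \<Rightarrow> ennreal"
  assumes "disjoint_family_on R C"
  shows "(\<integral>\<^sup>+i. f x * indicator (R i) x \<partial>count_space C) = f x * indicator (\<Union>i\<in>C. R i) x"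
proof (cases "x \<in> (\<Union>i\<in>C. R i)")
  case True
  then obtain i0 where i0: "i0 \<in> C" "x \<in> R i0" by blast
  have "(\<integral>\<^sup>+i. f x * indicator (R i) x \<partial>count_space C) = (\<integral>\<^sup>+i. f x * indicator {i0} i \<partial>count_space C)"
    using assms i0 by (intro nn_integral_cong) (auto simp: indicator_def disjoint_family_on_def)
  also have "\<dots> = f x" using i0 by (subst nn_integral_cmult_indicator) auto
  finally show ?thesis using True by simp
next
  case False
  then have "(\<integral>\<^sup>+i. f x * indicator (R i) x \<partial>count_space C) = (\<integral>\<^sup>+i. 0 \<partial>count_space C)"
    by (intro nn_integral_cong) auto
  with False show ?thesis by simp
qed

text \<open>The form in which Vitali families are used: local bounds on dilated cubes by integrals
  over the selected cubes add up, because the former cover S and the latter are disjoint subsets of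
  Q.\<close>

lemma covering_integral_le:
  fixes f g :: "'a \<Rightarrow> ennreal"
  assumes C: "countable C" and disj: "disjoint_family_on R C"
    and [measurable]: "f \<in> borel_measurable M" "g \<in> borel_measurable M" "S \<in> sets M"
      "\<And>i. i \<in> C \<Longrightarrow> R i \<in> sets M" "\<And>i. i \<in> C \<Longrightarrow> B i \<in> sets M"
    and cover: "S \<subseteq> (\<Union>i\<in>C. B i)" and sub: "\<And>i. i \<in> C \<Longrightarrow> R i \<subseteq> Q"
    and le: "\<And>i. i \<in> C \<Longrightarrow> (\<integral>\<^sup>+x\<in>B i. g x \<partial>M) \<le> c * (\<integral>\<^sup>+x\<in>R i. f x \<partial>M)"
  shows "(\<integral>\<^sup>+x\<in>S. g x \<partial>M) \<le> c * (\<integral>\<^sup>+x\<in>Q. f x \<partial>M)"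
proof -
  have "(\<integral>\<^sup>+x\<in>S. g x \<partial>M) \<le> (\<integral>\<^sup>+x. (\<integral>\<^sup>+i. g x * indicator (B i) x \<partial>count_space C) \<partial>M)"
  proof (rule nn_integral_mono)
    fix x
    show "g x * indicator S x \<le> (\<integral>\<^sup>+i. g x * indicator (B i) x \<partial>count_space C)"
    proof (cases "x \<in> S")
      case True
      then obtain i where "i \<in> C" "x \<in> B i" using cover by blast
      then show ?thesis
        using nn_integral_ge_point[of i C "\<lambda>i. g x * indicator (B i) x"] True by simp
    qed simp
  qed
  also have "\<dots> = (\<integral>\<^sup>+i. (\<integral>\<^sup>+x\<in>B i. g x \<partial>M) \<partial>count_space C)"
    by (rule nn_integral_count_space_nn_integral[OF C]) measurable
  also have "\<dots> \<le> (\<integral>\<^sup>+i. c * (\<integral>\<^sup>+x\<in>R i. f x \<partial>M) \<partial>count_space C)"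
    using le by (intro nn_integral_mono) auto
  also have "\<dots> = c * (\<integral>\<^sup>+i. (\<integral>\<^sup>+x\<in>R i. f x \<partial>M) \<partial>count_space C)"
    by (rule nn_integral_cmult) simp
  also have "(\<integral>\<^sup>+i. (\<integral>\<^sup>+x\<in>R i. f x \<partial>M) \<partial>count_space C) = (\<integral>\<^sup>+x. (\<integral>\<^sup>+i. f x * indicator (R i) x \<partial>count_space C) \<partial>M)"
    by (rule nn_integral_count_space_nn_integral[OF C, symmetric]) measurable
  also have "\<dots> \<le> (\<integral>\<^sup>+x\<in>Q. f x \<partial>M)"
    unfolding nn_integral_count_space_disjoint[OF disj]
    using sub by (intro nn_integral_mono) (auto simp: indicator_def)
  finally show ?thesis by (simp add: mult_left_mono)
qed

text \<open>On functions with values in [0,\<infinity>] the operator is sublinear without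
  integrability conditions, as interpolation requires.\<close>

definition maxf :: "(real^'n \<Rightarrow> ennreal) \<Rightarrow> real^'n \<Rightarrow> ennreal" where
  "maxf \<phi> x = (SUP Q\<in>cubes. (\<integral>\<^sup>+y\<in>Q. \<phi> y \<partial>lebesgue) / emeasure lebesgue Q * indicator Q x)"

lemma maximal_fun_eq: "maximal_fun f = maxf (\<lambda>y. ennreal (cmod (f y)))"
  by (simp add: maximal_fun_def maxf_def fun_eq_iff)

lemma ennreal_less_divide_iff:
  "0 < q \<Longrightarrow> x < I / ennreal q \<longleftrightarrow> x * ennreal q < I"
  by (cases x; cases I)
    (auto simp: divide_ennreal ennreal_less_iff less_divide_eq ennreal_top_mult ennreal_top_divide simp flip: ennreal_mult)

lemma less_maxf_iff:
  fixes x :: "real^'n"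
  shows "t < maxf \<phi> x \<longleftrightarrow>
    (\<exists>a l. 0 < l \<and> x \<in> cube a l \<and> t * ennreal (l ^ CARD('n)) < (\<integral>\<^sup>+y\<in>cube a l. \<phi> y \<partial>lebesgue))"
proof -
  have "t < maxf \<phi> x \<longleftrightarrow> (\<exists>a l. 0 < l \<and>
      t < (\<integral>\<^sup>+y\<in>cube a l. \<phi> y \<partial>lebesgue) / emeasure lebesgue (cube a l) * indicator (cube a l) x)"
    unfolding maxf_def less_SUP_iff cubes_eq by blast
  also have "\<dots> \<longleftrightarrow> (\<exists>a l. 0 < l \<and> x \<in> cube a l \<and> t * ennreal (l ^ CARD('n)) < (\<integral>\<^sup>+y\<in>cube a l. \<phi> y \<partial>lebesgue))"
  proof (intro ex_cong1 conj_cong refl)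
    fix a :: "real^'n" and l :: real assume l: "0 < l"
    have "t < (\<integral>\<^sup>+y\<in>cube a l. \<phi> y \<partial>lebesgue) / emeasure lebesgue (cube a l)
        \<longleftrightarrow> t * ennreal (l ^ CARD('n)) < (\<integral>\<^sup>+y\<in>cube a l. \<phi> y \<partial>lebesgue)"
      unfolding emeasure_cube[OF less_imp_le[OF l]] using l by (intro ennreal_less_divide_iff) simp
    then show "t < (\<integral>\<^sup>+y\<in>cube a l. \<phi> y \<partial>lebesgue) / emeasure lebesgue (cube a l) * indicator (cube a l) x
        \<longleftrightarrow> x \<in> cube a l \<and> t * ennreal (l ^ CARD('n)) < (\<integral>\<^sup>+y\<in>cube a l. \<phi> y \<partial>lebesgue)"
      by (cases "x \<in> cube a l") (simp_all only: indicator_simps mult_1_right mult_zero_right not_less_zero simp_thms)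
  qed
  finally show ?thesis .
qed

text \<open>Enlarging a closed cube slightly keeps the average above the level, so superlevel sets are open.\<close>

lemma maxf_superlevel:
  fixes \<phi> :: "real^'n \<Rightarrow> ennreal"
  assumes "0 \<le> t"
  shows "{x. ennreal t < maxf \<phi> x} =
    (\<Union>(a, l)\<in>{(a, l). 0 < l \<and> ennreal t * ennreal (l ^ CARD('n)) < (\<integral>\<^sup>+y\<in>cube a l. \<phi> y \<partial>lebesgue)}.
      box a (a + (\<chi> i. l)))" (is "_ = ?U")
proof
  show "?U \<subseteq> {x. ennreal t < maxf \<phi> x}"
    using box_subset_cbox unfolding less_maxf_iff cube_def by fast
  show "{x. ennreal t < maxf \<phi> x} \<subseteq> ?U"
  proof
    fix x assume "x \<in> {x. ennreal t < maxf \<phi> x}"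
    then obtain a l where l: "0 < l" "x \<in> cube a l"
      "ennreal t * ennreal (l ^ CARD('n)) < (\<integral>\<^sup>+y\<in>cube a l. \<phi> y \<partial>lebesgue)" (is "_ < ?I")
      unfolding less_maxf_iff by blast
    have "((\<lambda>e. ennreal t * ennreal ((l + 2 * e) ^ CARD('n))) \<longlongrightarrow> ennreal t * ennreal ((l + 2 * 0) ^ CARD('n))) (at_right 0)"
      by (intro ennreal_tendsto_cmult tendsto_ennrealI tendsto_intros) auto
    then have "eventually (\<lambda>e. ennreal t * ennreal ((l + 2 * e) ^ CARD('n)) < ?I) (at_right 0)"
      using l(3) by (intro order_tendstoD) auto
    moreover have "eventually (\<lambda>e::real. 0 < e) (at_right 0)"
      by (simp add: eventually_at_right_less)
    ultimately obtain e where e: "0 < e" "ennreal t * ennreal ((l + 2 * e) ^ CARD('n)) < ?I"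
      using eventually_happens[OF eventually_conj] by (metis (mono_tags, lifting) trivial_limit_at_right_real)
    define a' where "a' = a - (\<chi> i. e)"
    have "cube a l \<subseteq> cube a' (l + 2 * e)"
    proof
      fix y assume y: "y \<in> cube a l"
      have "a' $ i \<le> y $ i \<and> y $ i \<le> a' $ i + (l + 2 * e)" for i
        using y e(1) by (auto simp: mem_cube a'_def dest!: spec[of _ i])
      then show "y \<in> cube a' (l + 2 * e)" by (simp add: mem_cube)
    qed
    then have "?I \<le> (\<integral>\<^sup>+y\<in>cube a' (l + 2 * e). \<phi> y \<partial>lebesgue)"
      by (intro nn_integral_mono) (auto simp: indicator_def)
    moreover have "x \<in> box a' (a' + (\<chi> i. l + 2 * e))"
    proof -
      have "a' $ i < x $ i \<and> x $ i < a' $ i + (l + 2 * e)" for i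
        using l(2) e(1) by (auto simp: mem_cube a'_def dest!: spec[of _ i])
      then show ?thesis by (simp add: mem_box_cart)
    qed
    ultimately have "0 < l + 2 * e \<and>
        ennreal t * ennreal ((l + 2 * e) ^ CARD('n)) < (\<integral>\<^sup>+y\<in>cube a' (l + 2 * e). \<phi> y \<partial>lebesgue) \<and>
        x \<in> box a' (a' + (\<chi> i. l + 2 * e))"
      using l(1) e less_le_trans by fastforce
    then show "x \<in> ?U" by blast
  qed
qed

text \<open>Superlevel sets at finite levels are unions of open boxes whatever \<phi> is; the level
  \<infinity> gives the empty set.\<close>

lemma borel_measurable_maxf [measurable]: "maxf \<phi> \<in> borel_measurable borel"
proof (rule borel_measurableI_greater)
  fix y :: ennreal
  show "{x \<in> space borel. y < maxf \<phi> x} \<in> sets borel"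
  proof (cases y)
    case (real t)
    then have "open {x. y < maxf \<phi> x}"
      using maxf_superlevel[of t \<phi>] by (auto intro!: open_UN open_box)
    then show ?thesis by simp
  qed auto
qed

lemma borel_measurable_maxf_lebesgue [measurable]: "maxf \<phi> \<in> borel_measurable lebesgue"
  by (rule measurable_completion) simp

lemma maxf_add:
  fixes \<phi> \<psi> :: "real^'n \<Rightarrow> ennreal"
  assumes "\<phi> \<in> borel_measurable lebesgue" "\<psi> \<in> borel_measurable lebesgue"
  shows "maxf (\<lambda>x. \<phi> x + \<psi> x) x \<le> maxf \<phi> x + maxf \<psi> x"
  unfolding maxf_def
proof (rule SUP_least)
  fix Q :: "(real^'n) set" assume Q: "Q \<in> cubes"
  have [measurable]: "Q \<in> sets lebesgue" using Q by (auto simp: cubes_eq)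
  have "(\<integral>\<^sup>+y\<in>Q. (\<phi> y + \<psi> y) \<partial>lebesgue) = (\<integral>\<^sup>+y\<in>Q. \<phi> y \<partial>lebesgue) + (\<integral>\<^sup>+y\<in>Q. \<psi> y \<partial>lebesgue)"
    using assms by (simp add: distrib_right nn_integral_add)
  then have "(\<integral>\<^sup>+y\<in>Q. (\<phi> y + \<psi> y) \<partial>lebesgue) / emeasure lebesgue Q * indicator Q x =
     (\<integral>\<^sup>+y\<in>Q. \<phi> y \<partial>lebesgue) / emeasure lebesgue Q * indicator Q x + (\<integral>\<^sup>+y\<in>Q. \<psi> y \<partial>lebesgue) / emeasure lebesgue Q * indicator Q x"
    by (simp add: add_divide_distrib_ennreal distrib_right)
  also have "\<dots> \<le> (SUP Q\<in>cubes. (\<integral>\<^sup>+y\<in>Q. \<phi> y \<partial>lebesgue) / emeasure lebesgue Q * indicator Q x) +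
      (SUP Q\<in>cubes. (\<integral>\<^sup>+y\<in>Q. \<psi> y \<partial>lebesgue) / emeasure lebesgue Q * indicator Q x)"
    using Q by (intro add_mono SUP_upper)
  finally show "(\<integral>\<^sup>+y\<in>Q. (\<phi> y + \<psi> y) \<partial>lebesgue) / emeasure lebesgue Q * indicator Q x \<le> \<dots>" .
qed

section \<open>Muckenhoupt weights and the weak type inequality\<close>

text \<open>A weight and its dual weight enter as two powers of one function U, so that powers and
  inverses of U merely relabel the exponents.\<close>

definition wint :: "(real^'n \<Rightarrow> real) \<Rightarrow> real \<Rightarrow> (real^'n) set \<Rightarrow> ennreal" where
  "wint U t Q = (\<integral>\<^sup>+x\<in>Q. ennreal (U x powr t) \<partial>lebesgue)"

text \<open>For \<open>a, b > 0\<close> this says that \<open>U\<^sup>a\<close> is a Muckenhoupt weight of class \<open>A\<^sub>p\<close> with \<open>p = 1 + a/b\<close>.\<close>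

definition Acond :: "real \<Rightarrow> real \<Rightarrow> (real^'n \<Rightarrow> real) \<Rightarrow> bool" where
  "Acond a b U \<longleftrightarrow> (\<exists>K<top. \<forall>x l. 0 < l \<longrightarrow>
     ennpowr (wint U a (cube x l)) (1/a) * ennpowr (wint U (- b) (cube x l)) (1/b)
       \<le> K * ennreal (l powr (real CARD('n) * (1/a + 1/b))))"

lemma wint_mono: "Q \<subseteq> R \<Longrightarrow> wint U t Q \<le> wint U t R"
  unfolding wint_def by (intro nn_integral_mono) (auto simp: indicator_def)

text \<open>Hoelder with \<phi> U^(a/p) and U^(-a/p) produces the dual weight U^(-b), since q/p =
  b/a for p = 1 + a/b and q = 1 + b/a. Multiplying by the U^a-measure of the dilated cube leaves the
  product that \<open>Acond\<close> controls.\<close>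

lemma weak_type_cube:
  fixes U :: "real^'n \<Rightarrow> real"
  assumes [measurable]: "U \<in> borel_measurable lebesgue" and pos: "\<And>x. 0 < U x"
    and ab: "0 < a" "0 < b" and A: "Acond a b U"
  obtains D where "D < top" "\<And>\<phi> t x l. \<phi> \<in> borel_measurable lebesgue \<Longrightarrow> 0 < t \<Longrightarrow> 0 < l \<Longrightarrow>
     ennreal t * ennreal (l ^ CARD('n)) < (\<integral>\<^sup>+y\<in>cube x l. \<phi> y \<partial>lebesgue) \<Longrightarrow>
     ennreal (t powr (1 + a/b)) * wint U a (big_cube x l)
       \<le> D * (\<integral>\<^sup>+y\<in>cube x l. ennpowr (\<phi> y) (1 + a/b) * ennreal (U y powr a) \<partial>lebesgue)"
proof -
  obtain K where K: "K < top" "\<And>x l. 0 < l \<Longrightarrow>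
     ennpowr (wint U a (cube x l)) (1/a) * ennpowr (wint U (- b) (cube x l)) (1/b)
       \<le> K * ennreal (l powr (real CARD('n) * (1/a + 1/b)))"
    using A unfolding Acond_def by blast
  define p where "p = 1 + a/b"
  define q where "q = 1 + b/a"
  define d where "d = real CARD('n)"
  have "1/p = b / (a + b)" "1/q = a / (a + b)"
    using ab by (simp_all add: p_def q_def field_simps)
  then have pq: "1 < p" "1 < q" "1/p + 1/q = 1"
    using ab by (simp_all add: p_def q_def flip: add_divide_distrib)
  have d: "0 < d" by (simp add: d_def)
  have KK: "wint U a (cube x l) * ennpowr (wint U (- b) (cube x l)) (a/b) \<le> ennpowr K a * ennreal (l powr (d * p))"
    if "0 < l" for x l
  proof -
    have "ennpowr (ennpowr (wint U a (cube x l)) (1/a) * ennpowr (wint U (- b) (cube x l)) (1/b)) a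
        \<le> ennpowr (K * ennreal (l powr (d * (1/a + 1/b)))) a"
      using K(2)[OF that, of x] ab by (intro ennpowr_mono) (auto simp: d_def)
    moreover have "d * (1/a + 1/b) * a = d * p"
      using ab by (simp add: p_def field_simps)
    ultimately show ?thesis
      using ab by (simp add: ennpowr_mult ennpowr_ennpowr ennpowr_ennreal powr_powr)
  qed
  \<comment> \<open>2^p stems from Hoelder, the rest from the A-condition on a cube of side 10 d
    l.\<close>
  define D where "D = ennreal (2 powr p) * (ennpowr K a * ennreal ((10 * d) powr (d * p)))"
  have "D < top" using K(1) by (simp add: D_def ennreal_mult_less_top)
  moreover have "ennreal (t powr p) * wint U a (big_cube x l)
       \<le> D * (\<integral>\<^sup>+y\<in>cube x l. ennpowr (\<phi> y) p * ennreal (U y powr a) \<partial>lebesgue)"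
    if [measurable]: "\<phi> \<in> borel_measurable lebesgue" and t: "0 < t" "0 < l"
      and less: "ennreal t * ennreal (l ^ CARD('n)) < (\<integral>\<^sup>+y\<in>cube x l. \<phi> y \<partial>lebesgue)" for \<phi> t x l
  proof -
    let ?R = "cube x l"
    let ?I = "\<integral>\<^sup>+y\<in>?R. ennpowr (\<phi> y) p * ennreal (U y powr a) \<partial>lebesgue"
    let ?s = "wint U (- b) ?R" and ?W = "wint U a (big_cube x l)"
    have "(\<integral>\<^sup>+y\<in>?R. \<phi> y \<partial>lebesgue)
       = (\<integral>\<^sup>+y. (\<phi> y * ennreal (U y powr (a/p)) * indicator ?R y) * (ennreal (U y powr (- (a/p))) * indicator ?R y) \<partial>lebesgue)"
    proof (rule nn_integral_cong)
      fix y
      have "U y powr (a/p) * U y powr (- (a/p)) = 1"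
        using pos[of y] by (simp flip: powr_add)
      then have "ennreal (U y powr (a/p)) * ennreal (U y powr (- (a/p))) = 1"
        by (simp flip: ennreal_mult)
      then have "\<phi> y * ennreal (U y powr (a/p)) * ennreal (U y powr (- (a/p))) = \<phi> y"
        by (simp add: mult.assoc)
      then show "\<phi> y * indicator ?R y = (\<phi> y * ennreal (U y powr (a/p)) * indicator ?R y) * (ennreal (U y powr (- (a/p))) * indicator ?R y)"
        by (cases "y \<in> ?R") simp_all
    qed
    also have "\<dots> \<le> 2 * (ennpowr (\<integral>\<^sup>+y. ennpowr (\<phi> y * ennreal (U y powr (a/p)) * indicator ?R y) p \<partial>lebesgue) (1/p)
        * ennpowr (\<integral>\<^sup>+y. ennpowr (ennreal (U y powr (- (a/p))) * indicator ?R y) q \<partial>lebesgue) (1/q))"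
      by (rule Hoelder_ennreal[OF pq]) measurable
    also have "(\<integral>\<^sup>+y. ennpowr (\<phi> y * ennreal (U y powr (a/p)) * indicator ?R y) p \<partial>lebesgue) = ?I"
      using pq(1) unfolding ennpowr_indicator
      by (intro nn_integral_cong) (simp add: ennpowr_mult ennpowr_ennreal powr_powr)
    also have "(\<integral>\<^sup>+y. ennpowr (ennreal (U y powr (- (a/p))) * indicator ?R y) q \<partial>lebesgue) = ?s"
    proof -
      have "p = (a + b) / b" "q = (a + b) / a" "a + b \<noteq> 0" using ab by (simp_all add: p_def q_def field_simps)
      then have "- (a/p) * q = - b" using ab by simp
      then show ?thesis
        unfolding wint_def ennpowr_indicator
        by (intro nn_integral_cong) (simp add: ennpowr_ennreal powr_powr del: minus_divide_left)
    qed
    finally have "ennreal t * ennreal (l ^ CARD('n)) \<le> 2 * (ennpowr ?I (1/p) * ennpowr ?s (1/q))"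
      using less by simp
    then have "ennpowr (ennreal t * ennreal (l ^ CARD('n))) p \<le> ennpowr (ennreal 2 * (ennpowr ?I (1/p) * ennpowr ?s (1/q))) p"
      using pq by (intro ennpowr_mono) auto
    also have "ennpowr (ennreal t * ennreal (l ^ CARD('n))) p = ennreal (t powr p) * ennreal (l powr (d * p))"
      using pq t by (simp add: ennpowr_mult ennpowr_ennreal powr_powr d_def flip: powr_realpow)
    also have "1/q * p = a/b"
    proof -
      have "p = (a + b) / b" "q = (a + b) / a" "a + b \<noteq> 0" using ab by (simp_all add: p_def q_def field_simps)
      then show ?thesis using ab by simp
    qed
    then have "ennpowr (ennreal 2 * (ennpowr ?I (1/p) * ennpowr ?s (1/q))) p = ennreal (2 powr p) * (?I * ennpowr ?s (a/b))"
      using pq(1) by (simp add: ennpowr_mult ennpowr_ennpowr ennpowr_ennreal del: ennreal_numeral)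
    finally have 1: "ennreal (t powr p) * ennreal (l powr (d * p)) \<le> ennreal (2 powr p) * (?I * ennpowr ?s (a/b))" .
    \<comment> \<open>Enlarging the dual factor to the dilated cube allows the A-condition to be
      applied there; this takes the place of doubling.\<close>
    have "?W * ennpowr ?s (a/b) \<le> ?W * ennpowr (wint U (- b) (big_cube x l)) (a/b)"
      using t ab by (intro mult_left_mono ennpowr_mono wint_mono cube_subset_big_cube) auto
    also have "\<dots> \<le> ennpowr K a * ennreal ((10 * d * l) powr (d * p))"
      unfolding big_cube_def d_def[symmetric] using d t by (intro KK) simp
    also have "\<dots> = ennpowr K a * ennreal ((10 * d) powr (d * p)) * ennreal (l powr (d * p))"
      using d t by (simp add: powr_mult ennreal_mult mult.assoc)
    finally have 2: "?W * ennpowr ?s (a/b) \<le> ennpowr K a * ennreal ((10 * d) powr (d * p)) * ennreal (l powr (d * p))" .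
    have "ennreal (l powr (d * p)) * (ennreal (t powr p) * ?W) = (ennreal (t powr p) * ennreal (l powr (d * p))) * ?W"
      by (simp only: mult_ac)
    also have "\<dots> \<le> (ennreal (2 powr p) * (?I * ennpowr ?s (a/b))) * ?W"
      using 1 by (rule mult_right_mono) simp
    also have "\<dots> = ennreal (2 powr p) * ?I * (?W * ennpowr ?s (a/b))"
      by (simp only: mult_ac)
    also have "\<dots> \<le> ennreal (2 powr p) * ?I * (ennpowr K a * ennreal ((10 * d) powr (d * p)) * ennreal (l powr (d * p)))"
      using 2 by (rule mult_left_mono) simp
    also have "\<dots> = ennreal (l powr (d * p)) * (D * ?I)"
      unfolding D_def by (simp only: mult_ac)
    finally show ?thesis
      using t by (subst (asm) ennreal_mult_le_mult_iff) (auto simp: ennreal_eq_0_iff)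
  qed
  ultimately show thesis unfolding p_def by (rule that)
qed

text \<open>Vitali's lemma asks for bounded sides. The superlevel set is therefore exhausted by the
  open sets \<open>E n\<close> belonging to cubes of side at most n, with a bound uniform in
  n.\<close>

lemma weak_type_maxf:
  fixes U :: "real^'n \<Rightarrow> real"
  assumes U[measurable]: "U \<in> borel_measurable lebesgue" and pos: "\<And>x. 0 < U x"
    and ab: "0 < a" "0 < b" and A: "Acond a b U" and p: "p = 1 + a/b"
  shows "weak_type (density lebesgue (\<lambda>x. ennreal (U x powr a))) maxf p"
proof -
  let ?M = "density lebesgue (\<lambda>x. ennreal (U x powr a))"
  obtain D where D: "D < top" "\<And>\<phi> t x l. \<phi> \<in> borel_measurable lebesgue \<Longrightarrow> 0 < t \<Longrightarrow> 0 < l \<Longrightarrow>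
     ennreal t * ennreal (l ^ CARD('n)) < (\<integral>\<^sup>+y\<in>cube x l. \<phi> y \<partial>lebesgue) \<Longrightarrow>
     ennreal (t powr p) * wint U a (big_cube x l)
       \<le> D * (\<integral>\<^sup>+y\<in>cube x l. ennpowr (\<phi> y) p * ennreal (U y powr a) \<partial>lebesgue)"
    using weak_type_cube[OF U pos ab A] unfolding p by blast
  have "ennreal (t powr p) * emeasure ?M {x \<in> space ?M. ennreal t < maxf \<phi> x}
       \<le> D * (\<integral>\<^sup>+x. ennpowr (\<phi> x) p \<partial>?M)"
    if \<phi>': "\<phi> \<in> borel_measurable ?M" and t: "0 < t" for \<phi> t
  proof -
    have \<phi>[measurable]: "\<phi> \<in> borel_measurable lebesgue" using \<phi>' by simp
    define F where "F n = {(a, l). 0 < l \<and> l \<le> real n \<and>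
      ennreal t * ennreal (l ^ CARD('n)) < (\<integral>\<^sup>+y\<in>cube a l. \<phi> y \<partial>lebesgue)}" for n
    define E where "E n = (\<Union>(a, l)\<in>F n. box a (a + (\<chi> i. l)))" for n
    have [measurable]: "E n \<in> sets lebesgue" for n
    proof -
      have "open (E n)" by (auto simp: E_def intro!: open_UN open_box)
      then show ?thesis by simp
    qed
    have "F m \<subseteq> F n" if "m \<le> n" for m n
      using that by (auto simp: F_def intro: order_trans)
    then have inc: "incseq E"
      unfolding incseq_def E_def by (blast intro: UN_mono)
    have UN: "{x. ennreal t < maxf \<phi> x} = (\<Union>n. E n)"
    proof -
      have "(\<Union>n. F n) = {(a, l). 0 < l \<and> ennreal t * ennreal (l ^ CARD('n)) < (\<integral>\<^sup>+y\<in>cube a l. \<phi> y \<partial>lebesgue)}"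
        using real_arch_simple by (auto simp: F_def)
      then show ?thesis
        using t unfolding maxf_superlevel[OF less_imp_le[OF t]] E_def by blast
    qed
    have En: "ennreal (t powr p) * emeasure ?M (E n) \<le> D * (\<integral>\<^sup>+x. ennpowr (\<phi> x) p \<partial>?M)" for n
    proof -
      obtain C where C: "countable C" "C \<subseteq> F n" "disjoint_family_on (\<lambda>(a, l). cube a l) C"
        "(\<Union>(a, l)\<in>F n. cube a l) \<subseteq> (\<Union>(a, l)\<in>C. big_cube a l)"
        using Vitali_cubes[of "F n" "real n"] by (auto simp: F_def)
      have "(\<integral>\<^sup>+x\<in>E n. ennreal (t powr p) * ennreal (U x powr a) \<partial>lebesgue)
          \<le> D * (\<integral>\<^sup>+x\<in>UNIV. ennpowr (\<phi> x) p * ennreal (U x powr a) \<partial>lebesgue)"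
      proof (rule covering_integral_le[OF C(1,3), where B="\<lambda>(a, l). big_cube a l"])
        have "E n \<subseteq> (\<Union>(a, l)\<in>F n. cube a l)"
          unfolding E_def cube_def using box_subset_cbox by fast
        then show "E n \<subseteq> (\<Union>i\<in>C. case i of (a, l) \<Rightarrow> big_cube a l)"
          using C(4) by simp
        fix i assume i: "i \<in> C"
        obtain x l where xl: "i = (x, l)" by fastforce
        have less: "0 < l" "ennreal t * ennreal (l ^ CARD('n)) < (\<integral>\<^sup>+y\<in>cube x l. \<phi> y \<partial>lebesgue)"
          using i C(2) xl by (auto simp: F_def)
        have "(\<integral>\<^sup>+y\<in>big_cube x l. ennreal (t powr p) * ennreal (U y powr a) \<partial>lebesgue) = ennreal (t powr p) * wint U a (big_cube x l)"
          unfolding wint_def mult.assoc by (rule nn_integral_cmult) (auto simp: big_cube_def)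
        then show "(\<integral>\<^sup>+y\<in>(case i of (a, l) \<Rightarrow> big_cube a l). ennreal (t powr p) * ennreal (U y powr a) \<partial>lebesgue)
          \<le> D * (\<integral>\<^sup>+y\<in>(case i of (a, l) \<Rightarrow> cube a l). ennpowr (\<phi> y) p * ennreal (U y powr a) \<partial>lebesgue)"
          using D(2)[OF \<phi> t less] by (simp add: xl)
      qed (auto simp: big_cube_def split: prod.split)
      moreover have "(\<integral>\<^sup>+x\<in>E n. ennreal (t powr p) * ennreal (U x powr a) \<partial>lebesgue) = ennreal (t powr p) * emeasure ?M (E n)"
        unfolding mult.assoc by (subst nn_integral_cmult) (simp_all add: emeasure_density)
      moreover have "(\<integral>\<^sup>+x\<in>UNIV. ennpowr (\<phi> x) p * ennreal (U x powr a) \<partial>lebesgue) = (\<integral>\<^sup>+x. ennpowr (\<phi> x) p \<partial>?M)"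
        by (subst nn_integral_density) (simp_all add: mult.commute)
      ultimately show ?thesis by simp
    qed
    have "emeasure ?M {x \<in> space ?M. ennreal t < maxf \<phi> x} = (SUP n. emeasure ?M (E n))"
      using UN inc by (subst SUP_emeasure_incseq) auto
    then show ?thesis
      using En by (simp add: SUP_mult_left_ennreal SUP_least)
  qed
  then show ?thesis unfolding weak_type_def using D(1) by blast
qed

section \<open>The reverse Hoelder inequality\<close>

text \<open>Lebesgue differentiation along cubes with lower corner x. Only the lower bound is
  recorded: it provides the first cube of average above t in the stopping argument.\<close>

lemma lebesgue_points:
  fixes w :: "real^'n \<Rightarrow> real"
  assumes [measurable]: "w \<in> borel_measurable lebesgue" and pos: "\<And>x. 0 < w x"
    and fin: "\<And>x l. 0 < l \<Longrightarrow> (\<integral>\<^sup>+y\<in>cube x l. ennreal (w y) \<partial>lebesgue) < top"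
  obtains N where "N \<in> null_sets lebesgue" "\<And>x t. x \<notin> N \<Longrightarrow> 0 \<le> t \<Longrightarrow> t < w x \<Longrightarrow>
    \<exists>d>0. \<forall>h. 0 < h \<and> h < d \<longrightarrow> ennreal t * ennreal (h ^ CARD('n)) < (\<integral>\<^sup>+y\<in>cube x h. ennreal (w y) \<partial>lebesgue)"
proof -
  have int: "(w has_integral enn2real (\<integral>\<^sup>+y\<in>S. ennreal (w y) \<partial>lebesgue)) S"
    if [measurable]: "S \<in> sets lebesgue" and S: "S \<subseteq> cube x l" "0 < l" for S x l
  proof -
    have "(\<integral>\<^sup>+y\<in>S. ennreal (w y) \<partial>lebesgue) \<le> (\<integral>\<^sup>+y\<in>cube x l. ennreal (w y) \<partial>lebesgue)"
      using S by (intro nn_integral_mono) (auto simp: indicator_def)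
    then have *: "(\<integral>\<^sup>+y\<in>S. ennreal (w y) \<partial>lebesgue) < top"
      using fin[OF S(2)] by (rule le_less_trans)
    let ?g = "\<lambda>y. if y \<in> S then w y else 0"
    have "(\<integral>\<^sup>+y. ennreal (?g y) \<partial>lebesgue) = (\<integral>\<^sup>+y\<in>S. ennreal (w y) \<partial>lebesgue)"
      by (intro nn_integral_cong) auto
    moreover have "?g \<in> borel_measurable lebesgue" by measurable
    ultimately have "(?g has_integral enn2real (\<integral>\<^sup>+y\<in>S. ennreal (w y) \<partial>lebesgue)) UNIV"
      using * pos by (subst has_integral_iff_nn_integral_lebesgue) (auto simp: less_imp_le)
    then show ?thesis by (simp add: has_integral_restrict_UNIV)
  qed
  have "w integrable_on cbox a b" for a b
  proof -
    \<comment> \<open>A side exceeding every edge, so that the box lies in a cube, where w has a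
      finite integral.\<close>
    define l where "l = (\<Sum>i\<in>UNIV. \<bar>b $ i - a $ i\<bar>) + 1"
    have nn: "0 \<le> (\<Sum>i\<in>UNIV. \<bar>b $ i - a $ i\<bar>)" by (intro sum_nonneg) auto
    have "\<bar>b $ i - a $ i\<bar> \<le> (\<Sum>i\<in>UNIV. \<bar>b $ i - a $ i\<bar>)" for i
      by (intro member_le_sum) auto
    then have "b $ i \<le> a $ i + l" for i
      unfolding l_def by (smt (verit))
    then have "y \<in> cube a l" if "y \<in> cbox a b" for y
      using that unfolding mem_cube mem_box_cart by (meson order_trans)
    then have "cbox a b \<subseteq> cube a l" by blast
    moreover have "0 < l" using nn unfolding l_def by linarith
    ultimately show ?thesis using int[of "cbox a b" a l] by (auto simp: integrable_on_def)
  qed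
  then obtain N where N: "negligible N" "\<And>x e. \<lbrakk>x \<notin> N; 0 < e\<rbrakk> \<Longrightarrow>
      \<exists>d>0. \<forall>h. 0 < h \<and> h < d \<longrightarrow> norm (integral (cbox x (x + h *\<^sub>R One)) w /\<^sub>R h ^ DIM(real^'n) - w x) < e"
    using integrable_ccontinuous_explicit[of w] by blast
  show thesis
  proof (rule that[of N])
    show "N \<in> null_sets lebesgue" using N(1) by (simp add: negligible_iff_null_sets)
    fix x t assume x: "x \<notin> N" and t: "0 \<le> t" "t < w x"
    obtain d where d: "0 < d" "\<And>h. 0 < h \<Longrightarrow> h < d \<Longrightarrow>
        norm (integral (cbox x (x + h *\<^sub>R One)) w /\<^sub>R h ^ DIM(real^'n) - w x) < w x - t"
      using N(2)[OF x, of "w x - t"] t by auto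
    have "ennreal t * ennreal (h ^ CARD('n)) < (\<integral>\<^sup>+y\<in>cube x h. ennreal (w y) \<partial>lebesgue)" if h: "0 < h" "h < d" for h
    proof -
      let ?I = "integral (cube x h) w"
      have "(One :: real^'n) $ i = 1" for i
        using inner_sum_left_Basis[of "axis i (1::real) :: real^'n" "\<lambda>_. 1"] by (simp add: inner_axis axis_in_Basis_iff)
      then have "h *\<^sub>R One = ((\<chi> i. h) :: real^'n)"
        by (simp add: vec_eq_iff)
      then have c: "cbox x (x + h *\<^sub>R One) = cube x h" by (simp add: cube_def)
      have "\<bar>?I / h ^ CARD('n) - w x\<bar> < w x - t"
        using d(2)[OF h] unfolding c by (simp add: divide_inverse mult.commute)
      then have "t < ?I / h ^ CARD('n)" by (simp add: abs_if split: if_splits)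
      then have "t * h ^ CARD('n) < ?I" using h by (simp add: pos_less_divide_eq)
      moreover have "?I = enn2real (\<integral>\<^sup>+y\<in>cube x h. ennreal (w y) \<partial>lebesgue)"
        using int[of "cube x h" x h] h by (intro integral_unique) auto
      ultimately have "ennreal (t * h ^ CARD('n)) < (\<integral>\<^sup>+y\<in>cube x h. ennreal (w y) \<partial>lebesgue)"
        using fin[OF h(1), of x] t h
        by (cases "\<integral>\<^sup>+y\<in>cube x h. ennreal (w y) \<partial>lebesgue") (auto simp: ennreal_less_iff)
      then show ?thesis using t h by (simp add: ennreal_mult)
    qed
    then show "\<exists>d>0. \<forall>h. 0 < h \<and> h < d \<longrightarrow> ennreal t * ennreal (h ^ CARD('n)) < (\<integral>\<^sup>+y\<in>cube x h. ennreal (w y) \<partial>lebesgue)"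
      using d(1) by blast
  qed
qed

text \<open>On the set E where w < c t the dual density w^(-\<tau>) is at least (c t)^(-\<tau>). The
  A-condition and an average above t then limit the measure of E to half of the cube.\<close>

lemma Acond_half:
  fixes w :: "real^'n \<Rightarrow> real"
  assumes [measurable]: "w \<in> borel_measurable lebesgue" and pos: "\<And>x. 0 < w x"
    and \<tau>: "0 < \<tau>" and A: "Acond 1 \<tau> w"
  obtains c where "0 < c" "c \<le> 1" "\<And>x l t. 0 < l \<Longrightarrow> 0 < t \<Longrightarrow>
     ennreal t * ennreal (l ^ CARD('n)) < wint w 1 (cube x l) \<Longrightarrow>
     ennreal (l ^ CARD('n)) \<le> 2 * emeasure lebesgue {y \<in> cube x l. c * t \<le> w y}"
proof -
  obtain K0 where K0: "K0 < top" "\<And>x l. 0 < l \<Longrightarrow>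
     wint w 1 (cube x l) * ennpowr (wint w (- \<tau>) (cube x l)) (1/\<tau>)
       \<le> K0 * ennreal (l powr (real CARD('n) * (1 + 1/\<tau>)))"
    using A unfolding Acond_def by auto
  obtain k0 where k0: "K0 = ennreal k0" "0 \<le> k0" using K0(1) by (cases K0) auto
  define K where "K = max k0 1"
  have K: "1 \<le> K" "K0 \<le> ennreal K" by (auto simp: K_def k0 ennreal_leI)
  define d where "d = real CARD('n)"
  \<comment> \<open>Chosen so that (c K)^\<tau> = 1/2; K was made at least 1 in order that c \<le>
    1.\<close>
  define c where "c = 2 powr (- (1/\<tau>)) / K"
  have c: "0 < c" "c \<le> 1"
  proof -
    show "0 < c" using K by (simp add: c_def)
    have "2 powr (- (1/\<tau>)) \<le> 2 powr (0::real)" using \<tau> by (intro powr_mono) auto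
    then show "c \<le> 1" using K by (simp add: c_def divide_le_eq)
  qed
  moreover have "ennreal (l ^ CARD('n)) \<le> 2 * emeasure lebesgue {y \<in> cube x l. c * t \<le> w y}"
    if l: "0 < l" and t: "0 < t" and less: "ennreal t * ennreal (l ^ CARD('n)) < wint w 1 (cube x l)" for x l t
  proof -
    let ?R = "cube x l" and ?s = "wint w (- \<tau>) (cube x l)"
    define E where "E = {y \<in> ?R. w y < c * t}"
    have [measurable]: "E \<in> sets lebesgue" unfolding E_def by measurable
    have ld: "l ^ CARD('n) = l powr d" using l by (simp add: d_def powr_realpow)
    have "ennreal t * ennreal (l powr d) * ennpowr ?s (1/\<tau>) \<le> wint w 1 ?R * ennpowr ?s (1/\<tau>)"
      using less by (intro mult_right_mono) (auto simp: ld)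
    also have "\<dots> \<le> ennreal K * ennreal (l powr (d * (1 + 1/\<tau>)))"
      unfolding d_def by (rule order_trans[OF K0(2)[OF l] mult_right_mono[OF K(2)]]) simp
    finally have "ennpowr (ennreal t * ennreal (l powr d) * ennpowr ?s (1/\<tau>)) \<tau> \<le> ennpowr (ennreal K * ennreal (l powr (d * (1 + 1/\<tau>)))) \<tau>"
      using \<tau> by (intro ennpowr_mono) auto
    moreover have "d * (1 + 1/\<tau>) * \<tau> = d * \<tau> + d" using \<tau> by (simp add: field_simps)
    ultimately have 1: "ennreal (t powr \<tau>) * ennreal (l powr (d * \<tau>)) * ?s \<le> ennreal (K powr \<tau>) * ennreal (l powr (d * \<tau> + d))"
      using \<tau> t K by (simp add: ennpowr_mult ennpowr_ennreal powr_powr ennpowr_ennpowr)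
    have "ennreal ((c * t) powr (- \<tau>)) * emeasure lebesgue E = (\<integral>\<^sup>+y\<in>E. ennreal ((c * t) powr (- \<tau>)) \<partial>lebesgue)"
      by (rule nn_integral_cmult_indicator[symmetric]) measurable
    also have "\<dots> \<le> ?s"
      unfolding wint_def
    proof (rule nn_integral_mono)
      fix y
      have "(c * t) powr (- \<tau>) \<le> w y powr (- \<tau>)" if "y \<in> E"
        using that pos[of y] \<tau> by (intro powr_mono2') (auto simp: E_def)
      then show "ennreal ((c * t) powr (- \<tau>)) * indicator E y \<le> ennreal (w y powr - \<tau>) * indicator ?R y"
        by (auto simp: indicator_def E_def intro: ennreal_leI)
    qed
    finally have 2: "ennreal ((c * t) powr (- \<tau>)) * emeasure lebesgue E \<le> ?s" .
    have fin: "emeasure lebesgue E \<le> ennreal (l powr d)"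
      using emeasure_mono[of E ?R lebesgue] l by (simp add: E_def emeasure_cube ld subset_iff del: emeasure_completion)
    then obtain m where m: "emeasure lebesgue E = ennreal m" "0 \<le> m"
      by (cases "emeasure lebesgue E") (auto simp: top_unique)
    have "ennreal (t powr \<tau>) * ennreal (l powr (d * \<tau>)) * (ennreal ((c * t) powr (- \<tau>)) * ennreal m) \<le> ennreal (K powr \<tau>) * ennreal (l powr (d * \<tau> + d))"
      using 1 2 unfolding m(1) by (meson mult_left_mono order_trans zero_le)
    then have "t powr \<tau> * l powr (d * \<tau>) * ((c * t) powr (- \<tau>) * m) \<le> K powr \<tau> * l powr (d * \<tau> + d)"
      using m(2) by (simp flip: ennreal_mult)
    also have "\<dots> = l powr (d * \<tau>) * (K powr \<tau> * l powr d)" by (simp add: powr_add)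
    finally have "l powr (d * \<tau>) * (t powr \<tau> * ((c * t) powr (- \<tau>) * m)) \<le> l powr (d * \<tau>) * (K powr \<tau> * l powr d)"
      by (simp only: mult_ac)
    then have le: "t powr \<tau> * ((c * t) powr (- \<tau>) * m) \<le> K powr \<tau> * l powr d"
      using l by simp
    have eq1: "t powr \<tau> * ((c * t) powr (- \<tau>) * m) = c powr (- \<tau>) * m"
      using t c by (simp add: powr_mult powr_minus field_simps)
    have eq2: "c powr (- \<tau>) = 2 * K powr \<tau>"
    proof -
      have "(2 powr (- (1/\<tau>))) powr (- \<tau>) = (2::real)" using \<tau> by (subst powr_powr) simp
      then show ?thesis using K unfolding c_def by (subst powr_divide) (simp_all add: powr_minus[of K] divide_inverse)
    qed
    have "K powr \<tau> * (2 * m) \<le> K powr \<tau> * l powr d" using le[unfolded eq1 eq2] by (simp only: mult_ac)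
    then have m2: "2 * m \<le> l powr d" using K by simp
    have "ennreal (l powr d) = emeasure lebesgue ?R" using l by (simp add: emeasure_cube ld del: emeasure_completion)
    also have "\<dots> \<le> emeasure lebesgue (E \<union> {y \<in> ?R. c * t \<le> w y})"
      by (rule emeasure_mono) (auto simp: E_def)
    also have "\<dots> \<le> emeasure lebesgue E + emeasure lebesgue {y \<in> ?R. c * t \<le> w y}"
      by (rule emeasure_subadditive) measurable
    finally have 3: "ennreal (l powr d) \<le> ennreal m + emeasure lebesgue {y \<in> ?R. c * t \<le> w y}"
      by (simp add: m(1))
    show ?thesis
    proof (cases "emeasure lebesgue {y \<in> ?R. c * t \<le> w y}")
      case (real z)
      with 3 m have "l powr d \<le> m + z" by (simp flip: ennreal_plus)
      with m2 have "l powr d \<le> 2 * z" by simp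
      then show ?thesis unfolding real ld
        by (metis ennreal_leI ennreal_mult'' ennreal_numeral real(1) zero_le_numeral)
    qed (simp add: ennreal_mult_top)
  qed
  ultimately show thesis by (rule that)
qed

text \<open>A Gehring inequality. Around almost every point of the superlevel set choose a cube inside \<open>Q\<close>
  whose average exceeds \<open>t\<close> and whose side is maximal up to a factor two; after passing to a Vitali
  subfamily, the dilated cubes still have average at most \<open>t\<close>.\<close>

lemma gehring_superlevel:
  fixes w :: "real^'n \<Rightarrow> real"
  assumes w[measurable]: "w \<in> borel_measurable lebesgue" and pos: "\<And>x. 0 < w x"
    and fin: "\<And>x l. 0 < l \<Longrightarrow> wint w 1 (cube x l) < top"
    and c: "\<And>x l t. 0 < l \<Longrightarrow> 0 < t \<Longrightarrow>
     ennreal t * ennreal (l ^ CARD('n)) < wint w 1 (cube x l) \<Longrightarrow>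
     ennreal (l ^ CARD('n)) \<le> 2 * emeasure lebesgue {y \<in> cube x l. c * t \<le> w y}"
    and L: "0 < L" and t: "0 < t" and avg: "wint w 1 (cube a L) \<le> ennreal t * ennreal (L ^ CARD('n))"
  shows "(\<integral>\<^sup>+x\<in>{x \<in> cube a L. t < w x}. ennreal (w x) \<partial>lebesgue)
    \<le> ennreal (2 * (10 * real CARD('n)) ^ CARD('n) * t) * emeasure lebesgue {x \<in> cube a L. c * t \<le> w x}"
proof -
  define Q where "Q = cube a L"
  define d where "d = real CARD('n)"
  have d: "1 \<le> d" by (simp add: d_def Suc_leI)
  have [measurable]: "Q \<in> sets lebesgue" by (simp add: Q_def)
  have w1: "wint w 1 S = (\<integral>\<^sup>+y\<in>S. ennreal (w y) \<partial>lebesgue)" for S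
    using pos by (simp add: wint_def less_imp_le)
  obtain N where N: "N \<in> null_sets lebesgue" "\<And>x t. x \<notin> N \<Longrightarrow> 0 \<le> t \<Longrightarrow> t < w x \<Longrightarrow>
    \<exists>d>0. \<forall>h. 0 < h \<and> h < d \<longrightarrow> ennreal t * ennreal (h ^ CARD('n)) < wint w 1 (cube x h)"
    using lebesgue_points[OF w pos fin[unfolded w1]] unfolding w1 by blast
  have [measurable]: "N \<in> sets lebesgue" using N(1) by auto
  \<comment> \<open>Boundary points are removed so that small cubes with lower corner x stay in Q,
    and so are the exceptional points of the differentiation theorem; both sets are null.\<close>
  define G where "G = {x \<in> box a (a + (\<chi> i. L)). t < w x} - N"
  have [measurable]: "G \<in> sets lebesgue"
  proof -
    have "{x \<in> space lebesgue. t < w x} \<in> sets lebesgue" by measurable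
    moreover have "G = box a (a + (\<chi> i. L)) \<inter> {x \<in> space lebesgue. t < w x} - N" by (auto simp: G_def)
    moreover have "box a (a + (\<chi> i. L)) \<in> sets lebesgue" by simp
    ultimately show ?thesis
      using N(1) by (metis (no_types, lifting) null_setsD2 sets.Diff sets.Int)
  qed
  define good where "good x r \<longleftrightarrow> (case r of (b, l) \<Rightarrow> 0 < l \<and> cube b l \<subseteq> Q \<and> x \<in> cube b l \<and>
     ennreal t * ennreal (l ^ CARD('n)) < wint w 1 (cube b l))" for x and r :: "(real^'n) \<times> real"
  have good_le: "l \<le> L" if "good x (b, l)" for x b l
  proof -
    have "b \<in> cube b l" "b + (\<chi> i. l) \<in> cube b l" using that by (auto simp: good_def mem_cube)
    then have "b \<in> cube a L" "b + (\<chi> i. l) \<in> cube a L" using that by (auto simp: good_def Q_def)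
    then have "a $ i \<le> b $ i" "b $ i + l \<le> a $ i + L" for i by (auto simp: mem_cube)
    from this[of undefined] show ?thesis by linarith
  qed
  \<comment> \<open>The sides of the cubes that are good for x are bounded by L. A good cube whose
    side exceeds half of their supremum is taken, so that no cube of at least twice its side is
    good.\<close>
  have ex: "\<exists>r. good x r \<and> (\<forall>b l. 2 * snd r \<le> l \<longrightarrow> 0 < l \<longrightarrow> cube b l \<subseteq> Q \<longrightarrow> x \<in> cube b l \<longrightarrow>
      wint w 1 (cube b l) \<le> ennreal t * ennreal (l ^ CARD('n)))" if x: "x \<in> G" for x
  proof -
    obtain h0 where h0: "0 < h0" "\<And>h. 0 < h \<Longrightarrow> h < h0 \<Longrightarrow> ennreal t * ennreal (h ^ CARD('n)) < wint w 1 (cube x h)"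
      using N(2)[of x t] x t by (auto simp: G_def)
    define e where "e = Min (range (\<lambda>i. a $ i + L - x $ i))"
    have xb: "a $ i < x $ i" "x $ i < a $ i + L" for i
      using x by (auto simp: G_def mem_box_cart)
    have "e \<in> range (\<lambda>i. a $ i + L - x $ i)" unfolding e_def by (intro Min_in) auto
    then have e: "0 < e" using xb by auto
    have e_le: "e \<le> a $ i + L - x $ i" for i unfolding e_def by (intro Min_le) auto
    define h where "h = min h0 e / 2"
    have h: "0 < h" "h < h0" "h < e" using h0(1) e by (auto simp: h_def)
    have "cube x h \<subseteq> Q"
    proof
      fix y assume y: "y \<in> cube x h"
      have "a $ i \<le> y $ i \<and> y $ i \<le> a $ i + L" for i
      proof -
        have "x $ i \<le> y $ i" "y $ i \<le> x $ i + h" using y by (auto simp: mem_cube)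
        then show ?thesis using e_le[of i] xb[of i] h by linarith
      qed
      then show "y \<in> Q" by (simp add: Q_def mem_cube)
    qed
    then have g: "good x (x, h)" using h h0 by (auto simp: good_def mem_cube)
    define S where "S = {l. \<exists>b. good x (b, l)}"
    have S: "S \<noteq> {}" "bdd_above S" using g good_le by (auto simp: S_def bdd_above_def)
    have "h \<le> Sup S" using g S by (intro cSup_upper) (auto simp: S_def)
    then have "Sup S / 2 < Sup S" using h by simp
    then obtain l where l: "l \<in> S" "Sup S / 2 < l" using less_cSup_iff[OF S] by blast
    then obtain b where b: "good x (b, l)" by (auto simp: S_def)
    have "wint w 1 (cube b' l') \<le> ennreal t * ennreal (l' ^ CARD('n))"
      if "2 * l \<le> l'" "0 < l'" "cube b' l' \<subseteq> Q" "x \<in> cube b' l'" for b' l'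
    proof (rule ccontr)
      assume "\<not> ?thesis"
      then have "l' \<in> S" using that by (auto simp: S_def good_def not_le)
      then have "l' \<le> Sup S" using S by (intro cSup_upper)
      with that l show False by simp
    qed
    with b show ?thesis by (intro exI[of _ "(b, l)"]) auto
  qed
  then obtain R where R: "\<And>x. x \<in> G \<Longrightarrow> good x (R x)" "\<And>x b l. x \<in> G \<Longrightarrow> 2 * snd (R x) \<le> l \<Longrightarrow> 0 < l \<Longrightarrow>
      cube b l \<subseteq> Q \<Longrightarrow> x \<in> cube b l \<Longrightarrow> wint w 1 (cube b l) \<le> ennreal t * ennreal (l ^ CARD('n))"
    by metis
  have bound: "0 < l \<and> l \<le> L" if "(b, l) \<in> R ` G" for b l
    using that
  proof (rule imageE)
    fix x assume x: "(b, l) = R x" "x \<in> G"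
    then have g: "good x (b, l)" using R(1)[OF x(2)] by simp
    then have "0 < l" by (simp add: good_def)
    with good_le[OF g] show ?thesis by simp
  qed
  obtain C where C: "countable C" "C \<subseteq> R ` G" "disjoint_family_on (\<lambda>(a, l). cube a l) C"
    "(\<Union>(a, l)\<in>R ` G. cube a l) \<subseteq> (\<Union>(a, l)\<in>C. big_cube a l)"
    by (rule Vitali_cubes[of "R ` G" L, OF bound])
  \<comment> \<open>A dilated cube may leave Q. If its side reaches L, the average over Q itself is
    used; otherwise it is moved into Q with the same side, and the stopping rule applies because 10
    d l \<ge> 2 l.\<close>
  have dilate: "wint w 1 (big_cube b l \<inter> Q) \<le> ennreal t * ennreal ((10 * d * l) ^ CARD('n))"
    if bl: "(b, l) \<in> R ` G" for b l
  proof -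
    obtain x where x: "x \<in> G" "R x = (b, l)"
      using bl by (rule imageE) (use that in simp)
    have l: "0 < l" and xQ: "x \<in> Q" and xR: "x \<in> cube b l" using R(1)[OF x(1)] x(2) by (auto simp: good_def)
    have ll: "2 * l \<le> 10 * d * l" using l d by (intro mult_right_mono) auto
    show ?thesis
    proof (cases "L \<le> 10 * d * l")
      case True
      have "wint w 1 (big_cube b l \<inter> Q) \<le> wint w 1 (cube a L)"
        by (rule wint_mono) (simp add: Q_def)
      also have "\<dots> \<le> ennreal t * ennreal ((10 * d * l) ^ CARD('n))"
        using True L by (intro order_trans[OF avg] mult_left_mono ennreal_leI power_mono) auto
      finally show ?thesis .
    next
      case False
      \<comment> \<open>Clamping each coordinate of the corner between those of a and a + L - 10 d l
        moves the cube into Q without losing any point that it shared with Q.\<close>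
      define b' where "b' = (\<chi> i. max (a $ i) (min (centre b l $ i - 5 * (d * l)) (a $ i + L - 10 * d * l)))"
      have "cube b' (10 * d * l) \<subseteq> Q"
      proof
        fix y assume y: "y \<in> cube b' (10 * d * l)"
        have "a $ i \<le> y $ i \<and> y $ i \<le> a $ i + L" for i
        proof -
          have "b' $ i \<le> y $ i" "y $ i \<le> b' $ i + 10 * d * l" using y by (auto simp: mem_cube)
          moreover have "a $ i \<le> b' $ i" "b' $ i \<le> a $ i + L - 10 * d * l" using False by (auto simp: b'_def)
          ultimately show ?thesis by linarith
        qed
        then show "y \<in> Q" by (simp add: Q_def mem_cube)
      qed
      moreover have sub: "big_cube b l \<inter> Q \<subseteq> cube b' (10 * d * l)"
      proof
        fix y assume y: "y \<in> big_cube b l \<inter> Q"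
        have "b' $ i \<le> y $ i \<and> y $ i \<le> b' $ i + 10 * d * l" for i
        proof -
          have 1: "\<bar>y $ i - centre b l $ i\<bar> \<le> 5 * (d * l)"
            using y by (simp add: mem_big_cube d_def)
          have 2: "a $ i \<le> y $ i" "y $ i \<le> a $ i + L" using y by (auto simp: Q_def mem_cube)
          have 3: "10 * d * l = 2 * (5 * (d * l))" by simp
          have "b' $ i \<le> y $ i" using 1 2 by (auto simp: b'_def abs_le_iff)
          moreover have "y $ i \<le> b' $ i + 10 * d * l"
          proof -
            have "min (centre b l $ i - 5 * (d * l)) (a $ i + L - 10 * d * l) \<le> b' $ i" by (simp add: b'_def)
            moreover have "y $ i - 10 * d * l \<le> min (centre b l $ i - 5 * (d * l)) (a $ i + L - 10 * d * l)"
              unfolding 3 using 1 2 by (simp add: abs_le_iff)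
            ultimately show ?thesis by linarith
          qed
          ultimately show ?thesis by blast
        qed
        then show "y \<in> cube b' (10 * d * l)" by (simp add: mem_cube)
      qed
      moreover have "x \<in> cube b' (10 * d * l)"
        using sub xQ xR cube_subset_big_cube[of l b] l by auto
      ultimately have "wint w 1 (cube b' (10 * d * l)) \<le> ennreal t * ennreal ((10 * d * l) ^ CARD('n))"
        using R(2)[OF x(1), of "10 * d * l" b'] x(2) ll l d by simp
      then show ?thesis using wint_mono[OF sub] by (rule order_trans[rotated])
    qed
  qed
  have "(\<integral>\<^sup>+x\<in>{x \<in> Q. t < w x}. ennreal (w x) \<partial>lebesgue) = (\<integral>\<^sup>+x\<in>G. ennreal (w x) \<partial>lebesgue)"
  proof (rule nn_integral_cong_AE)
    have "N \<union> (cbox a (a + (\<chi> i. L)) - box a (a + (\<chi> i. L))) \<in> null_sets lebesgue"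
      using N(1) negligible_frontier_interval[of a "a + (\<chi> i. L)"]
      by (intro null_sets.Un) (auto simp: negligible_iff_null_sets)
    then show "AE x in lebesgue. ennreal (w x) * indicator {x \<in> Q. t < w x} x = ennreal (w x) * indicator G x"
      by (rule AE_I') (use box_subset_cbox[of a "a + (\<chi> i. L)"] in \<open>auto simp: indicator_def G_def Q_def cube_def\<close>)
  qed
  \<comment> \<open>The power of 10 d is the volume of the dilated cube relative to the selected
    one; the 2 expresses that w \<ge> c t on at least half of the selected cube.\<close>
  also have "\<dots> \<le> ennreal (2 * (10 * d) ^ CARD('n) * t) * (\<integral>\<^sup>+x\<in>Q. indicator {y. c * t \<le> w y} x \<partial>lebesgue)"
  proof (rule covering_integral_le[OF C(1,3), where B="\<lambda>(a, l). big_cube a l \<inter> Q"])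
    have "x \<in> (case R x of (a, l) \<Rightarrow> cube a l)" if "x \<in> G" for x
      using R(1)[OF that] by (auto simp: good_def split: prod.splits)
    then have "G \<subseteq> (\<Union>(a, l)\<in>R ` G. cube a l)"
      by (intro subsetI UN_I[OF imageI])
    moreover have "G \<subseteq> Q" using box_subset_cbox by (auto simp: G_def Q_def cube_def)
    ultimately have "G \<subseteq> (\<Union>(a, l)\<in>C. big_cube a l) \<inter> Q"
      using C(4) by (meson Int_greatest order_trans)
    then show "G \<subseteq> (\<Union>i\<in>C. case i of (a, l) \<Rightarrow> big_cube a l \<inter> Q)"
      by (simp add: case_prod_beta)
    fix i assume i: "i \<in> C"
    obtain b l where bl: "i = (b, l)" by fastforce
    have bl_in: "(b, l) \<in> R ` G" using i C(2) bl by blast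
    then obtain x where x: "x \<in> G" "R x = (b, l)"
      by (rule imageE) (use that in simp)
    have g: "0 < l" "cube b l \<subseteq> Q" "ennreal t * ennreal (l ^ CARD('n)) < wint w 1 (cube b l)"
      using R(1)[OF x(1)] x(2) by (auto simp: good_def)
    show "(case i of (a, l) \<Rightarrow> cube a l) \<subseteq> Q" using g bl by simp
    have "(\<integral>\<^sup>+x\<in>(big_cube b l \<inter> Q). ennreal (w x) \<partial>lebesgue) \<le> ennreal t * ennreal ((10 * d * l) ^ CARD('n))"
      using dilate[OF bl_in] unfolding w1 .
    also have "\<dots> = ennreal (t * (10 * d) ^ CARD('n)) * ennreal (l ^ CARD('n))"
      using t g d by (simp add: power_mult_distrib mult.assoc flip: ennreal_mult)
    also have "\<dots> \<le> ennreal (t * (10 * d) ^ CARD('n)) * (2 * emeasure lebesgue {y \<in> cube b l. c * t \<le> w y})"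
      using c[OF g(1) t g(3)] by (intro mult_left_mono) auto
    also have "\<dots> = ennreal (2 * (10 * d) ^ CARD('n) * t) * emeasure lebesgue {y \<in> cube b l. c * t \<le> w y}"
      using t d by (simp add: ennreal_mult mult_ac)
    also have "emeasure lebesgue {y \<in> cube b l. c * t \<le> w y} = (\<integral>\<^sup>+x. indicator {y \<in> cube b l. c * t \<le> w y} x \<partial>lebesgue)"
      by (rule nn_integral_indicator[symmetric]) measurable
    also have "\<dots> = (\<integral>\<^sup>+x\<in>cube b l. indicator {y. c * t \<le> w y} x \<partial>lebesgue)"
      by (intro nn_integral_cong) (auto simp: indicator_def)
    finally show "(\<integral>\<^sup>+x\<in>(case i of (a, l) \<Rightarrow> big_cube a l \<inter> Q). ennreal (w x) \<partial>lebesgue)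
       \<le> ennreal (2 * (10 * d) ^ CARD('n) * t) * (\<integral>\<^sup>+x\<in>(case i of (a, l) \<Rightarrow> cube a l). indicator {y. c * t \<le> w y} x \<partial>lebesgue)"
      by (simp add: bl)
  qed (auto simp: big_cube_def split: prod.split)
  also have "(\<integral>\<^sup>+x\<in>Q. indicator {y. c * t \<le> w y} x \<partial>lebesgue) = (\<integral>\<^sup>+x. indicator {x \<in> Q. c * t \<le> w x} x \<partial>lebesgue)"
    by (intro nn_integral_cong) (auto simp: indicator_def)
  also have "\<dots> = emeasure lebesgue {x \<in> Q. c * t \<le> w x}"
    by (rule nn_integral_indicator) measurable
  finally show ?thesis by (simp only: Q_def d_def)
qed

section \<open>Rules for the two-exponent Muckenhoupt condition\<close>

lemma wint_pos:
  fixes U :: "real^'n \<Rightarrow> real"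
  assumes [measurable]: "U \<in> borel_measurable lebesgue" and pos: "\<And>x. 0 < U x" and l: "0 < l"
  shows "0 < wint U t (cube x l)"
proof (rule ccontr)
  assume "\<not> ?thesis"
  then have "(\<integral>\<^sup>+y. ennreal (U y powr t) * indicator (cube x l) y \<partial>lebesgue) = 0"
    by (simp add: wint_def)
  then have "AE y in lebesgue. ennreal (U y powr t) * indicator (cube x l) y = 0"
    by (subst (asm) nn_integral_0_iff_AE) auto
  then have "AE y in lebesgue. y \<notin> cube x l"
  proof (rule eventually_mono)
    fix y assume "ennreal (U y powr t) * indicator (cube x l) y = 0"
    moreover have "ennreal (U y powr t) \<noteq> 0" using pos[of y] by (simp add: ennreal_eq_0_iff)
    ultimately show "y \<notin> cube x l" by auto
  qed
  then have "emeasure lebesgue (cube x l) = 0"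
    by (subst (asm) AE_iff_measurable[of "cube x l"]) auto
  then show False using l emeasure_cube[of l x] by simp
qed

text \<open>The dual factor is positive by \<open>wint_pos\<close>, so an infinite first factor
  would make the controlled product infinite.\<close>

lemma Acond_finite:
  fixes U :: "real^'n \<Rightarrow> real"
  assumes U: "U \<in> borel_measurable lebesgue" and pos: "\<And>x. 0 < U x" and A: "Acond a b U" and l: "0 < l"
  shows "wint U a (cube x l) < top"
proof (rule ccontr)
  assume "\<not> ?thesis"
  then have top: "wint U a (cube x l) = top" using less_top by blast
  obtain K where K: "K < top" "ennpowr (wint U a (cube x l)) (1/a) * ennpowr (wint U (- b) (cube x l)) (1/b)
       \<le> K * ennreal (l powr (real CARD('n) * (1/a + 1/b)))"
    using A l unfolding Acond_def by blast
  have "ennpowr (wint U (- b) (cube x l)) (1/b) \<noteq> 0"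
    using wint_pos[OF U pos l, of "- b" x] by auto
  with K show False unfolding top by (auto simp: ennreal_top_mult top_unique ennreal_mult_eq_top_iff)
qed

text \<open>A power of U rescales both exponents together, which permits normalising one of them to
  1.\<close>

lemma Acond_powr:
  fixes U :: "real^'n \<Rightarrow> real"
  assumes "0 < \<kappa>" "0 < a" "0 < b" and A: "Acond (\<kappa> * a) (\<kappa> * b) U"
  shows "Acond a b (\<lambda>x. U x powr \<kappa>)"
proof -
  obtain K where K: "K < top" "\<And>x l. 0 < l \<Longrightarrow> ennpowr (wint U (\<kappa> * a) (cube x l)) (1/(\<kappa> * a)) * ennpowr (wint U (- (\<kappa> * b)) (cube x l)) (1/(\<kappa> * b))
       \<le> K * ennreal (l powr (real CARD('n) * (1/(\<kappa> * a) + 1/(\<kappa> * b))))"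
    using A unfolding Acond_def by blast
  have w: "wint (\<lambda>x. U x powr \<kappa>) t Q = wint U (\<kappa> * t) Q" for t Q
    by (simp add: wint_def powr_powr)
  have e: "1/(\<kappa> * c) * \<kappa> = 1/c" for c using assms by simp
  show ?thesis
    unfolding Acond_def w
  proof (intro exI[of _ "ennpowr K \<kappa>"] conjI allI impI)
    fix x :: "real^'n" and l :: real assume l: "0 < l"
    have "ennpowr (ennpowr (wint U (\<kappa> * a) (cube x l)) (1/(\<kappa> * a)) * ennpowr (wint U (- (\<kappa> * b)) (cube x l)) (1/(\<kappa> * b))) \<kappa>
       \<le> ennpowr (K * ennreal (l powr (real CARD('n) * (1/(\<kappa> * a) + 1/(\<kappa> * b))))) \<kappa>"
      using assms by (intro ennpowr_mono K l) simp
    moreover have "real CARD('n) * (1/(\<kappa> * a) + 1/(\<kappa> * b)) * \<kappa> = real CARD('n) * (1/a + 1/b)"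
      unfolding mult.assoc distrib_right e ..
    ultimately show "ennpowr (wint U (\<kappa> * a) (cube x l)) (1/a) * ennpowr (wint U (\<kappa> * - b) (cube x l)) (1/b)
        \<le> ennpowr K \<kappa> * ennreal (l powr (real CARD('n) * (1/a + 1/b)))"
      unfolding ennpowr_mult[OF assms(1)] ennpowr_ennpowr e ennpowr_ennreal[OF powr_ge_zero] powr_powr
      by simp
  qed (use K in simp)
qed

text \<open>The duality between A_p and A_p': weight and dual weight change places.\<close>

lemma Acond_inverse:
  fixes U :: "real^'n \<Rightarrow> real"
  assumes pos: "\<And>x. 0 < U x" and A: "Acond a b U"
  shows "Acond b a (\<lambda>x. inverse (U x))"
proof -
  have w: "wint (\<lambda>x. inverse (U x)) t Q = wint U (- t) Q" for t Q
    using pos unfolding wint_def by (simp add: powr_minus inverse_powr less_imp_le)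
  show ?thesis
    using A unfolding Acond_def w by (simp add: mult.commute add.commute)
qed

text \<open>Monotonicity of averages in the exponent, by Hoelder against the indicator of the cube;
  the power of l is the normalisation by volume.\<close>

lemma wint_Jensen:
  fixes U :: "real^'n \<Rightarrow> real"
  assumes [measurable]: "U \<in> borel_measurable lebesgue" and a: "0 < a'" "a' < a" and l: "0 < l"
  shows "ennpowr (wint U a' (cube x l)) (1/a')
    \<le> ennreal (2 powr (1/a')) * ennpowr (wint U a (cube x l)) (1/a) * ennreal (l powr (real CARD('n) * (1/a' - 1/a)))"
proof -
  let ?Q = "cube x l"
  define p where "p = a/a'"
  define q where "q = a/(a - a')"
  have pq: "1 < p" "1 < q" "1/p + 1/q = 1"
    using a by (auto simp: p_def q_def less_divide_eq diff_divide_distrib)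
  have "wint U a' ?Q = (\<integral>\<^sup>+y. (ennreal (U y powr a') * indicator ?Q y) * indicator ?Q y \<partial>lebesgue)"
    unfolding wint_def by (intro nn_integral_cong) (auto simp: indicator_def)
  also have "\<dots> \<le> 2 * (ennpowr (\<integral>\<^sup>+y. ennpowr (ennreal (U y powr a') * indicator ?Q y) p \<partial>lebesgue) (1/p)
      * ennpowr (\<integral>\<^sup>+y. ennpowr (indicator ?Q y) q \<partial>lebesgue) (1/q))"
    by (rule Hoelder_ennreal[OF pq]) measurable
  also have "(\<integral>\<^sup>+y. ennpowr (ennreal (U y powr a') * indicator ?Q y) p \<partial>lebesgue) = wint U a ?Q"
    unfolding wint_def ennpowr_indicator using a
    by (intro nn_integral_cong) (simp add: ennpowr_ennreal powr_powr p_def)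
  also have "(\<integral>\<^sup>+y. ennpowr (indicator ?Q y) q \<partial>lebesgue) = (\<integral>\<^sup>+y. indicator ?Q y \<partial>lebesgue)"
    by (intro nn_integral_cong) (auto simp: indicator_def)
  also have "\<dots> = ennreal (l ^ CARD('n))"
    using l by (subst nn_integral_indicator) (auto simp: emeasure_cube simp del: emeasure_completion)
  finally have *: "wint U a' ?Q \<le> ennreal 2 * (ennpowr (wint U a ?Q) (1/p) * ennpowr (ennreal (l ^ CARD('n))) (1/q))"
    by simp
  have "0 < 1/a'" using a by simp
  have e: "1/p * (1/a') = 1/a" "real CARD('n) * (1/q * (1/a')) = real CARD('n) * (1/a' - 1/a)"
    using a by (simp_all add: p_def q_def field_simps)
  have "ennpowr (wint U a' ?Q) (1/a') \<le> ennpowr (ennreal 2 * (ennpowr (wint U a ?Q) (1/p) * ennpowr (ennreal (l ^ CARD('n))) (1/q))) (1/a')"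
    using * a by (intro ennpowr_mono) auto
  also have "\<dots> = ennreal (2 powr (1/a')) * (ennpowr (wint U a ?Q) (1/a) * ennpowr (ennreal (l powr real CARD('n))) (1/q * (1/a')))"
    using l unfolding ennpowr_mult[OF \<open>0 < 1/a'\<close>] ennpowr_ennpowr e(1) by (simp add: ennpowr_ennreal powr_realpow del: ennreal_numeral)
  also have "ennpowr (ennreal (l powr real CARD('n))) (1/q * (1/a')) = ennreal (l powr (real CARD('n) * (1/a' - 1/a)))"
    unfolding ennpowr_ennreal[OF powr_ge_zero] powr_powr e(2) ..
  finally show ?thesis by (simp only: mult.assoc)
qed

lemma Acond_mono_left:
  fixes U :: "real^'n \<Rightarrow> real"
  assumes U: "U \<in> borel_measurable lebesgue" and a: "0 < a'" "a' \<le> a" and A: "Acond a b U"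
  shows "Acond a' b U"
proof (cases "a' = a")
  case False
  then have a': "a' < a" using a by simp
  obtain K where K: "K < top" "\<And>x l. 0 < l \<Longrightarrow> ennpowr (wint U a (cube x l)) (1/a) * ennpowr (wint U (- b) (cube x l)) (1/b)
       \<le> K * ennreal (l powr (real CARD('n) * (1/a + 1/b)))"
    using A unfolding Acond_def by blast
  show ?thesis
    unfolding Acond_def
  proof (intro exI[of _ "ennreal (2 powr (1/a')) * K"] conjI allI impI)
    fix x :: "real^'n" and l :: real assume l: "0 < l"
    let ?Y = "ennpowr (wint U (- b) (cube x l)) (1/b)"
    let ?m = "ennreal (l powr (real CARD('n) * (1/a' - 1/a)))"
    have "ennpowr (wint U a' (cube x l)) (1/a') * ?Y
      \<le> ennreal (2 powr (1/a')) * ennpowr (wint U a (cube x l)) (1/a) * ?m * ?Y"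
      by (intro mult_right_mono wint_Jensen U a a' l) simp
    also have "\<dots> = ennreal (2 powr (1/a')) * ?m * (ennpowr (wint U a (cube x l)) (1/a) * ?Y)"
      by (simp only: mult_ac)
    also have "\<dots> \<le> ennreal (2 powr (1/a')) * ?m * (K * ennreal (l powr (real CARD('n) * (1/a + 1/b))))"
      by (intro mult_left_mono K l) simp
    also have "\<dots> = ennreal (2 powr (1/a')) * K * (?m * ennreal (l powr (real CARD('n) * (1/a + 1/b))))"
      by (simp only: mult_ac)
    also have "?m * ennreal (l powr (real CARD('n) * (1/a + 1/b))) = ennreal (l powr (real CARD('n) * (1/a' + 1/b)))"
      unfolding ennreal_powr_add[symmetric] by (simp add: algebra_simps)
    finally show "ennpowr (wint U a' (cube x l)) (1/a') * ?Y
      \<le> ennreal (2 powr (1/a')) * K * ennreal (l powr (real CARD('n) * (1/a' + 1/b)))" .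
  qed (use K in \<open>simp add: ennreal_mult_less_top\<close>)
qed (use A in simp)

text \<open>The second exponent is lowered by applying \<open>Acond_mono_left\<close> to
  1/U.\<close>

lemma Acond_mono:
  fixes U :: "real^'n \<Rightarrow> real"
  assumes U[measurable]: "U \<in> borel_measurable lebesgue" and pos: "\<And>x. 0 < U x"
    and a: "0 < a'" "a' \<le> a" "0 < b'" "b' \<le> b" and A: "Acond a b U"
  shows "Acond a' b' U"
proof -
  have "Acond b a' (\<lambda>x. inverse (U x))"
    by (intro Acond_inverse pos Acond_mono_left[OF U a(1,2) A])
  then have "Acond b' a' (\<lambda>x. inverse (U x))"
    by (intro Acond_mono_left[OF _ a(3,4)]) measurable
  then have "Acond a' b' (\<lambda>x. inverse (inverse (U x)))"
    by (rule Acond_inverse[rotated]) (use pos in simp)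
  then show ?thesis by simp
qed

section \<open>Self-improvement of Muckenhoupt weights\<close>

text \<open>Telescoping: doubling the truncation height adds at most 2^\<delta> - 1 times the
  \<delta>-th power of the level just passed. That factor tends to 0 with \<delta>, which makes the
  absorption in \<open>reverse_Hoelder\<close> possible.\<close>

lemma min_powr_le_levels:
  fixes u t0 :: real
  assumes "0 < t0" "0 < u" "0 < \<delta>"
  shows "min u (t0 * 2 ^ n) powr \<delta> \<le> t0 powr \<delta> +
    (\<Sum>k<n. (2 powr \<delta> - 1) * (t0 * 2 ^ k) powr \<delta> * of_bool (t0 * 2 ^ k < u))"
proof (induction n)
  case 0
  show ?case using assms by (simp add: powr_mono2)
next
  case (Suc n)
  have "min u (t0 * 2 ^ Suc n) powr \<delta> \<le> min u (t0 * 2 ^ n) powr \<delta> +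
      (2 powr \<delta> - 1) * (t0 * 2 ^ n) powr \<delta> * of_bool (t0 * 2 ^ n < u)"
  proof (cases "t0 * 2 ^ n < u")
    case True
    have "min u (t0 * 2 ^ Suc n) powr \<delta> \<le> (2 * (t0 * 2 ^ n)) powr \<delta>"
      using assms by (intro powr_mono2) auto
    also have "\<dots> = 2 powr \<delta> * (t0 * 2 ^ n) powr \<delta>" using assms by (subst powr_mult) auto
    also have "\<dots> = min u (t0 * 2 ^ n) powr \<delta> + (2 powr \<delta> - 1) * (t0 * 2 ^ n) powr \<delta>"
      using True by (simp add: algebra_simps)
    finally show ?thesis using True by simp
  next
    case False
    then have "min u (t0 * 2 ^ Suc n) = min u (t0 * 2 ^ n)" using assms by (auto simp: min_def)
    then show ?thesis using False by simp
  qed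
  then show ?case using Suc by simp
qed

text \<open>Every level that occurs is at most min(u, t0 2^n)/c; its \<delta>-th power is taken out
  and a geometric sum of levels remains. By \<delta> \<le> 1 and c \<le> 1 the constant does not
  depend on \<delta>, so \<delta> may be chosen after it.\<close>

lemma level_sum_le_min_powr:
  fixes u t0 c :: real
  assumes "0 < t0" "0 < u" "0 < \<delta>" "\<delta> \<le> 1" "0 < c" "c \<le> 1"
  shows "(\<Sum>k<n. (t0 * 2 ^ k) powr (1 + \<delta>) * of_bool (c * (t0 * 2 ^ k) \<le> u))
    \<le> 2 * c powr (- 2) * (u * min u (t0 * 2 ^ n) powr \<delta>)"
proof -
  have geo: "(\<Sum>k<n. t0 * 2 ^ k * of_bool (c * (t0 * 2 ^ k) \<le> u)) \<le> 2 * (u / c)" for n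
  proof (induction n)
    case (Suc n)
    show ?case
    proof (cases "c * (t0 * 2 ^ n) \<le> u")
      case True
      have s: "(\<Sum>k<n. t0 * 2 ^ k) \<le> t0 * 2 ^ n" for n :: nat
        using assms by (induction n) auto
      have "(\<Sum>k<n. t0 * 2 ^ k * of_bool (c * (t0 * 2 ^ k) \<le> u)) \<le> (\<Sum>k<n. t0 * 2 ^ k)"
        using assms by (intro sum_mono) auto
      also note s[of n]
      finally have "(\<Sum>k<Suc n. t0 * 2 ^ k * of_bool (c * (t0 * 2 ^ k) \<le> u)) \<le> 2 * (t0 * 2 ^ n)"
        using True by simp
      also have "\<dots> \<le> 2 * (u / c)" using True assms by (simp add: pos_le_divide_eq mult.commute)
      finally show ?thesis .
    qed (use Suc in simp)
  qed (use assms in simp)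
  let ?m = "min u (t0 * 2 ^ n)"
  have "(\<Sum>k<n. (t0 * 2 ^ k) powr (1 + \<delta>) * of_bool (c * (t0 * 2 ^ k) \<le> u))
     \<le> (\<Sum>k<n. (?m / c) powr \<delta> * (t0 * 2 ^ k * of_bool (c * (t0 * 2 ^ k) \<le> u)))"
  proof (rule sum_mono)
    fix k assume "k \<in> {..<n}"
    then have "t0 * 2 ^ k \<le> t0 * 2 ^ n" using assms by (intro mult_left_mono power_increasing) auto
    moreover have "c * (t0 * 2 ^ k) \<le> t0 * 2 ^ k" using assms by (intro mult_left_le_one_le) auto
    ultimately have "c * (t0 * 2 ^ k) \<le> u \<Longrightarrow> c * (t0 * 2 ^ k) \<le> ?m" by simp
    then have "c * (t0 * 2 ^ k) \<le> u \<Longrightarrow> t0 * 2 ^ k \<le> ?m / c" using assms by (simp add: pos_le_divide_eq mult.commute)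
    then have "c * (t0 * 2 ^ k) \<le> u \<Longrightarrow> (t0 * 2 ^ k) powr \<delta> \<le> (?m / c) powr \<delta>"
      using assms by (intro powr_mono2) auto
    then show "(t0 * 2 ^ k) powr (1 + \<delta>) * of_bool (c * (t0 * 2 ^ k) \<le> u) \<le> (?m / c) powr \<delta> * (t0 * 2 ^ k * of_bool (c * (t0 * 2 ^ k) \<le> u))"
      using assms by (auto simp: powr_add mult.commute)
  qed
  also have "\<dots> \<le> (?m / c) powr \<delta> * (2 * (u / c))"
    unfolding sum_distrib_left[symmetric] by (intro mult_left_mono geo) simp
  also have "(?m / c) powr \<delta> = ?m powr \<delta> * c powr (- \<delta>)"
    using assms by (subst powr_divide) (auto simp: powr_minus divide_inverse)
  also have "?m powr \<delta> * c powr (- \<delta>) * (2 * (u / c)) = 2 * (c powr (- \<delta>) * c powr (- 1)) * (u * ?m powr \<delta>)"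
    using assms by (simp add: powr_minus divide_inverse)
  also have "c powr (- \<delta>) * c powr (- 1) \<le> c powr (- 2)"
    using assms unfolding powr_add[symmetric] by (intro powr_mono') auto
  finally show ?thesis using assms by (simp add: mult_left_mono mult_right_mono)
qed

text \<open>Gehring's argument: weighting the superlevel inequality with powers of the level and
  summing over dyadic levels above the average bounds a truncated integral of w^(1+\<delta>) by a
  main term plus a small multiple of itself.\<close>

lemma reverse_Hoelder:
  fixes w :: "real^'n \<Rightarrow> real"
  assumes w[measurable]: "w \<in> borel_measurable lebesgue" and pos: "\<And>x. 0 < w x"
    and \<tau>: "0 < \<tau>" and A: "Acond 1 \<tau> w"
  obtains \<delta> where "0 < \<delta>" "\<And>x l. 0 < l \<Longrightarrow>
    wint w (1 + \<delta>) (cube x l) \<le> 2 * ennpowr (wint w 1 (cube x l)) (1 + \<delta>) * ennreal (l powr (- (real CARD('n) * \<delta>)))"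
proof -
  obtain c where c: "0 < c" "c \<le> 1" "\<And>x l t. 0 < l \<Longrightarrow> 0 < t \<Longrightarrow>
     ennreal t * ennreal (l ^ CARD('n)) < wint w 1 (cube x l) \<Longrightarrow>
     ennreal (l ^ CARD('n)) \<le> 2 * emeasure lebesgue {y \<in> cube x l. c * t \<le> w y}"
    using Acond_half[OF w pos \<tau> A] by blast
  have fin: "wint w 1 (cube x l) < top" if "0 < l" for x l
    by (rule Acond_finite[OF w pos A that])
  define C1 where "C1 = 2 * (10 * real CARD('n)) ^ CARD('n)"
  define C2 where "C2 = 2 * c powr (- 2)"
  have C: "0 < C1" "0 < C2" using c by (simp_all add: C1_def C2_def)
  \<comment> \<open>Makes (2^\<delta> - 1) C1 C2 at most 1/2; the cap \<delta> \<le> 1 is for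
    \<open>level_sum_le_min_powr\<close>.\<close>
  define \<eta> where "\<eta> = 1 / (2 * (C1 * C2))"
  define \<delta> where "\<delta> = min 1 (log 2 (1 + \<eta>))"
  have \<eta>: "0 < \<eta>" using C by (simp add: \<eta>_def)
  have \<delta>: "0 < \<delta>" "\<delta> \<le> 1" using \<eta> by (auto simp: \<delta>_def)
  have "2 powr \<delta> \<le> 2 powr (log 2 (1 + \<eta>))" by (intro powr_mono) (auto simp: \<delta>_def)
  then have "2 powr \<delta> - 1 \<le> \<eta>" using \<eta> by simp
  then have small: "(2 powr \<delta> - 1) * (C1 * C2) \<le> 1/2"
    using C mult_right_mono[of "2 powr \<delta> - 1" \<eta> "C1 * C2"] by (simp add: \<eta>_def)
  have p2: "0 \<le> 2 powr \<delta> - 1" using \<delta> by (simp add: ge_one_powr_ge_zero)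
  have "wint w (1 + \<delta>) (cube x l) \<le> 2 * ennpowr (wint w 1 (cube x l)) (1 + \<delta>) * ennreal (l powr (- (real CARD('n) * \<delta>)))"
    if l: "0 < l" for x l
  proof -
    define Q where "Q = cube x l"
    have [measurable]: "Q \<in> sets lebesgue" by (simp add: Q_def)
    obtain \<omega> where \<omega>: "wint w 1 Q = ennreal \<omega>" "0 < \<omega>"
      using fin[OF l, of x] wint_pos[OF w pos l, of 1 x] unfolding Q_def[symmetric]
      by (cases "wint w 1 Q") auto
    \<comment> \<open>The average of w over Q, the lowest level to which
      \<open>gehring_superlevel\<close> applies on Q.\<close>
    define t0 where "t0 = \<omega> / l ^ CARD('n)"
    have t0: "0 < t0" using \<omega> l by (simp add: t0_def)
    \<comment> \<open>Truncating the factor w^\<delta> alone keeps \<open>F n\<close> finite, as w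
      is integrable on Q; only a finite term can be absorbed.\<close>
    define F where "F n = (\<integral>\<^sup>+y\<in>Q. ennreal (w y * min (w y) (t0 * 2 ^ n) powr \<delta>) \<partial>lebesgue)" for n :: nat
    have w1: "(\<integral>\<^sup>+y\<in>Q. ennreal (w y) \<partial>lebesgue) = ennreal \<omega>"
      using \<omega>(1) pos by (simp add: wint_def less_imp_le)
    have Fle: "F n \<le> ennreal (2 * (t0 powr \<delta> * \<omega>))" for n
    proof -
      have "F n \<le> (\<integral>\<^sup>+y\<in>Q. ennreal ((t0 * 2 ^ n) powr \<delta>) * ennreal (w y) \<partial>lebesgue)"
        unfolding F_def
      proof (intro nn_integral_mono mult_right_mono)
        fix y
        have "min (w y) (t0 * 2 ^ n) powr \<delta> \<le> (t0 * 2 ^ n) powr \<delta>"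
          using pos[of y] t0 \<delta> by (intro powr_mono2) auto
        then show "ennreal (w y * min (w y) (t0 * 2 ^ n) powr \<delta>) \<le> ennreal ((t0 * 2 ^ n) powr \<delta>) * ennreal (w y)"
          using pos[of y] by (simp add: mult.commute mult_left_mono ennreal_leI flip: ennreal_mult)
      qed simp
      also have "\<dots> = ennreal ((t0 * 2 ^ n) powr \<delta>) * ennreal \<omega>"
        unfolding w1[symmetric] mult.assoc by (rule nn_integral_cmult) measurable
      also have "\<dots> < top" by (simp add: ennreal_mult_less_top)
      finally have Ffin: "F n < top" .
      have lev: "(\<integral>\<^sup>+y\<in>{y \<in> Q. t0 * 2 ^ k < w y}. ennreal (w y) \<partial>lebesgue)
          \<le> ennreal (C1 * (t0 * 2 ^ k)) * emeasure lebesgue {y \<in> Q. c * (t0 * 2 ^ k) \<le> w y}" for k :: nat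
        unfolding C1_def Q_def
      proof (rule gehring_superlevel[OF w pos fin c(3) l])
        show "0 < t0 * 2 ^ k" using t0 by simp
        have "\<omega> = t0 * l ^ CARD('n)" using l by (simp add: t0_def)
        also have "\<dots> \<le> t0 * 2 ^ k * l ^ CARD('n)" using t0 l by (intro mult_right_mono) auto
        finally have "ennreal \<omega> \<le> ennreal (t0 * 2 ^ k) * ennreal (l ^ CARD('n))"
          using t0 l by (simp add: ennreal_leI flip: ennreal_mult)
        then show "wint w 1 (cube x l) \<le> ennreal (t0 * 2 ^ k) * ennreal (l ^ CARD('n))"
          using \<omega>(1) by (simp add: Q_def)
      qed
      have "F n \<le> (\<integral>\<^sup>+y. ennreal (t0 powr \<delta>) * (ennreal (w y) * indicator Q y) +
           (\<Sum>k<n. ennreal ((2 powr \<delta> - 1) * (t0 * 2 ^ k) powr \<delta>) * (ennreal (w y) * indicator {y \<in> Q. t0 * 2 ^ k < w y} y)) \<partial>lebesgue)"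
        unfolding F_def
      proof (rule nn_integral_mono)
        fix y
        have "w y * min (w y) (t0 * 2 ^ n) powr \<delta> \<le> w y * (t0 powr \<delta> +
           (\<Sum>k<n. (2 powr \<delta> - 1) * (t0 * 2 ^ k) powr \<delta> * of_bool (t0 * 2 ^ k < w y)))"
          using pos[of y] t0 \<delta> by (intro mult_left_mono min_powr_le_levels) auto
        also have "\<dots> = t0 powr \<delta> * w y + (\<Sum>k<n. (2 powr \<delta> - 1) * (t0 * 2 ^ k) powr \<delta> * (w y * of_bool (t0 * 2 ^ k < w y)))"
          by (simp add: distrib_left sum_distrib_left mult_ac)
        finally have "ennreal (w y * min (w y) (t0 * 2 ^ n) powr \<delta>) \<le>
            ennreal (t0 powr \<delta> * w y + (\<Sum>k<n. (2 powr \<delta> - 1) * (t0 * 2 ^ k) powr \<delta> * (w y * of_bool (t0 * 2 ^ k < w y))))"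
          by (rule ennreal_leI)
        also have "\<dots> = ennreal (t0 powr \<delta>) * ennreal (w y) + (\<Sum>k<n. ennreal ((2 powr \<delta> - 1) * (t0 * 2 ^ k) powr \<delta>) * (ennreal (w y) * of_bool (t0 * 2 ^ k < w y)))"
        proof -
          have "0 \<le> (2 powr \<delta> - 1) * (t0 * 2 ^ k) powr \<delta> * (w y * of_bool (t0 * 2 ^ k < w y))" for k
            using pos[of y] p2 by (intro mult_nonneg_nonneg) auto
          moreover have "ennreal ((2 powr \<delta> - 1) * (t0 * 2 ^ k) powr \<delta> * (w y * of_bool (t0 * 2 ^ k < w y)))
              = ennreal ((2 powr \<delta> - 1) * (t0 * 2 ^ k) powr \<delta>) * (ennreal (w y) * of_bool (t0 * 2 ^ k < w y))" for k
            using pos[of y] p2 by (cases "t0 * 2 ^ k < w y") (simp_all add: ennreal_mult)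
          ultimately show ?thesis
            using pos[of y] by (simp add: ennreal_plus sum_nonneg ennreal_mult sum_ennreal[symmetric])
        qed
        finally show "ennreal (w y * min (w y) (t0 * 2 ^ n) powr \<delta>) * indicator Q y
           \<le> ennreal (t0 powr \<delta>) * (ennreal (w y) * indicator Q y) +
           (\<Sum>k<n. ennreal ((2 powr \<delta> - 1) * (t0 * 2 ^ k) powr \<delta>) * (ennreal (w y) * indicator {y \<in> Q. t0 * 2 ^ k < w y} y))"
          by (cases "y \<in> Q") (simp_all add: indicator_def)
      qed
      also have "\<dots> = ennreal (t0 powr \<delta>) * ennreal \<omega> +
         (\<Sum>k<n. ennreal ((2 powr \<delta> - 1) * (t0 * 2 ^ k) powr \<delta>) * (\<integral>\<^sup>+y\<in>{y \<in> Q. t0 * 2 ^ k < w y}. ennreal (w y) \<partial>lebesgue))"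
      proof -
        have [measurable]: "{y \<in> Q. t < w y} \<in> sets lebesgue" for t by measurable
        show ?thesis
          by (subst nn_integral_add, measurable, subst nn_integral_sum, measurable)
            (simp add: nn_integral_cmult w1)
      qed
      also have "\<dots> \<le> ennreal (t0 powr \<delta>) * ennreal \<omega> +
         (\<Sum>k<n. ennreal ((2 powr \<delta> - 1) * (t0 * 2 ^ k) powr \<delta>) * (ennreal (C1 * (t0 * 2 ^ k)) * emeasure lebesgue {y \<in> Q. c * (t0 * 2 ^ k) \<le> w y}))"
        by (intro add_left_mono sum_mono mult_left_mono lev) simp
      also have "(\<Sum>k<n. ennreal ((2 powr \<delta> - 1) * (t0 * 2 ^ k) powr \<delta>) * (ennreal (C1 * (t0 * 2 ^ k)) * emeasure lebesgue {y \<in> Q. c * (t0 * 2 ^ k) \<le> w y}))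
         = (\<integral>\<^sup>+y. (\<Sum>k<n. ennreal ((2 powr \<delta> - 1) * C1 * (t0 * 2 ^ k) powr (1 + \<delta>)) * indicator {y \<in> Q. c * (t0 * 2 ^ k) \<le> w y} y) \<partial>lebesgue)"
      proof -
        have [measurable]: "{y \<in> Q. t \<le> w y} \<in> sets lebesgue" for t by measurable
        have "ennreal ((2 powr \<delta> - 1) * (t0 * 2 ^ k) powr \<delta>) * (ennreal (C1 * (t0 * 2 ^ k)) * e)
            = ennreal ((2 powr \<delta> - 1) * C1 * (t0 * 2 ^ k) powr (1 + \<delta>)) * e" for k :: nat and e
        proof -
          have "(2 powr \<delta> - 1) * (t0 * 2 ^ k) powr \<delta> * (C1 * (t0 * 2 ^ k)) = (2 powr \<delta> - 1) * C1 * (t0 * 2 ^ k) powr (1 + \<delta>)"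
            using t0 by (simp add: powr_add)
          moreover have "ennreal ((2 powr \<delta> - 1) * (t0 * 2 ^ k) powr \<delta> * (C1 * (t0 * 2 ^ k))) = ennreal ((2 powr \<delta> - 1) * (t0 * 2 ^ k) powr \<delta>) * ennreal (C1 * (t0 * 2 ^ k))"
            using p2 C t0 by (intro ennreal_mult) auto
          ultimately show ?thesis by (simp only: mult.assoc)
        qed
        then show ?thesis
          by (subst nn_integral_sum, measurable) (simp add: nn_integral_cmult_indicator)
      qed
      also have "\<dots> \<le> (\<integral>\<^sup>+y\<in>Q. ennreal (1/2) * ennreal (w y * min (w y) (t0 * 2 ^ n) powr \<delta>) \<partial>lebesgue)"
      proof (rule nn_integral_mono)
        fix y
        let ?S = "\<Sum>k<n. (t0 * 2 ^ k) powr (1 + \<delta>) * of_bool (c * (t0 * 2 ^ k) \<le> w y)"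
        let ?m = "w y * min (w y) (t0 * 2 ^ n) powr \<delta>"
        have "(\<Sum>k<n. ennreal ((2 powr \<delta> - 1) * C1 * (t0 * 2 ^ k) powr (1 + \<delta>)) * of_bool (c * (t0 * 2 ^ k) \<le> w y))
           = (\<Sum>k<n. ennreal ((2 powr \<delta> - 1) * C1 * ((t0 * 2 ^ k) powr (1 + \<delta>) * of_bool (c * (t0 * 2 ^ k) \<le> w y))))"
          by (intro sum.cong refl) (simp add: of_bool_def)
        also have "\<dots> = ennreal ((2 powr \<delta> - 1) * C1 * ?S)"
          unfolding sum_distrib_left using p2 C by (intro sum_ennreal mult_nonneg_nonneg) auto
        also have "\<dots> \<le> ennreal (1/2 * ?m)"
        proof (rule ennreal_leI)
          have "?S \<le> C2 * ?m"
            unfolding C2_def using t0 pos[of y] \<delta> c by (intro level_sum_le_min_powr)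
          then have "(2 powr \<delta> - 1) * C1 * ?S \<le> (2 powr \<delta> - 1) * C1 * (C2 * ?m)"
            using p2 C by (intro mult_left_mono) auto
          also have "\<dots> = (2 powr \<delta> - 1) * (C1 * C2) * ?m" by simp
          also have "\<dots> \<le> 1/2 * ?m" using pos[of y] by (intro mult_right_mono small) auto
          finally show "(2 powr \<delta> - 1) * C1 * ?S \<le> 1/2 * ?m" .
        qed
        also have "\<dots> = ennreal (1/2) * ennreal ?m" using pos[of y] by (intro ennreal_mult) auto
        finally show "(\<Sum>k<n. ennreal ((2 powr \<delta> - 1) * C1 * (t0 * 2 ^ k) powr (1 + \<delta>)) * indicator {y \<in> Q. c * (t0 * 2 ^ k) \<le> w y} y)
            \<le> ennreal (1/2) * ennreal ?m * indicator Q y"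
          by (cases "y \<in> Q") (simp_all only: indicator_def mem_Collect_eq simp_thms of_bool_def if_True if_False mult_1_right mult_zero_right sum.neutral_const order_refl)
      qed
      also have "\<dots> = ennreal (1/2) * F n"
        unfolding F_def mult.assoc by (rule nn_integral_cmult) measurable
      finally have "F n \<le> ennreal (t0 powr \<delta>) * ennreal \<omega> + ennreal (1/2) * F n" by (simp add: add_left_mono)
      moreover obtain r where r: "F n = ennreal r" "0 \<le> r" using Ffin by (cases "F n") auto
      moreover have "ennreal (t0 powr \<delta>) * ennreal \<omega> = ennreal (t0 powr \<delta> * \<omega>)"
        using \<omega>(2) by (intro ennreal_mult[symmetric]) auto
      moreover have "ennreal (1/2) * ennreal r = ennreal (1/2 * r)"
        using r(2) by (intro ennreal_mult[symmetric]) auto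
      moreover have "ennreal (t0 powr \<delta> * \<omega>) + ennreal (1/2 * r) = ennreal (t0 powr \<delta> * \<omega> + 1/2 * r)"
        using r(2) \<omega>(2) by (intro ennreal_plus[symmetric]) auto
      ultimately have "ennreal r \<le> ennreal (t0 powr \<delta> * \<omega> + 1/2 * r)" by (simp only:)
      then have "r \<le> t0 powr \<delta> * \<omega> + 1/2 * r" using r(2) \<omega>(2) by (subst (asm) ennreal_le_iff) auto
      then have "r \<le> 2 * (t0 powr \<delta> * \<omega>)" by simp
      then show ?thesis unfolding r(1) by (rule ennreal_leI)
    qed
    have "wint w (1 + \<delta>) Q \<le> (\<integral>\<^sup>+y. (SUP n. ennreal (w y * min (w y) (t0 * 2 ^ n) powr \<delta>) * indicator Q y) \<partial>lebesgue)"
      unfolding wint_def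
    proof (rule nn_integral_mono)
      fix y
      \<comment> \<open>The supremum is attained as soon as t0 2^n has passed w y.\<close>
      obtain n where "w y / t0 < 2 ^ n" using real_arch_pow[of 2 "w y / t0"] by auto
      then have "w y \<le> t0 * 2 ^ n" using t0 by (simp add: pos_divide_less_eq mult.commute)
      then have "ennreal (w y powr (1 + \<delta>)) * indicator Q y = ennreal (w y * min (w y) (t0 * 2 ^ n) powr \<delta>) * indicator Q y"
        using pos[of y] by (simp add: powr_add)
      then show "ennreal (w y powr (1 + \<delta>)) * indicator Q y \<le> (SUP n. ennreal (w y * min (w y) (t0 * 2 ^ n) powr \<delta>) * indicator Q y)"
        by (intro SUP_upper2[of n]) auto
    qed
    also have "\<dots> = (SUP n. F n)"
      unfolding F_def
    proof (rule nn_integral_monotone_convergence_SUP)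
      show "incseq (\<lambda>n y. ennreal (w y * min (w y) (t0 * 2 ^ n) powr \<delta>) * indicator Q y)"
      proof (intro incseq_SucI le_funI mult_right_mono ennreal_leI mult_left_mono powr_mono2)
        fix n y show "min (w y) (t0 * 2 ^ n) \<le> min (w y) (t0 * 2 ^ Suc n)"
          using t0 by (intro min.mono order_refl mult_left_mono power_increasing) auto
        show "0 \<le> min (w y) (t0 * 2 ^ n)" using t0 pos[of y] by simp
      qed (use \<delta> pos in \<open>auto simp: less_imp_le\<close>)
    qed measurable
    also have "\<dots> \<le> ennreal (2 * (t0 powr \<delta> * \<omega>))" by (intro SUP_least Fle)
    also have "t0 powr \<delta> * \<omega> = \<omega> powr (1 + \<delta>) * l powr (- (real CARD('n) * \<delta>))"
    proof -
      have "t0 = \<omega> / l powr real CARD('n)" using l by (simp add: t0_def powr_realpow)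
      then have "t0 powr \<delta> = \<omega> powr \<delta> / l powr (real CARD('n) * \<delta>)"
        using \<omega> by (simp add: powr_divide powr_powr)
      then show ?thesis using \<omega> by (simp add: powr_add powr_minus divide_inverse)
    qed
    also have "ennreal (2 * (\<omega> powr (1 + \<delta>) * l powr (- (real CARD('n) * \<delta>)))) = 2 * ennpowr (wint w 1 Q) (1 + \<delta>) * ennreal (l powr (- (real CARD('n) * \<delta>)))"
      using \<omega> by (simp add: ennpowr_ennreal ennreal_mult mult.assoc)
    finally show ?thesis by (simp only: Q_def)
  qed
  then show thesis using that \<delta>(1) by blast
qed

text \<open>For w = U^a reverse Hoelder is available at exponent 1. Raising this exponent to 1 +
  \<delta> leaves the dual factor untouched, and the power 1/a leads back to U.\<close>

lemma Acond_open_left: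
  fixes U :: "real^'n \<Rightarrow> real"
  assumes U[measurable]: "U \<in> borel_measurable lebesgue" and pos: "\<And>x. 0 < U x"
    and ab: "0 < a" "0 < b" and A: "Acond a b U"
  obtains a1 where "a < a1" "Acond a1 b U"
proof -
  define w where "w = (\<lambda>x. U x powr a)"
  define \<tau> where "\<tau> = b / a"
  have \<tau>: "0 < \<tau>" using ab by (simp add: \<tau>_def)
  have w[measurable]: "w \<in> borel_measurable lebesgue" unfolding w_def by measurable
  have wpos: "0 < w x" for x using pos[of x] by (simp add: w_def)
  have "Acond (a * 1) (a * \<tau>) U" using A ab by (simp add: \<tau>_def)
  then have Aw: "Acond 1 \<tau> w" unfolding w_def using ab \<tau> by (intro Acond_powr) auto
  obtain \<delta> where \<delta>: "0 < \<delta>" and RH: "\<And>x l. 0 < l \<Longrightarrow>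
    wint w (1 + \<delta>) (cube x l) \<le> 2 * ennpowr (wint w 1 (cube x l)) (1 + \<delta>) * ennreal (l powr (- (real CARD('n) * \<delta>)))"
    using reverse_Hoelder[OF w wpos \<tau> Aw] by blast
  obtain K where K: "K < top" "\<And>x l. 0 < l \<Longrightarrow> ennpowr (wint w 1 (cube x l)) (1/1) * ennpowr (wint w (- \<tau>) (cube x l)) (1/\<tau>)
       \<le> K * ennreal (l powr (real CARD('n) * (1/1 + 1/\<tau>)))"
    using Aw unfolding Acond_def by blast
  define e where "e = 1 / (1 + \<delta>)"
  have e: "0 < e" "(1 + \<delta>) * e = 1" using \<delta> by (simp_all add: e_def)
  have "Acond (1 + \<delta>) \<tau> w"
    unfolding Acond_def e_def[symmetric]
  proof (intro exI[of _ "ennpowr 2 e * K"] conjI allI impI)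
    fix x :: "real^'n" and l :: real assume l: "0 < l"
    let ?Y = "ennpowr (wint w (- \<tau>) (cube x l)) (1/\<tau>)"
    have "ennpowr (wint w (1 + \<delta>) (cube x l)) e \<le> ennpowr (2 * ennpowr (wint w 1 (cube x l)) (1 + \<delta>) * ennreal (l powr (- (real CARD('n) * \<delta>)))) e"
      using e by (intro ennpowr_mono RH l) simp
    also have "\<dots> = ennpowr 2 e * wint w 1 (cube x l) * ennreal (l powr (- (real CARD('n) * \<delta>) * e))"
      unfolding ennpowr_mult[OF e(1)] ennpowr_ennpowr e(2) ennpowr_one ennpowr_ennreal[OF powr_ge_zero] powr_powr ..
    finally have "ennpowr (wint w (1 + \<delta>) (cube x l)) e * ?Y
      \<le> ennpowr 2 e * wint w 1 (cube x l) * ennreal (l powr (- (real CARD('n) * \<delta>) * e)) * ?Y"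
      by (rule mult_right_mono) simp
    also have "\<dots> = ennpowr 2 e * ennreal (l powr (- (real CARD('n) * \<delta>) * e)) * (ennpowr (wint w 1 (cube x l)) (1/1) * ?Y)"
      by (simp only: mult_ac div_by_1 ennpowr_one)
    also have "\<dots> \<le> ennpowr 2 e * ennreal (l powr (- (real CARD('n) * \<delta>) * e)) * (K * ennreal (l powr (real CARD('n) * (1/1 + 1/\<tau>))))"
      by (intro mult_left_mono K l) simp
    also have "\<dots> = ennpowr 2 e * K * (ennreal (l powr (- (real CARD('n) * \<delta>) * e)) * ennreal (l powr (real CARD('n) * (1/1 + 1/\<tau>))))"
      by (simp only: mult_ac)
    also have "ennreal (l powr (- (real CARD('n) * \<delta>) * e)) * ennreal (l powr (real CARD('n) * (1/1 + 1/\<tau>)))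
       = ennreal (l powr (real CARD('n) * (e + 1/\<tau>)))"
    proof -
      have "1 - \<delta> * e = e" using e(2) by (simp add: algebra_simps)
      then have "- (real CARD('n) * \<delta>) * e + real CARD('n) * (1/1 + 1/\<tau>) = real CARD('n) * (e + 1/\<tau>)"
        by (metis (no_types, opaque_lifting) ab_group_add_class.ab_diff_conv_add_uminus add.commute add.left_commute distrib_left div_by_1 mult.assoc mult_minus_left mult_minus_right)
      then show ?thesis unfolding ennreal_powr_add[symmetric] by simp
    qed
    finally show "ennpowr (wint w (1 + \<delta>) (cube x l)) e * ?Y \<le> ennpowr 2 e * K * ennreal (l powr (real CARD('n) * (e + 1/\<tau>)))" .
  qed (use K in \<open>simp add: ennreal_mult_less_top\<close>)
  then have "Acond ((1 / a) * (a * (1 + \<delta>))) ((1 / a) * b) w"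
    using ab by (simp add: \<tau>_def)
  then have "Acond (a * (1 + \<delta>)) b (\<lambda>x. w x powr (1 / a))"
    using ab \<delta> by (intro Acond_powr) auto
  moreover have "(\<lambda>x. w x powr (1 / a)) = U"
    using ab pos by (simp add: w_def powr_powr fun_eq_iff less_imp_le)
  ultimately have "Acond (a * (1 + \<delta>)) b U" by simp
  moreover have "a < a * (1 + \<delta>)" using ab \<delta> by simp
  ultimately show thesis using that by blast
qed

text \<open>The second exponent is raised through 1/U, after the first one has been
  enlarged.\<close>

lemma Acond_open:
  fixes U :: "real^'n \<Rightarrow> real"
  assumes U[measurable]: "U \<in> borel_measurable lebesgue" and pos: "\<And>x. 0 < U x"
    and ab: "0 < a" "0 < b" and A: "Acond a b U"
  obtains a1 b1 where "a < a1" "b < b1" "Acond a1 b1 U"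
proof -
  obtain a1 where a1: "a < a1" "Acond a1 b U"
    by (rule Acond_open_left[OF U pos ab A])
  have "Acond b a1 (\<lambda>x. inverse (U x))"
    by (rule Acond_inverse[OF pos a1(2)])
  then obtain b1 where b1: "b < b1" "Acond b1 a1 (\<lambda>x. inverse (U x))"
    using ab a1 pos by (elim Acond_open_left[rotated -1]) auto
  have "Acond a1 b1 (\<lambda>x. inverse (inverse (U x)))"
    by (rule Acond_inverse[OF _ b1(2)]) (use pos in simp)
  then have "Acond a1 b1 U" by simp
  with a1 b1 show thesis using that by blast
qed

section \<open>Weighted estimates for the maximal function\<close>

text \<open>One weight U^e in both A_t0 and A_t1 gives weak bounds at t0 and t1; interpolation on
  the diagonal makes the bound strong in between.\<close>

lemma maxf_strong_type:
  fixes U :: "real^'n \<Rightarrow> real"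
  assumes U[measurable]: "U \<in> borel_measurable lebesgue" and pos: "\<And>x. 0 < U x"
    and e: "0 < e" and t: "1 < t0" "t0 < t" "t < t1"
    and A: "Acond e (e / (t0 - 1)) U" "Acond e (e / (t1 - 1)) U"
  obtains C where "C < top" "\<And>\<phi>. \<phi> \<in> borel_measurable lebesgue \<Longrightarrow>
    (\<integral>\<^sup>+x. ennpowr (maxf \<phi> x) t * ennreal (U x powr e) \<partial>lebesgue)
      \<le> C * (\<integral>\<^sup>+x. ennpowr (\<phi> x) t * ennreal (U x powr e) \<partial>lebesgue)"
proof -
  let ?M = "density lebesgue (\<lambda>x. ennreal (U x powr e))"
  have weak: "weak_type ?M maxf t0" "weak_type ?M maxf t1"
    using e t by (intro weak_type_maxf[OF U pos _ _ A(1)] weak_type_maxf[OF U pos _ _ A(2)]; simp)+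
  obtain C where C: "C < top" "\<And>\<phi>. \<phi> \<in> borel_measurable lebesgue \<Longrightarrow> dlor 2 t t ?M (maxf \<phi>) \<le> C * dlor 2 t t ?M \<phi>"
  proof -
    have "\<exists>C<top. \<forall>f\<in>borel_measurable ?M. dlor 2 t t ?M (maxf f) \<le> C * dlor 2 t t ?M f"
      using t by (intro marcinkiewicz[OF _ _ t(2,3) _ _ _ weak] maxf_add) auto
    moreover have "\<phi> \<in> borel_measurable ?M" if "\<phi> \<in> borel_measurable lebesgue" for \<phi> :: "real^'n \<Rightarrow> ennreal"
      using that by simp
    ultimately show thesis using that by blast
  qed
  let ?C = "ennreal (2 powr t) * (C * geosum 2 t)"
  show thesis
  proof (rule that[of ?C])
    show "?C < top" using C(1) t geosum_less_top[of 2 t] by (simp add: ennreal_mult_less_top)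
    fix \<phi> :: "real^'n \<Rightarrow> ennreal" assume \<phi>[measurable]: "\<phi> \<in> borel_measurable lebesgue"
    have d: "(\<integral>\<^sup>+x. ennpowr (\<psi> x) t \<partial>?M) = (\<integral>\<^sup>+x. ennpowr (\<psi> x) t * ennreal (U x powr e) \<partial>lebesgue)"
      if [measurable]: "\<psi> \<in> borel_measurable lebesgue" for \<psi>
      by (subst nn_integral_density) (simp_all add: mult.commute)
    have "(\<integral>\<^sup>+x. ennpowr (maxf \<phi> x) t \<partial>?M) \<le> ennreal (2 powr t) * dlor 2 t t ?M (maxf \<phi>)"
      using t by (intro dlor_diag(2)) auto
    also have "\<dots> \<le> ennreal (2 powr t) * (C * dlor 2 t t ?M \<phi>)"
      by (intro mult_left_mono C \<phi>) simp
    also have "\<dots> \<le> ennreal (2 powr t) * (C * (geosum 2 t * (\<integral>\<^sup>+x. ennpowr (\<phi> x) t \<partial>?M)))"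
      using t by (intro mult_left_mono dlor_diag(1)) auto
    finally show "(\<integral>\<^sup>+x. ennpowr (maxf \<phi> x) t * ennreal (U x powr e) \<partial>lebesgue)
      \<le> ?C * (\<integral>\<^sup>+x. ennpowr (\<phi> x) t * ennreal (U x powr e) \<partial>lebesgue)"
      unfolding d[OF \<phi>] d[OF borel_measurable_maxf_lebesgue] by (simp only: mult.assoc)
  qed
qed

text \<open>The weight \<open>U\<^bsup>c0 + c1 t\<^esup>\<close> belongs to \<open>A\<^sub>t\<close> at \<open>t = A\<close>, and by openness also for \<open>t\<close> near \<open>A\<close>;
  hence \<open>f \<mapsto> U\<^bsup>c1\<^esup> M (U\<^bsup>-c1\<^esup> f)\<close> can be interpolated with respect to the fixed measure \<open>U\<^bsup>c0\<^esup> dx\<close>.\<close>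

lemma maxf_lorentz:
  fixes U :: "real^'n \<Rightarrow> real"
  assumes U[measurable]: "U \<in> borel_measurable lebesgue" and pos: "\<And>x. 0 < U x"
    and ab: "0 < \<alpha>" "0 < \<beta>" and A: "Acond \<alpha> \<beta> U" and p: "p = 1 + \<alpha> / \<beta>"
    and c: "c0 + c1 * p = \<alpha>" and q: "0 < q" and b: "1 < b"
  obtains C where "C < top" "\<And>\<phi>. \<phi> \<in> borel_measurable lebesgue \<Longrightarrow>
     dlor b p q (density lebesgue (\<lambda>x. ennreal (U x powr c0))) (\<lambda>x. maxf \<phi> x * ennreal (U x powr c1))
      \<le> C * dlor b p q (density lebesgue (\<lambda>x. ennreal (U x powr c0))) (\<lambda>x. \<phi> x * ennreal (U x powr c1))"
proof -
  obtain \<alpha>1 \<beta>1 where 1: "\<alpha> < \<alpha>1" "\<beta> < \<beta>1" "Acond \<alpha>1 \<beta>1 U"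
    by (rule Acond_open[OF U pos ab A])
  have p1: "1 < p" using ab by (simp add: p)
  \<comment> \<open>s marks the exponent t = p + s \<eta> whose weight U^(c0 + c1 t) is considered,
    s' an exponent t' = p + s' \<eta> for which this weight shall lie in A_t'. All conditions are
    strict and hold at \<eta> = 0, where they read 0 < \<alpha> < \<alpha>1, 1 < p and \<beta> <
    \<beta>1.\<close>
  define ok where "ok \<eta> s s' \<longleftrightarrow> 0 < c0 + c1 * (p + s * \<eta>) \<and> c0 + c1 * (p + s * \<eta>) < \<alpha>1 \<and> 1 < p + s' * \<eta> \<and>
     (c0 + c1 * (p + s * \<eta>)) / (p + s' * \<eta> - 1) < \<beta>1" for \<eta> s s' :: real
  have ev: "eventually (\<lambda>\<eta>. ok \<eta> s s') (at_right 0)" for s s'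
  proof -
    have t: "((\<lambda>\<eta>. p + s * \<eta>) \<longlongrightarrow> p + s * 0) (at_right 0)" for s
      by (intro tendsto_intros)
    have e: "((\<lambda>\<eta>. c0 + c1 * (p + s * \<eta>)) \<longlongrightarrow> c0 + c1 * (p + s * 0)) (at_right 0)"
      by (intro tendsto_intros)
    have f: "((\<lambda>\<eta>. (c0 + c1 * (p + s * \<eta>)) / (p + s' * \<eta> - 1)) \<longlongrightarrow> (c0 + c1 * (p + s * 0)) / (p + s' * 0 - 1)) (at_right 0)"
      using p1 by (intro tendsto_intros) auto
    have "\<alpha> / (p - 1) = \<beta>" using ab by (simp add: p)
    then show ?thesis
      using order_tendstoD[OF e] order_tendstoD[OF f] order_tendstoD[OF t[of s']] 1 p1 c ab
      unfolding ok_def by (intro eventually_conj) auto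
  qed
  \<comment> \<open>The strong bound at p + \<eta> comes from weak bounds at p and p + 2\<eta>, the
    one at p - \<eta> from p - 2\<eta> and p, each pair with its own weight.\<close>
  have "eventually (\<lambda>\<eta>. ok \<eta> 1 2 \<and> ok \<eta> 1 0 \<and> ok \<eta> (- 1) 0 \<and> ok \<eta> (- 1) (- 2) \<and> 0 < \<eta>) (at_right 0)"
    by (intro eventually_conj ev) (simp add: eventually_at_right_less)
  then obtain \<eta> where \<eta>: "ok \<eta> 1 2" "ok \<eta> 1 0" "ok \<eta> (- 1) 0" "ok \<eta> (- 1) (- 2)" "0 < \<eta>"
    using eventually_happens trivial_limit_at_right_real by blast
  have Aok: "Acond (c0 + c1 * (p + s * \<eta>)) ((c0 + c1 * (p + s * \<eta>)) / (p + s' * \<eta> - 1)) U" if "ok \<eta> s s'" for s s'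
    using that by (intro Acond_mono[OF U pos _ _ _ _ 1(3)]) (auto simp: ok_def)
  let ?M = "density lebesgue (\<lambda>x. ennreal (U x powr c0))"
  define T where "T f x = maxf (\<lambda>y. f y * ennreal (U y powr (- c1))) x * ennreal (U x powr c1)" for f x
  have T: "T f \<in> borel_measurable ?M" for f
    unfolding T_def by simp
  have sub: "T (\<lambda>x. f x + g x) x \<le> T f x + T g x"
    if "f \<in> borel_measurable ?M" "g \<in> borel_measurable ?M" for f g x
    using that unfolding T_def distrib_right
    by (subst distrib_right[symmetric], intro mult_right_mono maxf_add) auto
  have weak: "weak_type ?M T t"
    if t: "t = p + s * \<eta>" and t0: "1 < t0" "t0 < t" "t < t1"
      and oth: "t0 = p + s0 * \<eta>" "t1 = p + s1 * \<eta>" "ok \<eta> s s0" "ok \<eta> s s1" for s s0 s1 t t0 t1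
  proof -
    have e: "0 < c0 + c1 * t" using t oth by (simp add: ok_def)
    have A12: "Acond (c0 + c1 * t) ((c0 + c1 * t) / (t0 - 1)) U" "Acond (c0 + c1 * t) ((c0 + c1 * t) / (t1 - 1)) U"
      using Aok[OF oth(3)] Aok[OF oth(4)] t oth by simp_all
    obtain C where C: "C < top" "\<And>\<phi>. \<phi> \<in> borel_measurable lebesgue \<Longrightarrow>
      (\<integral>\<^sup>+x. ennpowr (maxf \<phi> x) t * ennreal (U x powr (c0 + c1 * t)) \<partial>lebesgue)
      \<le> C * (\<integral>\<^sup>+x. ennpowr (\<phi> x) t * ennreal (U x powr (c0 + c1 * t)) \<partial>lebesgue)"
      using maxf_strong_type[OF U pos e t0 A12] by blast
    show ?thesis
    proof (rule weak_type_strong[OF _ C(1) T])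
      show "0 < t" using t0 by simp
      fix f :: "real^'n \<Rightarrow> ennreal" assume "f \<in> borel_measurable ?M"
      then have [measurable]: "f \<in> borel_measurable lebesgue" by simp
      have tp: "0 < t" using t0 by simp
      let ?g = "\<lambda>y. f y * ennreal (U y powr (- c1))"
      have "(\<integral>\<^sup>+x. ennpowr (T f x) t \<partial>?M) = (\<integral>\<^sup>+x. ennpowr (maxf ?g x) t * ennreal (U x powr (c0 + c1 * t)) \<partial>lebesgue)"
      proof (subst nn_integral_density)
        show "(\<integral>\<^sup>+x. ennreal (U x powr c0) * ennpowr (T f x) t \<partial>lebesgue) = (\<integral>\<^sup>+x. ennpowr (maxf ?g x) t * ennreal (U x powr (c0 + c1 * t)) \<partial>lebesgue)"
          unfolding T_def ennpowr_mult[OF tp] ennpowr_ennreal[OF powr_ge_zero] powr_powr ennreal_powr_add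
          by (simp only: mult_ac)
      qed (use T[of f] in simp_all)
      also have "\<dots> \<le> C * (\<integral>\<^sup>+x. ennpowr (?g x) t * ennreal (U x powr (c0 + c1 * t)) \<partial>lebesgue)"
        by (rule C(2)) measurable
      also have "(\<integral>\<^sup>+x. ennpowr (?g x) t * ennreal (U x powr (c0 + c1 * t)) \<partial>lebesgue) = (\<integral>\<^sup>+x. ennpowr (f x) t \<partial>?M)"
      proof (subst nn_integral_density)
        have "- c1 * t + (c0 + c1 * t) = c0" by simp
        then show "(\<integral>\<^sup>+x. ennpowr (?g x) t * ennreal (U x powr (c0 + c1 * t)) \<partial>lebesgue) = (\<integral>\<^sup>+x. ennreal (U x powr c0) * ennpowr (f x) t \<partial>lebesgue)"
          unfolding ennpowr_mult[OF tp] ennpowr_ennreal[OF powr_ge_zero] powr_powr mult.assoc ennreal_powr_add[symmetric]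
          by (simp only: mult.commute)
      qed simp_all
      finally show "(\<integral>\<^sup>+x. ennpowr (T f x) t \<partial>?M) \<le> C * (\<integral>\<^sup>+x. ennpowr (f x) t \<partial>?M)" .
    qed
  qed
  have w0: "weak_type ?M T (p - \<eta>)"
    using \<eta> by (intro weak[of _ "- 1" "p - 2 * \<eta>" p "- 2" 0]) (auto simp: ok_def)
  have w1: "weak_type ?M T (p + \<eta>)"
    using \<eta> p1 by (intro weak[of _ 1 p "p + 2 * \<eta>" 0 2]) (auto simp: ok_def)
  have "0 < p - \<eta>" using \<eta>(4,5) by (simp add: ok_def)
  then have "\<exists>C<top. \<forall>f\<in>borel_measurable ?M. dlor b p q ?M (T f) \<le> C * dlor b p q ?M f"
    using \<eta>(5) by (intro marcinkiewicz[OF b _ _ _ q T sub w0 w1]) simp_all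
  then obtain C where C: "C < top" "\<And>f. f \<in> borel_measurable ?M \<Longrightarrow> dlor b p q ?M (T f) \<le> C * dlor b p q ?M f"
    by blast
  show thesis
  proof (rule that[OF C(1)])
    fix \<phi> :: "real^'n \<Rightarrow> ennreal" assume [measurable]: "\<phi> \<in> borel_measurable lebesgue"
    let ?f = "\<lambda>x. \<phi> x * ennreal (U x powr c1)"
    have "?f y * ennreal (U y powr (- c1)) = \<phi> y" for y
      unfolding mult.assoc ennreal_powr_add[symmetric] using pos[of y] by simp
    then have "T ?f = (\<lambda>x. maxf \<phi> x * ennreal (U x powr c1))" by (simp add: T_def fun_eq_iff)
    then show "dlor b p q ?M (\<lambda>x. maxf \<phi> x * ennreal (U x powr c1)) \<le> C * dlor b p q ?M (\<lambda>x. \<phi> x * ennreal (U x powr c1))"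
      using C(2)[of ?f] by simp
  qed
qed

section \<open>Spaces of Lorentz type\<close>

definition lam :: "real \<Rightarrow> real \<Rightarrow> real \<Rightarrow> ('a::euclidean_space \<Rightarrow> real) \<Rightarrow> ('a \<Rightarrow> real) \<Rightarrow> ('a \<Rightarrow> complex) \<Rightarrow> ennreal" where
  "lam b p q w m f = dlor b p q (density lebesgue (\<lambda>x. ennreal (w x))) (\<lambda>x. ennreal (cmod (f x) * m x))"

text \<open>\<open>E\<close> is, up to equivalence of quasi-norms, the space of all \<open>f\<close> with \<open>f m \<in> L\<^sup>p\<^sup>,\<^sup>q(w dx)\<close>. This
  class of spaces is closed under powers and Koethe duality.\<close>

definition lor_eq ::
    "'a::euclidean_space fun_space \<Rightarrow> real \<Rightarrow> real \<Rightarrow> real \<Rightarrow> ('a \<Rightarrow> real) \<Rightarrow> ('a \<Rightarrow> real) \<Rightarrow> bool" where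
  "lor_eq E b p q w m \<longleftrightarrow>
     elems E = {f \<in> borel_measurable lebesgue. lam b p q w m f < top} \<and>
     (\<forall>f\<in>borel_measurable lebesgue. \<forall>c>0. qnorm E (\<lambda>x. complex_of_real c * f x) = ennreal c * qnorm E f) \<and>
     (\<exists>C<top. \<forall>f\<in>borel_measurable lebesgue.
        qnorm E f \<le> C * ennpowr (lam b p q w m f) (1/q) \<and> ennpowr (lam b p q w m f) (1/q) \<le> C * qnorm E f)"

section \<open>Weighted Lorentz spaces and their powers in discrete form\<close>

text \<open>Superlevel sets of an antitone function are initial segments of the line.\<close>

lemma borel_measurable_antimono_ennreal:
  fixes d :: "real \<Rightarrow> ennreal"
  assumes "antimono d" shows "d \<in> borel_measurable borel"
proof (rule borel_measurableI_greater)
  fix y :: ennreal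
  let ?S = "{t. y < d t}"
  have down: "s \<in> ?S" if "t \<in> ?S" "s \<le> t" for s t
    using that assms by (auto simp: antimono_def intro: less_le_trans)
  have "?S \<in> sets borel"
  proof (cases "?S = {} \<or> \<not> bdd_above ?S")
    case True
    then show ?thesis
    proof
      assume unb: "\<not> bdd_above ?S"
      have "s \<in> ?S" for s
      proof -
        obtain t where "t \<in> ?S" "s < t" using unb unfolding bdd_above_def by (meson not_le)
        then show ?thesis using down[of t s] by simp
      qed
      then have "?S = UNIV" by blast
      then show ?thesis by simp
    qed simp
  next
    case False
    then have S: "?S \<noteq> {}" "bdd_above ?S" by auto
    have "s \<in> ?S" if s: "s < Sup ?S" for s
    proof -
      obtain t where "t \<in> ?S" "s < t" using s less_cSup_iff[OF S] by blast
      then show ?thesis using down[of t s] by simp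
    qed
    moreover have "s \<le> Sup ?S" if "s \<in> ?S" for s using that S(2) by (rule cSup_upper)
    ultimately have "?S = {..<Sup ?S} \<or> ?S = {..Sup ?S}" by (force simp: le_less)
    then show ?thesis by (metis borel_closed borel_open closed_atMost open_lessThan)
  qed
  then show "{t \<in> space borel. y < d t} \<in> sets borel" by simp
qed

text \<open>Between b^k and b^(k+1) the function d lies between its values at the ends and t is
  comparable to b^k. The upper bound uses the left end, the lower bound the right end.\<close>

lemma lorentz_dyadic:
  fixes d :: "real \<Rightarrow> ennreal"
  assumes anti: "antimono d" and b: "1 < b" and p: "0 < p" and q: "0 < q"
  defines "I \<equiv> \<integral>\<^sup>+t. ennpowr (ennreal t * ennpowr (d t) (1/p)) q \<partial>dlambda_over_lambda"
  defines "L \<equiv> \<integral>\<^sup>+k. levp b k q * ennpowr (d (b powr real_of_int k)) (q/p) \<partial>count_space UNIV"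
  shows "I \<le> ennreal (b powr q * (b - 1)) * L" "L \<le> ennreal (b powr q * b / (b - 1)) * I"
proof -
  have d[measurable]: "d \<in> borel_measurable borel" by (rule borel_measurable_antimono_ennreal[OF anti])
  define R where "R k = {b powr real_of_int k<..b powr (real_of_int k + 1)}" for k :: int
  define G where "G t = ennreal (1/t) * ennpowr (ennreal t * ennpowr (d t) (1/p)) q" for t :: real
  have [measurable]: "G \<in> borel_measurable borel" unfolding G_def by measurable
  have disj: "disjoint_family_on R UNIV"
    unfolding disjoint_family_on_def
  proof (intro ballI impI)
    fix j k :: int assume "j \<noteq> k"
    have "R j \<inter> R k = {}" if "j < k" for j k
    proof -
      have "real_of_int j + 1 \<le> real_of_int k" using that by linarith
      then have "b powr (real_of_int j + 1) \<le> b powr real_of_int k" using b by (intro powr_mono) auto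
      then show ?thesis by (auto simp: R_def)
    qed
    then show "R j \<inter> R k = {}" using \<open>j \<noteq> k\<close> by (metis Int_commute linorder_neqE)
  qed
  have UN: "(\<Union>k. R k) = {0<..}"
  proof
    have "0 < t" if "t \<in> R k" for t k
      using that le_less_trans[OF powr_ge_zero] by (auto simp: R_def)
    then show "(\<Union>k. R k) \<subseteq> {0<..}" by auto
    show "{0<..} \<subseteq> (\<Union>k. R k)"
    proof
      fix t :: real assume "t \<in> {0<..}"
      then obtain K where "lev b K < ennreal t" "ennreal t \<le> ennreal (b powr (real_of_int K + 1))"
        using level_exists[OF b, of "ennreal t"] by auto
      then have "t \<in> R K" using \<open>t \<in> {0<..}\<close> by (auto simp: R_def ennreal_less_iff)
      then show "t \<in> (\<Union>k. R k)" by blast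
    qed
  qed
  have "I = (\<integral>\<^sup>+t. G t * indicator {0<..} t \<partial>lborel)"
    unfolding I_def dlambda_over_lambda_def
    by (subst nn_integral_density) (auto intro!: nn_integral_cong simp: G_def mult_ac)
  also have "\<dots> = (\<integral>\<^sup>+t. (\<Sum>\<^sup>+k. G t * indicator (R k) t) \<partial>lborel)"
    unfolding nn_integral_count_space_disjoint[OF disj] UN ..
  also have "\<dots> = (\<Sum>\<^sup>+k. (\<integral>\<^sup>+t\<in>R k. G t \<partial>lborel))"
    by (rule nn_integral_count_space_nn_integral) (auto simp: R_def)
  finally have I: "I = (\<Sum>\<^sup>+k. (\<integral>\<^sup>+t\<in>R k. G t \<partial>lborel))" .
  have G: "G t = ennreal (1/t) * (ennreal (t powr q) * ennpowr (d t) (q/p))" if "0 < t" for t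
    using that q by (simp add: G_def ennpowr_mult ennpowr_ennpowr ennpowr_ennreal)
  have len: "emeasure lborel (R k) = ennreal ((b - 1) * b powr real_of_int k)" for k
    using b by (simp add: R_def powr_add algebra_simps)
  have up: "(\<integral>\<^sup>+t\<in>R k. G t \<partial>lborel) \<le> ennreal (b powr q * (b - 1)) * (levp b k q * ennpowr (d (b powr real_of_int k)) (q/p))" for k
  proof -
    let ?c = "ennreal (1 / b powr real_of_int k) * (ennreal (b powr ((real_of_int k + 1) * q)) * ennpowr (d (b powr real_of_int k)) (q/p))"
    have "(\<integral>\<^sup>+t\<in>R k. G t \<partial>lborel) \<le> (\<integral>\<^sup>+t\<in>R k. ?c \<partial>lborel)"
    proof (intro nn_integral_mono)
      fix t
      show "G t * indicator (R k) t \<le> ?c * indicator (R k) t"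
      proof (cases "t \<in> R k")
        case True
        have k0: "0 < b powr real_of_int k" using b by simp
        have t: "b powr real_of_int k \<le> t" "t \<le> b powr (real_of_int k + 1)" "0 < t"
          using True le_less_trans[OF powr_ge_zero] by (auto simp: R_def)
        have "t powr q \<le> (b powr (real_of_int k + 1)) powr q" using t q by (intro powr_mono2) auto
        moreover have "d t \<le> d (b powr real_of_int k)" using anti t by (simp add: antimonoD)
        moreover have "1 / t \<le> 1 / b powr real_of_int k" by (intro divide_left_mono mult_pos_pos t k0) simp
        ultimately have "G t \<le> ?c"
          unfolding G[OF t(3)] using p q by (intro mult_mono ennreal_leI ennpowr_mono) (auto simp: powr_powr)
        then show ?thesis using True by simp
      qed simp
    qed
    also have "\<dots> = ?c * emeasure lborel (R k)"
      by (rule nn_integral_cmult_indicator) (simp add: R_def)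
    also have "\<dots> = (ennreal (1 / b powr real_of_int k) * ennreal (b powr ((real_of_int k + 1) * q)) * ennreal ((b - 1) * b powr real_of_int k)) * ennpowr (d (b powr real_of_int k)) (q/p)"
      unfolding len by (simp only: mult_ac)
    also have "ennreal (1 / b powr real_of_int k) * ennreal (b powr ((real_of_int k + 1) * q)) * ennreal ((b - 1) * b powr real_of_int k)
       = ennreal (b powr q * (b - 1) * b powr (real_of_int k * q))"
    proof -
      have e: "(real_of_int k + 1) * q = q + real_of_int k * q" by (simp add: algebra_simps)
      have "1 / b powr real_of_int k * b powr ((real_of_int k + 1) * q) * ((b - 1) * b powr real_of_int k) = b powr q * (b - 1) * b powr (real_of_int k * q)"
        unfolding e powr_add using b by simp
      then show ?thesis using b by (simp flip: ennreal_mult)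
    qed
    also have "\<dots> = ennreal (b powr q * (b - 1)) * levp b k q"
      using b by (intro ennreal_mult) auto
    finally show ?thesis by (simp only: mult.assoc)
  qed
  have "I \<le> (\<Sum>\<^sup>+k. ennreal (b powr q * (b - 1)) * (levp b k q * ennpowr (d (b powr real_of_int k)) (q/p)))"
    unfolding I by (intro nn_integral_mono up)
  also have "\<dots> = ennreal (b powr q * (b - 1)) * L"
    unfolding L_def by (rule nn_integral_cmult) simp
  finally show "I \<le> ennreal (b powr q * (b - 1)) * L" .
  \<comment> \<open>The right end carries the index k + 1; translating the sum undoes the
    shift.\<close>
  have lo: "ennreal (b powr (real_of_int (k + 1) * q)) * ennpowr (d (b powr real_of_int (k + 1))) (q/p) \<le> ennreal (b powr q * b / (b - 1)) * (\<integral>\<^sup>+t\<in>R k. G t \<partial>lborel)" for k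
  proof -
    let ?c = "ennreal (1 / b powr (real_of_int k + 1)) * (levp b k q * ennpowr (d (b powr (real_of_int k + 1))) (q/p))"
    have "?c * emeasure lborel (R k) = (\<integral>\<^sup>+t\<in>R k. ?c \<partial>lborel)"
      by (rule nn_integral_cmult_indicator[symmetric]) (simp add: R_def)
    also have "\<dots> \<le> (\<integral>\<^sup>+t\<in>R k. G t \<partial>lborel)"
    proof (intro nn_integral_mono)
      fix t
      show "?c * indicator (R k) t \<le> G t * indicator (R k) t"
      proof (cases "t \<in> R k")
        case True
        have k0: "0 < b powr real_of_int k" using b by simp
        have t: "b powr real_of_int k \<le> t" "t \<le> b powr (real_of_int k + 1)" "0 < t"
          using True le_less_trans[OF powr_ge_zero] by (auto simp: R_def)
        have k1: "0 < b powr (real_of_int k + 1)" using b by simp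
        have "(b powr real_of_int k) powr q \<le> t powr q" using t q by (intro powr_mono2) auto
        moreover have "d (b powr (real_of_int k + 1)) \<le> d t" using anti t by (simp add: antimonoD)
        moreover have "1 / b powr (real_of_int k + 1) \<le> 1 / t" by (intro divide_left_mono mult_pos_pos t k1) simp
        ultimately have "?c \<le> G t"
          unfolding G[OF t(3)] using p q by (intro mult_mono ennreal_leI ennpowr_mono) (auto simp: powr_powr)
        then show ?thesis using True by simp
      qed simp
    qed
    finally have 1: "?c * emeasure lborel (R k) \<le> (\<integral>\<^sup>+t\<in>R k. G t \<partial>lborel)" .
    have "b powr q * b / (b - 1) * (1 / b powr (real_of_int k + 1) * b powr (real_of_int k * q) * ((b - 1) * b powr real_of_int k)) = b powr (real_of_int (k + 1) * q)"
    proof -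
      have e: "real_of_int (k + 1) * q = q + real_of_int k * q" by (simp add: algebra_simps)
      show ?thesis unfolding e powr_add using b by simp
    qed
    then have "ennreal (b powr (real_of_int (k + 1) * q)) = ennreal (b powr q * b / (b - 1)) * (ennreal (1 / b powr (real_of_int k + 1)) * levp b k q * ennreal ((b - 1) * b powr real_of_int k))"
      using b by (simp flip: ennreal_mult)
    then have "ennreal (b powr (real_of_int (k + 1) * q)) * ennpowr (d (b powr real_of_int (k + 1))) (q/p)
       = ennreal (b powr q * b / (b - 1)) * (?c * emeasure lborel (R k))"
      unfolding len by (simp add: mult_ac add.commute)
    also have "\<dots> \<le> ennreal (b powr q * b / (b - 1)) * (\<integral>\<^sup>+t\<in>R k. G t \<partial>lborel)"
      by (rule mult_left_mono[OF 1]) simp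
    finally show ?thesis .
  qed
  have "L = (\<Sum>\<^sup>+k. ennreal (b powr (real_of_int (k + 1) * q)) * ennpowr (d (b powr real_of_int (k + 1))) (q/p))"
    unfolding L_def
    using nn_integral_int_shift[where n=1 and f="\<lambda>k. levp b k q * ennpowr (d (b powr real_of_int k)) (q/p)"] by (rule sym)
  also have "\<dots> \<le> (\<Sum>\<^sup>+k. ennreal (b powr q * b / (b - 1)) * (\<integral>\<^sup>+t\<in>R k. G t \<partial>lborel))"
    by (intro nn_integral_mono lo)
  also have "\<dots> = ennreal (b powr q * b / (b - 1)) * I"
    unfolding I by (rule nn_integral_cmult) simp
  finally show "L \<le> ennreal (b powr q * b / (b - 1)) * I" .
qed

text \<open>d\<lambda>/\<lambda> is the Haar measure of the multiplicative group; its dilation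
  invariance makes the Lorentz norm exactly homogeneous.\<close>

lemma dlambda_scale:
  fixes h :: "real \<Rightarrow> ennreal"
  assumes [measurable]: "h \<in> borel_measurable borel" and c: "0 < c"
  shows "(\<integral>\<^sup>+t. h (t / c) \<partial>dlambda_over_lambda) = (\<integral>\<^sup>+t. h t \<partial>dlambda_over_lambda)"
proof -
  let ?k = "\<lambda>t. ennreal (1 / t) * indicator {0<..} t"
  have "(\<integral>\<^sup>+t. h (t / c) \<partial>dlambda_over_lambda) = (\<integral>\<^sup>+t. ?k t * h (t / c) \<partial>lborel)"
    unfolding dlambda_over_lambda_def by (subst nn_integral_density) auto
  also have "\<dots> = ennreal \<bar>c\<bar> * (\<integral>\<^sup>+t. ?k (0 + c * t) * h ((0 + c * t) / c) \<partial>lborel)"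
    using c by (intro nn_integral_real_affine) auto
  also have "\<dots> = (\<integral>\<^sup>+t. ennreal \<bar>c\<bar> * (?k (0 + c * t) * h ((0 + c * t) / c)) \<partial>lborel)"
    by (rule nn_integral_cmult[symmetric]) measurable
  also have "\<dots> = (\<integral>\<^sup>+t. ?k t * h t \<partial>lborel)"
  proof (rule nn_integral_cong)
    fix t
    show "ennreal \<bar>c\<bar> * (?k (0 + c * t) * h ((0 + c * t) / c)) = ?k t * h t"
    proof (cases "0 < t")
      case True
      then have "ennreal \<bar>c\<bar> * ennreal (1 / (c * t)) = ennreal (1 / t)"
        using c by (simp flip: ennreal_mult)
      then show ?thesis using True c by (simp add: mult.assoc[symmetric])
    qed (use c in \<open>simp add: zero_less_mult_iff\<close>)
  qed
  also have "\<dots> = (\<integral>\<^sup>+t. h t \<partial>dlambda_over_lambda)"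
    unfolding dlambda_over_lambda_def by (subst nn_integral_density) auto
  finally show ?thesis .
qed

lemma lor_eq_lorentz_space:
  fixes v :: "'a::euclidean_space \<Rightarrow> real"
  assumes [measurable]: "v \<in> borel_measurable lebesgue" and p: "0 < p" and q: "0 < q" and b: "1 < b"
  shows "lor_eq (lorentz_space p q v) b p q (\<lambda>x. v x powr p) (\<lambda>_. 1)"
proof -
  define d where "d f t = (\<integral>\<^sup>+x\<in>{x. cmod (f x) > t}. ennreal (v x powr p) \<partial>lebesgue)" for f :: "'a \<Rightarrow> complex" and t
  define I where "I f = (\<integral>\<^sup>+t. ennpowr (ennreal t * ennpowr (d f t) (1/p)) q \<partial>dlambda_over_lambda)" for f
  have anti: "antimono (d f)" for f
    unfolding antimono_def d_def by (intro allI impI nn_integral_mono) (auto simp: indicator_def)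
  have norm: "lorentz_norm p q v f = ennreal (p powr (1/q)) * ennpowr (I f) (1/q)" for f
    by (simp add: lorentz_norm_def Lnorm_def I_def d_def)
  have lam: "lam b p q (\<lambda>x. v x powr p) (\<lambda>_. 1) f =
      (\<Sum>\<^sup>+k. levp b k q * ennpowr (d f (b powr real_of_int k)) (q/p))"
    if [measurable]: "f \<in> borel_measurable lebesgue" for f
    unfolding lam_def dlor_def
  proof (intro nn_integral_cong)
    fix k :: int
    have "{x \<in> space (density lebesgue (\<lambda>x. ennreal (v x powr p))). lev b k < ennreal (cmod (f x) * 1)}
        = {x \<in> space lebesgue. b powr real_of_int k < cmod (f x)}"
      using b by (auto simp: ennreal_less_iff)
    moreover have "emeasure (density lebesgue (\<lambda>x. ennreal (v x powr p))) {x \<in> space lebesgue. b powr real_of_int k < cmod (f x)} = d f (b powr real_of_int k)"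
    proof -
      have S: "{x \<in> space lebesgue. b powr real_of_int k < cmod (f x)} \<in> sets lebesgue" by measurable
      have w: "(\<lambda>x. ennreal (v x powr p)) \<in> borel_measurable lebesgue" by measurable
      show ?thesis unfolding emeasure_density[OF w S] d_def by simp
    qed
    ultimately show "levp b k q * ennpowr (emeasure (density lebesgue (\<lambda>x. ennreal (v x powr p))) {x \<in> space (density lebesgue (\<lambda>x. ennreal (v x powr p))). lev b k < ennreal (cmod (f x) * 1)}) (q/p)
      = levp b k q * ennpowr (d f (b powr real_of_int k)) (q/p)"
      by (simp only:)
  qed
  let ?L = "lam b p q (\<lambda>x. v x powr p) (\<lambda>_. 1)"
  define c1 where "c1 = ennreal (b powr q * (b - 1))"
  define c2 where "c2 = ennreal (b powr q * b / (b - 1))"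
  have IL: "I f \<le> c1 * ?L f" "?L f \<le> c2 * I f" if "f \<in> borel_measurable lebesgue" for f
    using lorentz_dyadic[OF anti b p q, of f] lam[OF that] by (simp_all add: I_def c1_def c2_def)
  have q': "0 < 1/q" using q by simp
  define P where "P = ennreal (p powr (1/q))"
  have P: "P * ennreal (p powr (- (1/q))) = 1"
    using p by (simp add: P_def flip: ennreal_mult powr_add)
  have fin: "lorentz_norm p q v f < \<infinity> \<longleftrightarrow> ?L f < top" if "f \<in> borel_measurable lebesgue" for f
  proof -
    have "I f < top \<longleftrightarrow> ?L f < top"
      using IL[OF that] by (auto simp: c1_def c2_def ennreal_mult_less_top intro: le_less_trans)
    moreover have "0 < p powr (1/q)" using p by simp
    ultimately show ?thesis
      unfolding norm by (auto simp: ennreal_mult_less_top ennreal_eq_0_iff)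
  qed
  have hom: "lorentz_norm p q v (\<lambda>x. complex_of_real c * f x) = ennreal c * lorentz_norm p q v f"
    if c: "0 < c" for c f
  proof -
    have dc: "d (\<lambda>x. complex_of_real c * f x) t = d f (t / c)" for t
    proof -
      have "{x. cmod (complex_of_real c * f x) > t} = {x. cmod (f x) > t / c}"
        using c by (auto simp: norm_mult divide_less_eq mult.commute)
      then show ?thesis unfolding d_def by simp
    qed
    have [measurable]: "d f \<in> borel_measurable borel" by (rule borel_measurable_antimono_ennreal[OF anti])
    have "I (\<lambda>x. complex_of_real c * f x) = (\<integral>\<^sup>+t. ennpowr (ennreal c) q * ennpowr (ennreal (t / c) * ennpowr (d f (t / c)) (1/p)) q \<partial>dlambda_over_lambda)"
      unfolding I_def dc
    proof (rule nn_integral_cong)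
      fix t
      \<comment> \<open>For negative t both sides are 0.\<close>
      have "ennreal t = ennreal c * ennreal (t / c)"
        using c by (cases "0 \<le> t") (simp_all add: ennreal_neg divide_nonpos_pos flip: ennreal_mult)
      then show "ennpowr (ennreal t * ennpowr (d f (t / c)) (1/p)) q = ennpowr (ennreal c) q * ennpowr (ennreal (t / c) * ennpowr (d f (t / c)) (1/p)) q"
        using q by (simp only: ennpowr_mult mult.assoc)
    qed
    also have "\<dots> = ennpowr (ennreal c) q * (\<integral>\<^sup>+t. ennpowr (ennreal (t / c) * ennpowr (d f (t / c)) (1/p)) q \<partial>dlambda_over_lambda)"
      by (rule nn_integral_cmult) (simp add: dlambda_over_lambda_def)
    also have "(\<integral>\<^sup>+t. ennpowr (ennreal (t / c) * ennpowr (d f (t / c)) (1/p)) q \<partial>dlambda_over_lambda) = I f"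
      unfolding I_def using dlambda_scale[of "\<lambda>t. ennpowr (ennreal t * ennpowr (d f t) (1/p)) q" c] c by simp
    finally have "ennpowr (I (\<lambda>x. complex_of_real c * f x)) (1/q) = ennreal c * ennpowr (I f) (1/q)"
      using q by (simp add: ennpowr_mult ennpowr_ennpowr)
    then show ?thesis unfolding norm by (simp add: mult_ac)
  qed
  define C where "C = P * ennpowr c1 (1/q) + ennpowr c2 (1/q) * ennreal (p powr (- (1/q)))"
  have "C < top" by (simp add: C_def P_def c1_def c2_def ennreal_mult_less_top)
  moreover have "lorentz_norm p q v f \<le> C * ennpowr (?L f) (1/q) \<and> ennpowr (?L f) (1/q) \<le> C * lorentz_norm p q v f"
    if f: "f \<in> borel_measurable lebesgue" for f
  proof
    have "lorentz_norm p q v f \<le> P * ennpowr (c1 * ?L f) (1/q)"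
      unfolding norm P_def using q by (intro mult_left_mono ennpowr_mono IL f) auto
    also have "\<dots> = (P * ennpowr c1 (1/q)) * ennpowr (?L f) (1/q)"
      by (simp only: ennpowr_mult[OF q'] mult.assoc)
    also have "\<dots> \<le> C * ennpowr (?L f) (1/q)" by (intro mult_right_mono) (auto simp: C_def)
    finally show "lorentz_norm p q v f \<le> C * ennpowr (?L f) (1/q)" .
    have "ennpowr (?L f) (1/q) \<le> ennpowr (c2 * I f) (1/q)"
      using q by (intro ennpowr_mono IL f) auto
    also have "\<dots> = ennpowr c2 (1/q) * (P * ennreal (p powr (- (1/q)))) * ennpowr (I f) (1/q)"
      unfolding P by (simp only: ennpowr_mult[OF q'] mult_1_right)
    also have "\<dots> = (ennpowr c2 (1/q) * ennreal (p powr (- (1/q)))) * lorentz_norm p q v f"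
      unfolding norm P_def by (simp only: mult_ac)
    also have "\<dots> \<le> C * lorentz_norm p q v f" by (intro mult_right_mono) (auto simp: C_def)
    finally show "ennpowr (?L f) (1/q) \<le> C * lorentz_norm p q v f" .
  qed
  ultimately show ?thesis
    unfolding lor_eq_def using fin hom by (auto simp: lorentz_space_def)
qed

text \<open>|f|^(1/t) m > b^k is the same as |f| m^t > (b^t)^k, so the functional does not change at
  all once the base is b^t; only the equivalence constant is raised to the power t.\<close>

lemma lor_eq_space_power:
  fixes w m :: "'a::euclidean_space \<Rightarrow> real"
  assumes E: "lor_eq E b p q w m" and t: "0 < t" and b: "1 < b" and mpos: "\<And>x. 0 < m x" and q: "0 < q"
  shows "lor_eq (space_power E t) (b powr t) (p/t) (q/t) w (\<lambda>x. m x powr t)"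
proof -
  let ?A = "\<lambda>f. abs_powr f (1/t)"
  have meas: "?A f \<in> borel_measurable lebesgue" if [measurable]: "f \<in> borel_measurable lebesgue" for f
    unfolding abs_powr_def by measurable
  have lam: "lam b p q w m (?A f) = lam (b powr t) (p/t) (q/t) w (\<lambda>x. m x powr t) f" for f
  proof -
    have "lev b k < ennreal (cmod (?A f x) * m x)
        \<longleftrightarrow> ennreal ((b powr t) powr real_of_int k) < ennreal (cmod (f x) * m x powr t)" for k x
    proof -
      have A: "cmod (?A f x) = cmod (f x) powr (1/t)" by (simp add: abs_powr_def)
      have "ennpowr (ennreal (cmod (?A f x) * m x)) t = ennreal (cmod (f x) * m x powr t)"
        unfolding A using t mpos[of x] by (simp add: ennpowr_ennreal powr_mult powr_powr)
      moreover have "ennpowr (lev b k) t = ennreal ((b powr t) powr real_of_int k)"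
        by (simp add: ennpowr_ennreal powr_powr mult.commute)
      ultimately show ?thesis using ennpowr_less_iff[OF t] by metis
    qed
    moreover have "b powr (real_of_int k * q) = (b powr t) powr (real_of_int k * (q/t))" for k
      using t by (simp add: powr_powr)
    ultimately show ?thesis using t unfolding lam_def dlor_def by simp
  qed
  obtain C where C: "C < top" "\<And>f. f \<in> borel_measurable lebesgue \<Longrightarrow>
        qnorm E f \<le> C * ennpowr (lam b p q w m f) (1/q)" "\<And>f. f \<in> borel_measurable lebesgue \<Longrightarrow>
        ennpowr (lam b p q w m f) (1/q) \<le> C * qnorm E f"
    using E unfolding lor_eq_def by blast
  have hom: "qnorm E (\<lambda>x. complex_of_real c * f x) = ennreal c * qnorm E f" if "0 < c" "f \<in> borel_measurable lebesgue" for c f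
    using E that unfolding lor_eq_def by blast
  have el: "elems E = {f \<in> borel_measurable lebesgue. lam b p q w m f < top}"
    using E unfolding lor_eq_def by blast
  have qn: "qnorm (space_power E t) f = ennpowr (qnorm E (?A f)) t" for f by (simp add: space_power_def)
  have e: "1/(q/t) = 1/q * t" using q t by simp
  show ?thesis
    unfolding lor_eq_def
  proof (intro conjI exI[of _ "ennpowr C t"] ballI allI impI)
    show "elems (space_power E t) = {f \<in> borel_measurable lebesgue. lam (b powr t) (p/t) (q/t) w (\<lambda>x. m x powr t) f < top}"
      using meas by (auto simp: space_power_def el lam)
    fix f :: "'a \<Rightarrow> complex" assume f: "f \<in> borel_measurable lebesgue"
    show "qnorm (space_power E t) f \<le> ennpowr C t * ennpowr (lam (b powr t) (p/t) (q/t) w (\<lambda>x. m x powr t) f) (1/(q/t))"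
      unfolding qn lam[symmetric] e ennpowr_ennpowr[symmetric] ennpowr_mult[OF t, symmetric]
      using t by (intro ennpowr_mono C(2) meas f) simp
    show "ennpowr (lam (b powr t) (p/t) (q/t) w (\<lambda>x. m x powr t) f) (1/(q/t)) \<le> ennpowr C t * qnorm (space_power E t) f"
      unfolding qn lam[symmetric] e ennpowr_ennpowr[symmetric] ennpowr_mult[OF t, symmetric]
      using t by (intro ennpowr_mono C(3) meas f) simp
    fix c :: real assume c: "0 < c"
    have "?A (\<lambda>x. complex_of_real c * f x) = (\<lambda>x. complex_of_real (c powr (1/t)) * ?A f x)"
      using c by (simp add: abs_powr_def norm_mult powr_mult fun_eq_iff)
    then show "qnorm (space_power E t) (\<lambda>x. complex_of_real c * f x) = ennreal c * qnorm (space_power E t) f"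
      unfolding qn using hom[of "c powr (1/t)" "?A f"] c t meas[OF f] by (simp add: ennpowr_mult ennpowr_ennreal powr_powr)
  qed (use C in simp)
qed

section \<open>Duality\<close>

lemma nn_integral_powr_below:
  fixes e :: ennreal
  assumes "0 < a"
  shows "(\<integral>\<^sup>+t. ennreal (t powr (a - 1)) * indicator {t. 0 < t \<and> ennreal t < e} t \<partial>lborel) \<le> ennreal (1/a) * ennpowr e a"
proof (cases e)
  case (real r)
  have "(\<integral>\<^sup>+t. ennreal (t powr (a - 1)) * indicator {t. 0 < t \<and> ennreal t < e} t \<partial>lborel)
      \<le> (\<integral>\<^sup>+t. ennreal (indicator {0..r} t * t powr (a - 1)) \<partial>lborel)"
    using real by (intro nn_integral_mono) (auto simp: indicator_def ennreal_less_iff)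
  also have "\<dots> = ennreal (r powr (a - 1 + 1) / (a - 1 + 1))"
    using has_integral_powr_from_0[of "a - 1" r] assms real
    by (intro nn_integral_has_integral_lebesgue) auto
  also have "\<dots> = ennreal (1/a) * ennpowr e a"
    using real assms by (simp add: ennpowr_ennreal flip: ennreal_mult)
  finally show ?thesis .
qed (use assms in \<open>simp add: ennreal_mult_top\<close>)

text \<open>Writing the minimum as an integral over t separates the measures of two level sets, so
  that a pairing of functions becomes an integral of a product in one real variable.\<close>

lemma nn_integral_min:
  fixes d e :: ennreal
  shows "min d e = (\<integral>\<^sup>+t. indicator {t. 0 < t \<and> ennreal t < d} t * indicator {t. 0 < t \<and> ennreal t < e} t \<partial>lborel)"
proof -
  have *: "(\<integral>\<^sup>+t. indicator {t. 0 < t \<and> ennreal t < c} t \<partial>lborel) = c" for c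
  proof (cases c)
    case (real r)
    then have "{t. 0 < t \<and> ennreal t < c} = {0<..<r}" by (auto simp: ennreal_less_iff)
    then show ?thesis using real by simp
  next
    case top
    then have "{t. 0 < t \<and> ennreal t < c} = {0<..}" by auto
    moreover have "emeasure lborel {0::real<..} = top"
    proof (rule ccontr)
      assume "emeasure lborel {0::real<..} \<noteq> top"
      then obtain r where r: "emeasure lborel {0::real<..} = ennreal r" "0 \<le> r" by (cases "emeasure lborel {0::real<..}") auto
      have "emeasure lborel {0<..<r + 1} \<le> emeasure lborel {0::real<..}" by (intro emeasure_mono) auto
      then show False using r by simp
    qed
    ultimately show ?thesis using top by simp
  qed
  have "indicator {t. 0 < t \<and> ennreal t < d} t * indicator {t. 0 < t \<and> ennreal t < e} t = (indicator {t. 0 < t \<and> ennreal t < min d e} t :: ennreal)" for t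
    by (auto simp: indicator_def)
  then show ?thesis by (simp only: *)
qed

text \<open>A sum of distinct powers of \<open>b\<close> is comparable to its largest term.\<close>

lemma sum_levels_powr_le:
  fixes S :: "int set"
  assumes b: "1 < b" and q: "0 < q"
  shows "ennpowr (\<Sum>\<^sup>+j. lev b j * indicator S j) q
    \<le> ennpowr (geosum b 1) q * (\<Sum>\<^sup>+j. levp b j q * indicator S j)"
proof (cases "\<exists>m. \<forall>j\<in>S. j \<le> m")
  case False
  have "(\<Sum>\<^sup>+j. levp b j q * indicator S j) = top"
  proof (rule ccontr)
    assume "\<not> ?thesis"
    then obtain r where r: "(\<Sum>\<^sup>+j. levp b j q * indicator S j) = ennreal r" "0 \<le> r"
      by (cases "\<integral>\<^sup>+j. levp b j q * indicator S j \<partial>count_space UNIV") auto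
    obtain j where j: "j \<in> S" "\<lceil>log b (r + 1) / q\<rceil> < j" using False by (meson not_le)
    then have "log b (r + 1) / q \<le> j" by linarith
    then have "log b (r + 1) \<le> j * q" using q by (simp add: divide_le_eq)
    then have "r + 1 \<le> b powr (j * q)" using b r by (subst le_powr_iff) auto
    then have "ennreal (r + 1) \<le> levp b j q * indicator S j" using j(1) by (simp add: ennreal_leI)
    also have "\<dots> \<le> ennreal r" unfolding r(1)[symmetric] by (rule nn_integral_ge_point) simp
    finally show False using r by simp
  qed
  moreover have "geosum b 1 \<noteq> 0" using geosum_ge_1[of b 1] b by auto
  ultimately show ?thesis by (simp add: ennreal_mult_top)
next
  case True
  then obtain m where m: "\<And>j. j \<in> S \<Longrightarrow> j \<le> m" by blast
  show ?thesis
  proof (cases "S = {}")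
    case False
    then obtain j0 where "j0 \<in> S" by blast
    \<comment> \<open>The largest element of S, found as the least distance below the bound
      m.\<close>
    define J where "J = m - int (LEAST n. m - int n \<in> S)"
    have "m - int (nat (m - j0)) \<in> S" using m[OF \<open>j0 \<in> S\<close>] \<open>j0 \<in> S\<close> by simp
    then have J: "J \<in> S" unfolding J_def by (rule LeastI)
    have J_max: "j \<le> J" if "j \<in> S" for j
    proof -
      have "m - int (nat (m - j)) \<in> S" using m[OF that] that by simp
      then have "(LEAST n. m - int n \<in> S) \<le> nat (m - j)" by (rule Least_le)
      then show ?thesis using m[OF that] by (simp add: J_def)
    qed
    have "(\<Sum>\<^sup>+j. lev b j * indicator S j)
        \<le> (\<Sum>\<^sup>+j. lev b J * ennreal (b powr (- 1 * \<bar>real_of_int j - real_of_int J\<bar>)))"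
    proof (rule nn_integral_mono)
      fix j
      show "lev b j * indicator S j \<le> lev b J * ennreal (b powr (- 1 * \<bar>real_of_int j - real_of_int J\<bar>))"
        using J_max[of j] by (cases "j \<in> S") (simp_all flip: ennreal_powr_add)
    qed
    also have "\<dots> = lev b J * geosum b 1"
      by (subst nn_integral_cmult) (simp_all only: geosum_shift borel_measurable_count_space)
    finally have "ennpowr (\<Sum>\<^sup>+j. lev b j * indicator S j) q
        \<le> ennpowr (lev b J * geosum b 1) q"
      using q by (intro ennpowr_mono) auto
    also have "\<dots> = ennpowr (geosum b 1) q * (levp b J q * indicator S J)"
      using J q by (simp add: ennpowr_mult ennpowr_ennreal powr_powr mult.commute)
    also have "\<dots> \<le> ennpowr (geosum b 1) q * (\<Sum>\<^sup>+j. levp b j q * indicator S j)"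
      by (intro mult_left_mono nn_integral_ge_point) auto
    finally show ?thesis .
  qed simp
qed

text \<open>If d j is the measure of the set where \<phi> > b^j, the sum over j is comparable to the
  decreasing rearrangement of \<phi> at t. The left side is then the q-th power of the Lorentz norm
  in its rearrangement form.\<close>

lemma sum_levels_integral_le:
  fixes d :: "int \<Rightarrow> ennreal"
  assumes b: "1 < b" and q: "0 < q" and p: "0 < p"
  shows "(\<integral>\<^sup>+t. ennpowr (ennreal (t powr (1/p - 1/q)) * (\<Sum>\<^sup>+j. lev b j * indicator {t. 0 < t \<and> ennreal t < d j} t)) q \<partial>lborel)
    \<le> ennpowr (geosum b 1) q * ennreal (p/q) * (\<Sum>\<^sup>+j. levp b j q * ennpowr (d j) (q/p))"
proof -
  have e: "(1/p - 1/q) * q = q/p - 1" using q by (simp add: field_simps)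
  let ?i = "\<lambda>j t. indicator {t. 0 < t \<and> ennreal t < d j} t :: ennreal"
  have [measurable]: "{t. 0 < t \<and> ennreal t < d j} \<in> sets borel" for j by measurable
  have "(\<integral>\<^sup>+t. ennpowr (ennreal (t powr (1/p - 1/q)) * (\<Sum>\<^sup>+j. lev b j * ?i j t)) q \<partial>lborel)
     \<le> (\<integral>\<^sup>+t. (\<Sum>\<^sup>+j. ennpowr (geosum b 1) q * (levp b j q * (ennreal (t powr (q/p - 1)) * ?i j t))) \<partial>lborel)"
  proof (rule nn_integral_mono)
    fix t
    have "?i j t = indicator {j. 0 < t \<and> ennreal t < d j} j" for j by (simp add: indicator_def)
    then have "ennpowr (\<Sum>\<^sup>+j. lev b j * ?i j t) q
       \<le> ennpowr (geosum b 1) q * (\<Sum>\<^sup>+j. levp b j q * ?i j t)"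
      using sum_levels_powr_le[OF b q, of "{j. 0 < t \<and> ennreal t < d j}"] by simp
    then have "ennpowr (ennreal (t powr (1/p - 1/q)) * (\<Sum>\<^sup>+j. lev b j * ?i j t)) q
       \<le> ennreal (t powr (q/p - 1)) * (ennpowr (geosum b 1) q * (\<Sum>\<^sup>+j. levp b j q * ?i j t))"
      unfolding ennpowr_mult[OF q] ennpowr_ennreal[OF powr_ge_zero] powr_powr e by (rule mult_left_mono) simp
    also have "\<dots> = (ennreal (t powr (q/p - 1)) * ennpowr (geosum b 1) q) * (\<Sum>\<^sup>+j. levp b j q * ?i j t)"
      by (simp only: mult.assoc)
    also have "\<dots> = (\<Sum>\<^sup>+j. (ennreal (t powr (q/p - 1)) * ennpowr (geosum b 1) q) * (levp b j q * ?i j t))"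
      by (rule nn_integral_cmult[symmetric]) simp
    also have "\<dots> = (\<Sum>\<^sup>+j. ennpowr (geosum b 1) q * (levp b j q * (ennreal (t powr (q/p - 1)) * ?i j t)))"
      by (simp only: mult_ac)
    finally show "ennpowr (ennreal (t powr (1/p - 1/q)) * (\<Sum>\<^sup>+j. lev b j * ?i j t)) q
      \<le> (\<Sum>\<^sup>+j. ennpowr (geosum b 1) q * (levp b j q * (ennreal (t powr (q/p - 1)) * ?i j t)))" .
  qed
  also have "\<dots> = (\<Sum>\<^sup>+j. (\<integral>\<^sup>+t. ennpowr (geosum b 1) q * (levp b j q * (ennreal (t powr (q/p - 1)) * ?i j t)) \<partial>lborel))"
    by (rule nn_integral_count_space_nn_integral) auto
  also have "\<dots> \<le> (\<Sum>\<^sup>+j. ennpowr (geosum b 1) q * ennreal (p/q) * (levp b j q * ennpowr (d j) (q/p)))"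
  proof (rule nn_integral_mono)
    fix j
    have "(\<integral>\<^sup>+t. ennpowr (geosum b 1) q * (levp b j q * (ennreal (t powr (q/p - 1)) * ?i j t)) \<partial>lborel)
       = ennpowr (geosum b 1) q * levp b j q * (\<integral>\<^sup>+t. ennreal (t powr (q/p - 1)) * ?i j t \<partial>lborel)"
      unfolding mult.assoc[symmetric, of "ennpowr (geosum b 1) q"] by (rule nn_integral_cmult) measurable
    also have "\<dots> \<le> ennpowr (geosum b 1) q * levp b j q * (ennreal (1/(q/p)) * ennpowr (d j) (q/p))"
      using p q by (intro mult_left_mono nn_integral_powr_below) auto
    also have "\<dots> = ennpowr (geosum b 1) q * ennreal (p/q) * (levp b j q * ennpowr (d j) (q/p))"
      by (simp add: mult_ac)
    finally show "(\<integral>\<^sup>+t. ennpowr (geosum b 1) q * (levp b j q * (ennreal (t powr (q/p - 1)) * ?i j t)) \<partial>lborel)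
       \<le> ennpowr (geosum b 1) q * ennreal (p/q) * (levp b j q * ennpowr (d j) (q/p))" .
  qed
  also have "\<dots> = ennpowr (geosum b 1) q * ennreal (p/q) * (\<Sum>\<^sup>+j. levp b j q * ennpowr (d j) (q/p))"
    by (rule nn_integral_cmult) simp
  finally show ?thesis .
qed

text \<open>Decompose both functions into layers. Two level sets meet in at most the minimum of
  their measures, which \<open>nn_integral_min\<close> turns into an integral over t; there ordinary
  Hoelder with q and q' applies.\<close>

lemma dlor_Hoelder:
  assumes b: "1 < b" and p: "1 < p" "1 < p'" "1/p + 1/p' = 1" and q: "1 < q" "1 < q'" "1/q + 1/q' = (1::real)"
  obtains C where "C < top" "\<And>\<phi> \<psi>. \<phi> \<in> borel_measurable M \<Longrightarrow> \<psi> \<in> borel_measurable M \<Longrightarrow>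
    (\<integral>\<^sup>+x. \<phi> x * \<psi> x \<partial>M) \<le> C * (ennpowr (dlor b p q M \<phi>) (1/q) * ennpowr (dlor b p' q' M \<psi>) (1/q'))"
proof -
  define c1 where "c1 = ennpowr (geosum b 1) q * ennreal (p/q)"
  define c2 where "c2 = ennpowr (geosum b 1) q' * ennreal (p'/q')"
  define C where "C = ennreal b * ennreal b * (2 * (ennpowr c1 (1/q) * ennpowr c2 (1/q')))"
  have "C < top" using b by (simp add: C_def c1_def c2_def ennreal_mult_less_top geosum_less_top)
  moreover have "(\<integral>\<^sup>+x. \<phi> x * \<psi> x \<partial>M) \<le> C * (ennpowr (dlor b p q M \<phi>) (1/q) * ennpowr (dlor b p' q' M \<psi>) (1/q'))"
    if [measurable]: "\<phi> \<in> borel_measurable M" "\<psi> \<in> borel_measurable M" for \<phi> \<psi>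
  proof -
    define e where "e k = emeasure M {x \<in> space M. lev b k < \<psi> x}" for k :: int
    define d where "d j = emeasure M {x \<in> space M. lev b j < \<phi> x}" for j :: int
    let ?F = "\<lambda>j x. indicator {x \<in> space M. lev b j < \<phi> x} x :: ennreal"
    let ?G = "\<lambda>k x. indicator {x \<in> space M. lev b k < \<psi> x} x :: ennreal"
    let ?b = "\<lambda>j. lev b j"
    let ?i = "\<lambda>c t. indicator {t. 0 < t \<and> ennreal t < c} t :: ennreal"
    have [measurable]: "{t. 0 < t \<and> ennreal t < c} \<in> sets borel" for c by measurable
    have le1: "f x \<le> ennreal b * (\<Sum>\<^sup>+j. ?b j * indicator {x \<in> space M. ?b j < f x} x)" if "x \<in> space M" for f x
    proof -
      have "f x \<le> ennreal b * (\<Sum>\<^sup>+j. ?b j * (if ?b j < f x then 1 else 0))"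
        using layer_sum_ge[OF b, of 1 "f x"] b by simp
      also have "(\<lambda>j. ?b j * (if ?b j < f x then 1 else 0)) = (\<lambda>j. ?b j * indicator {x \<in> space M. ?b j < f x} x)"
        using that by (auto simp: indicator_def)
      finally show ?thesis .
    qed
    have "(\<integral>\<^sup>+x. \<phi> x * \<psi> x \<partial>M) \<le> (\<integral>\<^sup>+x. (\<Sum>\<^sup>+j. (\<Sum>\<^sup>+k. ennreal b * ennreal b * (?b j * ?b k * (?F j x * ?G k x)))) \<partial>M)"
    proof (rule nn_integral_mono)
      fix x assume x: "x \<in> space M"
      have "\<phi> x * \<psi> x \<le> (ennreal b * (\<Sum>\<^sup>+j. ?b j * ?F j x)) * (ennreal b * (\<Sum>\<^sup>+k. ?b k * ?G k x))"
        by (intro mult_mono le1 x) auto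
      also have "\<dots> = (\<Sum>\<^sup>+j. ?b j * ?F j x) * (ennreal b * ennreal b * (\<Sum>\<^sup>+k. ?b k * ?G k x))"
        by (simp only: mult_ac)
      also have "\<dots> = (\<Sum>\<^sup>+j. ?b j * ?F j x * (ennreal b * ennreal b * (\<Sum>\<^sup>+k. ?b k * ?G k x)))"
        by (rule nn_integral_multc[symmetric]) simp
      also have "\<dots> = (\<Sum>\<^sup>+j. (\<Sum>\<^sup>+k. ennreal b * ennreal b * (?b j * ?b k * (?F j x * ?G k x))))"
      proof (rule nn_integral_cong)
        fix j
        have "?b j * ?F j x * (ennreal b * ennreal b * (\<Sum>\<^sup>+k. ?b k * ?G k x))
            = (?b j * ?F j x * (ennreal b * ennreal b)) * (\<Sum>\<^sup>+k. ?b k * ?G k x)"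
          by (simp only: mult_ac)
        also have "\<dots> = (\<Sum>\<^sup>+k. (?b j * ?F j x * (ennreal b * ennreal b)) * (?b k * ?G k x))"
          by (rule nn_integral_cmult[symmetric]) simp
        finally show "?b j * ?F j x * (ennreal b * ennreal b * (\<Sum>\<^sup>+k. ?b k * ?G k x))
            = (\<Sum>\<^sup>+k. ennreal b * ennreal b * (?b j * ?b k * (?F j x * ?G k x)))"
          by (simp only: mult_ac)
      qed
      finally show "\<phi> x * \<psi> x \<le> (\<Sum>\<^sup>+j. (\<Sum>\<^sup>+k. ennreal b * ennreal b * (?b j * ?b k * (?F j x * ?G k x))))" .
    qed
    also have "\<dots> = (\<Sum>\<^sup>+j. (\<integral>\<^sup>+x. (\<Sum>\<^sup>+k. ennreal b * ennreal b * (?b j * ?b k * (?F j x * ?G k x))) \<partial>M))"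
      by (rule nn_integral_count_space_nn_integral) (auto intro!: borel_measurable_nn_integral_count_space)
    also have "\<dots> = (\<Sum>\<^sup>+j. (\<Sum>\<^sup>+k. (\<integral>\<^sup>+x. ennreal b * ennreal b * (?b j * ?b k * (?F j x * ?G k x)) \<partial>M)))"
      by (intro nn_integral_cong nn_integral_count_space_nn_integral) auto
    also have "\<dots> \<le> (\<Sum>\<^sup>+j. (\<Sum>\<^sup>+k. ennreal b * ennreal b * (?b j * ?b k * min (d j) (e k))))"
    proof (intro nn_integral_mono)
      fix j k :: int
      have "(\<integral>\<^sup>+x. ennreal b * ennreal b * (?b j * ?b k * (?F j x * ?G k x)) \<partial>M) = ennreal b * ennreal b * (?b j * ?b k) * (\<integral>\<^sup>+x. ?F j x * ?G k x \<partial>M)"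
        unfolding mult.assoc[symmetric] by (simp add: nn_integral_cmult mult.assoc)
      also have "(\<integral>\<^sup>+x. ?F j x * ?G k x \<partial>M) \<le> min (d j) (e k)"
      proof -
        have "(\<integral>\<^sup>+x. ?F j x * ?G k x \<partial>M) \<le> (\<integral>\<^sup>+x. ?F j x \<partial>M)" by (intro nn_integral_mono) (auto simp: indicator_def)
        moreover have "(\<integral>\<^sup>+x. ?F j x * ?G k x \<partial>M) \<le> (\<integral>\<^sup>+x. ?G k x \<partial>M)" by (intro nn_integral_mono) (auto simp: indicator_def)
        ultimately show ?thesis by (simp add: d_def e_def)
      qed
      finally show "(\<integral>\<^sup>+x. ennreal b * ennreal b * (?b j * ?b k * (?F j x * ?G k x)) \<partial>M) \<le> ennreal b * ennreal b * (?b j * ?b k * min (d j) (e k))"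
        by (simp only: mult.assoc mult_left_mono zero_le)
    qed
    also have "\<dots> = (\<Sum>\<^sup>+j. (\<Sum>\<^sup>+k. (\<integral>\<^sup>+t. ennreal b * ennreal b * (?b j * ?b k * (?i (d j) t * ?i (e k) t)) \<partial>lborel)))"
      unfolding nn_integral_min by (intro nn_integral_cong) (simp add: nn_integral_cmult)
    also have "\<dots> = (\<Sum>\<^sup>+j. (\<integral>\<^sup>+t. (\<Sum>\<^sup>+k. ennreal b * ennreal b * (?b j * ?b k * (?i (d j) t * ?i (e k) t))) \<partial>lborel))"
      by (intro nn_integral_cong nn_integral_count_space_nn_integral[symmetric]) auto
    also have "\<dots> = (\<integral>\<^sup>+t. (\<Sum>\<^sup>+j. (\<Sum>\<^sup>+k. ennreal b * ennreal b * (?b j * ?b k * (?i (d j) t * ?i (e k) t)))) \<partial>lborel)"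
      by (rule nn_integral_count_space_nn_integral[symmetric]) (auto intro!: borel_measurable_nn_integral_count_space)
    \<comment> \<open>The two powers of t have product 1, because 1/p + 1/p' = 1/q + 1/q'. They turn
      each factor into the integrand of \<open>sum_levels_integral_le\<close>.\<close>
    also have "\<dots> = (\<integral>\<^sup>+t. ennreal b * ennreal b * ((ennreal (t powr (1/p - 1/q)) * (\<Sum>\<^sup>+j. ?b j * ?i (d j) t)) * (ennreal (t powr (1/p' - 1/q')) * (\<Sum>\<^sup>+k. ?b k * ?i (e k) t))) \<partial>lborel)"
    proof (rule nn_integral_cong)
      fix t :: real
      have A: "(\<Sum>\<^sup>+j. (\<Sum>\<^sup>+k. ennreal b * ennreal b * (?b j * ?b k * (?i (d j) t * ?i (e k) t))))
         = ennreal b * ennreal b * ((\<Sum>\<^sup>+j. ?b j * ?i (d j) t) * (\<Sum>\<^sup>+k. ?b k * ?i (e k) t))"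
      proof -
        have "(\<Sum>\<^sup>+k. ennreal b * ennreal b * (?b j * ?b k * (?i (d j) t * ?i (e k) t)))
            = ?b j * ?i (d j) t * (ennreal b * ennreal b * (\<Sum>\<^sup>+k. ?b k * ?i (e k) t))" for j
        proof -
          have "(\<Sum>\<^sup>+k. ennreal b * ennreal b * (?b j * ?b k * (?i (d j) t * ?i (e k) t)))
             = (\<Sum>\<^sup>+k. (?b j * ?i (d j) t * (ennreal b * ennreal b)) * (?b k * ?i (e k) t))"
            by (simp only: mult_ac)
          also have "\<dots> = (?b j * ?i (d j) t * (ennreal b * ennreal b)) * (\<Sum>\<^sup>+k. ?b k * ?i (e k) t)"
            by (rule nn_integral_cmult) simp
          finally show ?thesis by (simp only: mult.assoc)
        qed
        then have "(\<Sum>\<^sup>+j. (\<Sum>\<^sup>+k. ennreal b * ennreal b * (?b j * ?b k * (?i (d j) t * ?i (e k) t))))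
           = (\<Sum>\<^sup>+j. ?b j * ?i (d j) t * (ennreal b * ennreal b * (\<Sum>\<^sup>+k. ?b k * ?i (e k) t)))"
          by simp
        also have "\<dots> = (\<Sum>\<^sup>+j. ?b j * ?i (d j) t) * (ennreal b * ennreal b * (\<Sum>\<^sup>+k. ?b k * ?i (e k) t))"
          by (rule nn_integral_multc) simp
        finally show ?thesis by (simp only: mult_ac)
      qed
      show "(\<Sum>\<^sup>+j. (\<Sum>\<^sup>+k. ennreal b * ennreal b * (?b j * ?b k * (?i (d j) t * ?i (e k) t))))
        = ennreal b * ennreal b * ((ennreal (t powr (1/p - 1/q)) * (\<Sum>\<^sup>+j. ?b j * ?i (d j) t)) * (ennreal (t powr (1/p' - 1/q')) * (\<Sum>\<^sup>+k. ?b k * ?i (e k) t)))"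
      proof (cases "0 < t")
        case True
        have "(1/p - 1/q) + (1/p' - 1/q') = 0" using p q by simp
        then have "ennreal (t powr (1/p - 1/q)) * ennreal (t powr (1/p' - 1/q')) = 1"
          unfolding ennreal_powr_add[symmetric] using True by simp
        then have "(ennreal (t powr (1/p - 1/q)) * x) * (ennreal (t powr (1/p' - 1/q')) * y) = x * y" for x y
          by (metis mult.assoc mult.commute mult_1)
        then show ?thesis unfolding A by simp
      qed simp
    qed
    also have "\<dots> = ennreal b * ennreal b * (\<integral>\<^sup>+t. (ennreal (t powr (1/p - 1/q)) * (\<Sum>\<^sup>+j. ?b j * ?i (d j) t)) * (ennreal (t powr (1/p' - 1/q')) * (\<Sum>\<^sup>+k. ?b k * ?i (e k) t)) \<partial>lborel)"
    proof (rule nn_integral_cmult)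
      have m: "(\<lambda>t. \<integral>\<^sup>+j. ?b j * ?i (c j) t \<partial>count_space UNIV) \<in> borel_measurable lborel" for c :: "int \<Rightarrow> ennreal"
        by (rule borel_measurable_nn_integral_count_space) measurable
      note m[of d, measurable] m[of e, measurable]
      show "(\<lambda>t. (ennreal (t powr (1/p - 1/q)) * (\<Sum>\<^sup>+j. ?b j * ?i (d j) t)) * (ennreal (t powr (1/p' - 1/q')) * (\<Sum>\<^sup>+k. ?b k * ?i (e k) t))) \<in> borel_measurable lborel"
        by measurable
    qed
    also have "\<dots> \<le> ennreal b * ennreal b * (2 * (ennpowr (\<integral>\<^sup>+t. ennpowr (ennreal (t powr (1/p - 1/q)) * (\<Sum>\<^sup>+j. ?b j * ?i (d j) t)) q \<partial>lborel) (1/q)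
        * ennpowr (\<integral>\<^sup>+t. ennpowr (ennreal (t powr (1/p' - 1/q')) * (\<Sum>\<^sup>+k. ?b k * ?i (e k) t)) q' \<partial>lborel) (1/q')))"
    proof (intro mult_left_mono Hoelder_ennreal q)
      have m: "(\<lambda>t. \<integral>\<^sup>+j. ?b j * ?i (c j) t \<partial>count_space UNIV) \<in> borel_measurable lborel" for c :: "int \<Rightarrow> ennreal"
        by (rule borel_measurable_nn_integral_count_space) measurable
      note m[of d, measurable] m[of e, measurable]
      show "(\<lambda>t. ennreal (t powr (1/p - 1/q)) * (\<Sum>\<^sup>+j. ?b j * ?i (d j) t)) \<in> borel_measurable lborel"
        "(\<lambda>t. ennreal (t powr (1/p' - 1/q')) * (\<Sum>\<^sup>+k. ?b k * ?i (e k) t)) \<in> borel_measurable lborel"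
        by measurable
    qed simp
    also have "\<dots> \<le> ennreal b * ennreal b * (2 * (ennpowr (c1 * dlor b p q M \<phi>) (1/q) * ennpowr (c2 * dlor b p' q' M \<psi>) (1/q')))"
      unfolding c1_def c2_def dlor_def d_def[symmetric] e_def[symmetric]
      using b p q by (intro mult_left_mono mult_mono ennpowr_mono sum_levels_integral_le) auto
    also have "\<dots> = C * (ennpowr (dlor b p q M \<phi>) (1/q) * ennpowr (dlor b p' q' M \<psi>) (1/q'))"
    proof -
      have "0 < 1/q" "0 < 1/q'" using q by auto
      then show ?thesis unfolding C_def by (simp only: ennpowr_mult mult_ac)
    qed
    finally show ?thesis .
  qed
  ultimately show thesis by (rule that)
qed

text \<open>The extremal function for the duality: on nested level sets \<open>H k\<close> of \<open>\<psi>\<close> it is the maximum of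
  \<open>a\<^sub>k 1\<^bsub>H k\<^esub>\<close>, where \<open>a\<^sub>k (M (H k))\<^bsup>1/p\<^esup>\<close> is extremal for \<open>\<ell>\<^sup>q\<close>-\<open>\<ell>\<^bsup>q'\<^esup>\<close> duality against \<open>b\<^sup>k (M (H k))\<^bsup>1/p'\<^esup>\<close>.\<close>

lemma dual_test_function:
  fixes H :: "int \<Rightarrow> 'a set" and \<psi> :: "'a \<Rightarrow> ennreal"
  assumes b: "1 < b" and p: "1 < p" "1 < p'" "1/p + 1/p' = 1" and q: "1 < q" "1 < q'" "1/q + 1/q' = (1::real)"
    and \<psi>[measurable]: "\<psi> \<in> borel_measurable M" and H[measurable]: "\<And>k. H k \<in> sets M"
    and fin: "\<And>k. emeasure M (H k) < top"
    and K: "finite K" "K \<noteq> {}" and nested: "\<And>j k. j \<in> K \<Longrightarrow> k \<in> K \<Longrightarrow> j \<le> k \<Longrightarrow> H k \<subseteq> H j"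
    and level: "\<And>k x. x \<in> H k \<Longrightarrow> lev b k < \<psi> x"
  defines "S \<equiv> \<Sum>k\<in>K. levp b k q' * ennpowr (emeasure M (H k)) (q'/p')"
  obtains \<phi> :: "'a \<Rightarrow> real" where "\<phi> \<in> borel_measurable M" "\<And>x. 0 \<le> \<phi> x"
    "dlor b p q M (\<lambda>x. ennreal (\<phi> x)) \<le> geosum b q * S"
    "S \<le> geosum b 1 * (\<integral>\<^sup>+x. ennreal (\<phi> x) * \<psi> x \<partial>M)"
proof -
  have qq: "q * q' = q + q'" using q by (simp add: field_simps)
  have pp: "1 - 1/p = 1/p'" using p(3) by linarith
  define e where "e k = enn2real (emeasure M (H k))" for k
  have e: "emeasure M (H k) = ennreal (e k)" "0 \<le> e k" for k
    using fin[of k] by (auto simp: e_def)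
  \<comment> \<open>For positive e_k the exponents solve a_k^q e_k^(q/p) = b^k a_k e_k = b^(k q')
    e_k^(q'/p'). Thus the k-th term of S occurs both in the norm of \<phi> and in its pairing with
    \<psi>. Null sets get coefficient 0.\<close>
  define a where "a k = (if e k = 0 then 0 else b powr (real_of_int k * (q' - 1)) * e k powr (q'/p' - 1))" for k
  have a0: "0 \<le> a k" for k by (simp add: a_def)
  define \<phi> where "\<phi> x = Max ((\<lambda>k. a k * indicator (H k) x) ` K)" for x
  have [measurable]: "\<phi> \<in> borel_measurable M"
    unfolding \<phi>_def using K by (intro borel_measurable_Max) auto
  have ge: "a k * indicator (H k) x \<le> \<phi> x" if "k \<in> K" for k x
    unfolding \<phi>_def using K that by (intro Max_ge) auto
  have \<phi>0: "0 \<le> \<phi> x" for x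
  proof -
    obtain k where "k \<in> K" using K by blast
    have "0 \<le> a k * indicator (H k) x" using a0 by simp
    also have "\<dots> \<le> \<phi> x" by (rule ge) fact
    finally show ?thesis .
  qed
  have lev: "b powr real_of_int j < \<phi> x \<longleftrightarrow> (\<exists>k\<in>K. b powr real_of_int j < a k \<and> x \<in> H k)" for j x
  proof -
    have "b powr real_of_int j < \<phi> x \<longleftrightarrow> (\<exists>k\<in>K. b powr real_of_int j < a k * indicator (H k) x)"
      unfolding \<phi>_def using K by (subst Max_gr_iff) auto
    also have "\<dots> \<longleftrightarrow> (\<exists>k\<in>K. b powr real_of_int j < a k \<and> x \<in> H k)"
      using powr_ge_zero[of b "real_of_int j"] by (intro bex_cong refl) (auto simp: indicator_def not_less)
    finally show ?thesis .
  qed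
  have ak: "ennpowr (ennreal (a k)) q * ennpowr (emeasure M (H k)) (q/p) = levp b k q' * ennpowr (emeasure M (H k)) (q'/p')" for k
  proof (cases "e k = 0")
    case True
    then show ?thesis by (simp add: e a_def)
  next
    case False
    then have pos: "0 < e k" using e(2)[of k] by simp
    have "q'/p' - 1 + 1/p = q'/p' - 1/p'" using pp by linarith
    then have "q * (q'/p' - 1 + 1/p) = q * (q'/p' - 1/p')" by (simp only:)
    also have "\<dots> = (q * q' - q) / p'" by (simp add: algebra_simps diff_divide_distrib)
    also have "\<dots> = q'/p'" using qq by simp
    finally have 1: "(q'/p' - 1) * q + q/p = q'/p'" by (simp add: algebra_simps)
    have 2: "real_of_int k * (q' - 1) * q = real_of_int k * q'" proof -
      have "(q' - 1) * q = q'" using qq by (simp add: algebra_simps)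
      then show ?thesis by (simp only: mult.assoc)
    qed
    have "(b powr (real_of_int k * (q' - 1)) * e k powr (q'/p' - 1)) powr q * e k powr (q/p) = b powr (real_of_int k * (q' - 1) * q) * (e k powr ((q'/p' - 1) * q) * e k powr (q/p))"
      using b pos by (simp add: powr_mult powr_powr)
    also have "\<dots> = b powr (real_of_int k * q') * e k powr (q'/p')"
      unfolding powr_add[symmetric] 1 2 ..
    finally show ?thesis
      using False pos by (simp add: e a_def ennpowr_ennreal flip: ennreal_mult)
  qed
  have ak1: "lev b k * (ennreal (a k) * emeasure M (H k)) = levp b k q' * ennpowr (emeasure M (H k)) (q'/p')" for k
  proof (cases "e k = 0")
    case True
    then show ?thesis by (simp add: e)
  next
    case False
    then have pos: "0 < e k" using e(2)[of k] by simp
    have 1: "real_of_int k + real_of_int k * (q' - 1) = real_of_int k * q'" by (simp add: algebra_simps)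
    have "b powr real_of_int k * (b powr (real_of_int k * (q' - 1)) * e k powr (q'/p' - 1) * e k)
       = b powr (real_of_int k + real_of_int k * (q' - 1)) * (e k powr (q'/p' - 1) * e k powr 1)"
      using pos by (simp add: powr_add)
    also have "\<dots> = b powr (real_of_int k * q') * e k powr (q'/p')"
      unfolding powr_add[symmetric] 1 by simp
    finally show ?thesis
      using False pos by (simp add: e a_def ennpowr_ennreal flip: ennreal_mult)
  qed
  have "dlor b p q M (\<lambda>x. ennreal (\<phi> x)) \<le> (\<Sum>\<^sup>+j. (\<Sum>k\<in>K. ennpowr (emeasure M (H k)) (q/p) * (levp b j q * (if lev b j < ennreal (a k) then 1 else 0))))"
    unfolding dlor_def
  proof (rule nn_integral_mono)
    fix j :: int
    define Kj where "Kj = {k \<in> K. b powr real_of_int j < a k}"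
    have set: "{x \<in> space M. lev b j < ennreal (\<phi> x)} = (\<Union>k\<in>Kj. H k)"
      using sets.sets_into_space[OF H] by (auto simp: ennreal_less_iff lev Kj_def)
    have "ennpowr (emeasure M (\<Union>k\<in>Kj. H k)) (q/p) \<le> (\<Sum>k\<in>K. ennpowr (emeasure M (H k)) (q/p) * (if lev b j < ennreal (a k) then 1 else 0))"
    proof (cases "Kj = {}")
      case False
      have fK: "finite Kj" using K by (simp add: Kj_def)
      \<comment> \<open>By nesting, the union is the set with the smallest index; this one term is
        dominated by the sum, so no constant depending on K appears.\<close>
      define k0 where "k0 = Min Kj"
      have k0: "k0 \<in> Kj" unfolding k0_def using fK False by (rule Min_in)
      have "(\<Union>k\<in>Kj. H k) \<subseteq> H k0"
      proof (rule UN_least)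
        fix k assume k: "k \<in> Kj"
        have "k0 \<le> k" unfolding k0_def using fK k by (rule Min_le)
        then show "H k \<subseteq> H k0" using nested k k0 by (auto simp: Kj_def)
      qed
      then have "emeasure M (\<Union>k\<in>Kj. H k) \<le> emeasure M (H k0)" by (rule emeasure_mono) measurable
      then have "ennpowr (emeasure M (\<Union>k\<in>Kj. H k)) (q/p) \<le> ennpowr (emeasure M (H k0)) (q/p)"
        using p q by (intro ennpowr_mono) auto
      also have "\<dots> = ennpowr (emeasure M (H k0)) (q/p) * (if lev b j < ennreal (a k0) then 1 else 0)"
        using k0 by (simp add: Kj_def ennreal_less_iff)
      also have "\<dots> \<le> (\<Sum>k\<in>K. ennpowr (emeasure M (H k)) (q/p) * (if lev b j < ennreal (a k) then 1 else 0))"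
        using k0 K by (intro member_le_sum) (auto simp: Kj_def)
      finally show ?thesis .
    qed simp
    then have "levp b j q * ennpowr (emeasure M (\<Union>k\<in>Kj. H k)) (q/p)
       \<le> levp b j q * (\<Sum>k\<in>K. ennpowr (emeasure M (H k)) (q/p) * (if lev b j < ennreal (a k) then 1 else 0))"
      by (rule mult_left_mono) simp
    then show "levp b j q * ennpowr (emeasure M {x \<in> space M. lev b j < ennreal (\<phi> x)}) (q/p)
      \<le> (\<Sum>k\<in>K. ennpowr (emeasure M (H k)) (q/p) * (levp b j q * (if lev b j < ennreal (a k) then 1 else 0)))"
      unfolding set sum_distrib_left by (simp only: mult.left_commute)
  qed
  also have "\<dots> = (\<Sum>k\<in>K. ennpowr (emeasure M (H k)) (q/p) * (\<Sum>\<^sup>+j. levp b j q * (if lev b j < ennreal (a k) then 1 else 0)))"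
    by (subst nn_integral_sum) (simp_all add: nn_integral_cmult)
  also have "\<dots> \<le> (\<Sum>k\<in>K. ennpowr (emeasure M (H k)) (q/p) * (geosum b q * ennpowr (ennreal (a k)) q))"
    using b q by (intro sum_mono mult_left_mono layer_sum_le) auto
  also have "\<dots> = geosum b q * S"
    unfolding S_def sum_distrib_left ak[symmetric] by (simp only: mult_ac)
  finally have d: "dlor b p q M (\<lambda>x. ennreal (\<phi> x)) \<le> geosum b q * S" .
  have "S = (\<Sum>k\<in>K. lev b k * (\<integral>\<^sup>+x. ennreal (a k) * indicator (H k) x \<partial>M))"
    unfolding S_def ak1[symmetric] by (intro sum.cong refl) (simp add: nn_integral_cmult_indicator)
  also have "\<dots> = (\<integral>\<^sup>+x. (\<Sum>k\<in>K. lev b k * (ennreal (a k) * indicator (H k) x)) \<partial>M)"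
    by (subst nn_integral_sum) (simp_all add: nn_integral_cmult)
  also have "\<dots> \<le> (\<integral>\<^sup>+x. geosum b 1 * (ennreal (\<phi> x) * \<psi> x) \<partial>M)"
  proof (rule nn_integral_mono)
    fix x
    have "(\<Sum>k\<in>K. lev b k * (ennreal (a k) * indicator (H k) x))
       \<le> (\<Sum>k\<in>K. ennreal (\<phi> x) * (ennreal (b powr (real_of_int k * 1)) * (if lev b k < \<psi> x then 1 else 0)))"
    proof (rule sum_mono)
      fix k assume k: "k \<in> K"
      show "lev b k * (ennreal (a k) * indicator (H k) x)
        \<le> ennreal (\<phi> x) * (ennreal (b powr (real_of_int k * 1)) * (if lev b k < \<psi> x then 1 else 0))"
        using ge[OF k, of x] level[of x k] by (cases "x \<in> H k") (auto simp: mult.commute intro!: mult_left_mono mult_right_mono ennreal_leI)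
    qed
    also have "\<dots> = ennreal (\<phi> x) * (\<Sum>k\<in>K. ennreal (b powr (real_of_int k * 1)) * (if lev b k < \<psi> x then 1 else 0))"
      by (simp only: sum_distrib_left)
    also have "(\<Sum>k\<in>K. ennreal (b powr (real_of_int k * 1)) * (if lev b k < \<psi> x then 1 else 0))
       = (\<integral>\<^sup>+k. ennreal (b powr (real_of_int k * 1)) * (if lev b k < \<psi> x then 1 else 0) \<partial>count_space K)"
      using K by (simp add: nn_integral_count_space_finite)
    also have "\<dots> \<le> (\<Sum>\<^sup>+k. ennreal (b powr (real_of_int k * 1)) * (if lev b k < \<psi> x then 1 else 0))"
      by (subst nn_integral_count_space_indicator) (auto intro!: nn_integral_mono simp: indicator_def)
    also have "\<dots> \<le> geosum b 1 * ennpowr (\<psi> x) 1"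
      using b by (intro layer_sum_le) auto
    finally show "(\<Sum>k\<in>K. lev b k * (ennreal (a k) * indicator (H k) x)) \<le> geosum b 1 * (ennreal (\<phi> x) * \<psi> x)"
      by (simp add: mult_left_mono mult.left_commute)
  qed
  also have "\<dots> = geosum b 1 * (\<integral>\<^sup>+x. ennreal (\<phi> x) * \<psi> x \<partial>M)"
    by (rule nn_integral_cmult) measurable
  finally have s: "S \<le> geosum b 1 * (\<integral>\<^sup>+x. ennreal (\<phi> x) * \<psi> x \<partial>M)" .
  show thesis by (rule that[OF _ \<phi>0 d s]) measurable
qed

section \<open>Suprema of sequences and finiteness almost everywhere\<close>

text \<open>Stands in for summing a series in a quasi-norm. Level sets of the supremum are unions of
  those of the \<open>\<phi> n\<close> at the heights b^(k+n). Shifting k gains b^(-n q), half of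
  which pays for exchanging the sum over n with the power q/p.\<close>

lemma dlor_SUP_less_top:
  assumes b: "1 < b" and p: "0 < p" and q: "0 < q"
    and meas[measurable]: "\<And>n. \<phi> n \<in> borel_measurable M"
    and le: "\<And>n. dlor b p q M (\<phi> n) \<le> D" and D: "D < top"
  shows "dlor b p q M (\<lambda>x. SUP n::nat. ennreal (b powr (- real n)) * \<phi> n x) < top"
proof -
  define \<beta> where "\<beta> = q/p"
  have \<beta>: "0 < \<beta>" using p q by (simp add: \<beta>_def)
  define d where "d n k = emeasure M {x \<in> space M. lev b k < \<phi> n x}" for n k
  define s where "s n = ennreal (b powr (- (p/2) * real n))" for n :: nat
  have geo: "(\<Sum>\<^sup>+(n::nat). ennreal (b powr (- \<epsilon> * real n))) \<le> geosum b \<epsilon>" for \<epsilon>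
  proof -
    have "(\<Sum>\<^sup>+n. ennreal (b powr (- \<epsilon> * real n))) = (\<integral>\<^sup>+k. ennreal (b powr (- \<epsilon> * \<bar>real_of_int k\<bar>)) \<partial>count_space (range int))"
      by (subst nn_integral_bij_count_space[symmetric, where g=int and A=UNIV]) (auto simp: bij_betw_def)
    also have "\<dots> \<le> geosum b \<epsilon>"
      unfolding geosum_def by (subst nn_integral_count_space_indicator) (auto intro!: nn_integral_mono simp: indicator_def)
    finally show ?thesis .
  qed
  have lev: "lev b k < ennreal (b powr (- real n)) * y \<longleftrightarrow> ennreal (b powr real_of_int (k + int n)) < y" for k n y
  proof -
    have 1: "lev b k = ennreal (b powr (- real n)) * ennreal (b powr real_of_int (k + int n))"
      unfolding ennreal_powr_add[symmetric] by simp
    have "ennreal (b powr (- real n)) * y \<le> ennreal (b powr (- real n)) * ennreal (b powr real_of_int (k + int n)) \<longleftrightarrow> y \<le> ennreal (b powr real_of_int (k + int n))"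
      using b by (intro ennreal_mult_le_mult_iff) (auto simp: ennreal_eq_0_iff not_le)
    then show ?thesis unfolding 1 by (simp flip: not_le)
  qed
  have bound: "emeasure M {x \<in> space M. lev b k < (SUP n. ennreal (b powr (- real n)) * \<phi> n x)}
      \<le> (\<Sum>\<^sup>+n. d n (k + int n))" for k
  proof -
    have "{x \<in> space M. lev b k < (SUP n. ennreal (b powr (- real n)) * \<phi> n x)}
       = (\<Union>n. {x \<in> space M. ennreal (b powr real_of_int (k + int n)) < \<phi> n x})"
      unfolding less_SUP_iff lev by auto
    also have "emeasure M \<dots> \<le> (\<Sum>n. d n (k + int n))"
      unfolding d_def by (rule emeasure_subadditive_countably) auto
    finally show ?thesis by (simp add: nn_integral_count_space_nat)
  qed
  have "dlor b p q M (\<lambda>x. SUP n. ennreal (b powr (- real n)) * \<phi> n x)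
      \<le> (\<Sum>\<^sup>+k. levp b k q * (ennpowr (geosum b (p/2)) \<beta> * (\<Sum>\<^sup>+n. ennreal (b powr (q/2 * real n)) * ennpowr (d n (k + int n)) \<beta>)))"
    unfolding dlor_def \<beta>_def[symmetric]
  proof (intro nn_integral_mono mult_left_mono)
    fix k
    let ?t = "\<lambda>n::nat. ennreal (b powr (p/2 * real n))"
    have st: "s n * ?t n = 1" for n
      using b unfolding s_def ennreal_powr_add[symmetric] by simp
    have "ennpowr (emeasure M {x \<in> space M. lev b k < (SUP n. ennreal (b powr (- real n)) * \<phi> n x)}) \<beta>
       \<le> ennpowr (\<Sum>\<^sup>+n. s n * ?t n * d n (k + int n)) \<beta>"
      unfolding st mult_1 using \<beta> by (intro ennpowr_mono bound) simp
    also have "\<dots> \<le> ennpowr (\<Sum>\<^sup>+n. s n) \<beta> * (\<Sum>\<^sup>+n. ennpowr (?t n * d n (k + int n)) \<beta>)"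
      by (rule ennpowr_sum_le[OF \<beta>])
    also have "\<dots> \<le> ennpowr (geosum b (p/2)) \<beta> * (\<Sum>\<^sup>+n. ennpowr (?t n * d n (k + int n)) \<beta>)"
      unfolding s_def using \<beta> by (intro mult_right_mono ennpowr_mono geo) auto
    also have "(\<lambda>n. ennpowr (?t n * d n (k + int n)) \<beta>) = (\<lambda>n. ennreal (b powr (q/2 * real n)) * ennpowr (d n (k + int n)) \<beta>)"
    proof -
      have "p/2 * real n * \<beta> = q/2 * real n" for n using p by (simp add: \<beta>_def)
      then show ?thesis unfolding ennpowr_mult[OF \<beta>] ennpowr_ennreal[OF powr_ge_zero] powr_powr by (simp only:)
    qed
    finally show "ennpowr (emeasure M {x \<in> space M. lev b k < (SUP n. ennreal (b powr (- real n)) * \<phi> n x)}) \<beta>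
       \<le> ennpowr (geosum b (p/2)) \<beta> * (\<Sum>\<^sup>+n. ennreal (b powr (q/2 * real n)) * ennpowr (d n (k + int n)) \<beta>)" .
  qed simp
  also have "\<dots> = (\<Sum>\<^sup>+k. ennpowr (geosum b (p/2)) \<beta> * (\<Sum>\<^sup>+n. ennreal (b powr (- (q/2) * real n)) * (levp b (k + int n) q * ennpowr (d n (k + int n)) \<beta>)))"
  proof (rule nn_integral_cong)
    fix k :: int
    have "levp b k q * (\<Sum>\<^sup>+n. ennreal (b powr (q/2 * real n)) * ennpowr (d n (k + int n)) \<beta>)
      = (\<Sum>\<^sup>+n. levp b k q * (ennreal (b powr (q/2 * real n)) * ennpowr (d n (k + int n)) \<beta>))"
      by (rule nn_integral_cmult[symmetric]) simp
    also have "\<dots> = (\<Sum>\<^sup>+n. ennreal (b powr (- (q/2) * real n)) * (levp b (k + int n) q * ennpowr (d n (k + int n)) \<beta>))"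
    proof (rule nn_integral_cong)
      fix n
      have "real_of_int k * q + q/2 * real n = - (q/2) * real n + real_of_int (k + int n) * q" by (simp add: algebra_simps)
      then show "levp b k q * (ennreal (b powr (q/2 * real n)) * ennpowr (d n (k + int n)) \<beta>)
        = ennreal (b powr (- (q/2) * real n)) * (levp b (k + int n) q * ennpowr (d n (k + int n)) \<beta>)"
        unfolding mult.assoc[symmetric] ennreal_powr_add[symmetric] by (simp only:)
    qed
    finally show "levp b k q * (ennpowr (geosum b (p/2)) \<beta> * (\<Sum>\<^sup>+n. ennreal (b powr (q/2 * real n)) * ennpowr (d n (k + int n)) \<beta>))
      = ennpowr (geosum b (p/2)) \<beta> * (\<Sum>\<^sup>+n. ennreal (b powr (- (q/2) * real n)) * (levp b (k + int n) q * ennpowr (d n (k + int n)) \<beta>))"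
      by (simp only: mult.left_commute[of "levp b k q" "ennpowr (geosum b (p/2)) \<beta>"])
  qed
  also have "\<dots> = ennpowr (geosum b (p/2)) \<beta> * (\<Sum>\<^sup>+k. (\<Sum>\<^sup>+n. ennreal (b powr (- (q/2) * real n)) * (levp b (k + int n) q * ennpowr (d n (k + int n)) \<beta>)))"
    by (rule nn_integral_cmult) simp
  also have "(\<Sum>\<^sup>+k. (\<Sum>\<^sup>+n. ennreal (b powr (- (q/2) * real n)) * (levp b (k + int n) q * ennpowr (d n (k + int n)) \<beta>)))
     = (\<integral>\<^sup>+n. (\<integral>\<^sup>+k. ennreal (b powr (- (q/2) * real n)) * (levp b (k + int n) q * ennpowr (d n (k + int n)) \<beta>) \<partial>count_space (UNIV :: int set)) \<partial>count_space (UNIV :: nat set))"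
    by (rule nn_integral_count_space_nn_integral) auto
  also have "\<dots> = (\<Sum>\<^sup>+n. ennreal (b powr (- (q/2) * real n)) * dlor b p q M (\<phi> n))"
  proof (rule nn_integral_cong)
    fix n :: nat
    have "(\<Sum>\<^sup>+k. levp b (k + int n) q * ennpowr (d n (k + int n)) \<beta>) = dlor b p q M (\<phi> n)"
      using nn_integral_int_shift[where n="int n" and f="\<lambda>k. levp b k q * ennpowr (d n k) \<beta>"]
      by (simp only: dlor_def d_def \<beta>_def)
    then show "(\<Sum>\<^sup>+k. ennreal (b powr (- (q/2) * real n)) * (levp b (k + int n) q * ennpowr (d n (k + int n)) \<beta>))
       = ennreal (b powr (- (q/2) * real n)) * dlor b p q M (\<phi> n)"
      by (subst nn_integral_cmult) simp_all
  qed
  also have "\<dots> \<le> (\<Sum>\<^sup>+n. ennreal (b powr (- (q/2) * real n)) * D)"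
    by (intro nn_integral_mono mult_left_mono le) simp
  also have "\<dots> = (\<Sum>\<^sup>+(n::nat). ennreal (b powr (- (q/2) * real n))) * D"
    by (rule nn_integral_multc) simp
  also have "\<dots> \<le> geosum b (q/2) * D" by (intro mult_right_mono geo) simp
  finally have "dlor b p q M (\<lambda>x. SUP n. ennreal (b powr (- real n)) * \<phi> n x) \<le> ennpowr (geosum b (p/2)) \<beta> * (geosum b (q/2) * D)"
    by (simp add: mult_left_mono)
  also have "\<dots> < top" using b p q D by (simp add: ennreal_mult_less_top geosum_less_top)
  finally show ?thesis .
qed

text \<open>The set where \<phi> = \<infinity> lies in every level set, so b^(k q) times a power of
  its measure stays below the finite functional for all k.\<close>

lemma dlor_finite_AE:
  assumes b: "1 < b" and p: "0 < p" and q: "0 < q" and [measurable]: "\<phi> \<in> borel_measurable M"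
    and fin: "dlor b p q M \<phi> < top"
  shows "AE x in M. \<phi> x < top"
proof -
  let ?T = "{x \<in> space M. \<phi> x = top}"
  have T[measurable]: "?T \<in> sets M" by measurable
  have le: "levp b k q * ennpowr (emeasure M ?T) (q/p) \<le> dlor b p q M \<phi>" for k
  proof -
    have "levp b k q * ennpowr (emeasure M ?T) (q/p) \<le> levp b k q * ennpowr (emeasure M {x \<in> space M. lev b k < \<phi> x}) (q/p)"
      using p q by (intro mult_left_mono ennpowr_mono emeasure_mono) auto
    also have "\<dots> \<le> dlor b p q M \<phi>" unfolding dlor_def by (rule nn_integral_ge_point) simp
    finally show ?thesis .
  qed
  have "emeasure M ?T = 0"
  proof (rule ccontr)
    assume nz: "emeasure M ?T \<noteq> 0"
    obtain D where D: "dlor b p q M \<phi> = ennreal D" "0 \<le> D" using fin by (cases "dlor b p q M \<phi>") auto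
    let ?e = "ennpowr (emeasure M ?T) (q/p)"
    have "?e \<le> dlor b p q M \<phi>" using le[of 0] b by simp
    then have "?e < top" using fin by (rule le_less_trans)
    then obtain e where e': "?e = ennreal e" "0 \<le> e" by (metis ennreal_cases order_less_irrefl)
    have "?e \<noteq> 0" using nz by simp
    with e' have e: "?e = ennreal e" "0 < e" by (auto simp: le_less simp del: ennpowr_eq_0_iff)
    obtain k where k: "log b (D / e + 1) / q \<le> real_of_int k" using ex_le_of_int by blast
    then have "log b (D / e + 1) \<le> real_of_int k * q" using q by (simp add: divide_le_eq)
    then have "D / e + 1 \<le> b powr (real_of_int k * q)" using b D e by (subst le_powr_iff) (auto intro: add_nonneg_pos)
    then have "D / e < b powr (real_of_int k * q)" by linarith
    then have "D < b powr (real_of_int k * q) * e" using e(2) by (simp add: pos_divide_less_eq)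
    moreover have "b powr (real_of_int k * q) * e \<le> D"
      using le[of k] D e by (simp flip: ennreal_mult)
    ultimately show False by simp
  qed
  then have "?T \<in> null_sets M" using T by blast
  then show ?thesis
    by (rule AE_I'[of ?T]) (auto simp: not_less top_unique)
qed

section \<open>Koethe duals of spaces of Lorentz type\<close>

text \<open>E has the multiplier m over w dx. The dual multiplier 1/(m w) is dictated by f g dx = (f
  m) (g/(m w)) w dx, the identity behind \<open>pairing\<close>.\<close>

locale lorentz_dual_setup =
  fixes E :: "'a::euclidean_space fun_space" and b p q p' q' :: real and w m :: "'a \<Rightarrow> real"
  assumes E: "lor_eq E b p q w m"
    and b: "1 < b" and p: "1 < p" "1 < p'" "1/p + 1/p' = 1" and q: "1 < q" "1 < q'" "1/q + 1/q' = (1::real)"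
    and w[measurable]: "w \<in> borel_measurable lebesgue" and wpos: "\<And>x. 0 < w x"
    and m[measurable]: "m \<in> borel_measurable lebesgue" and mpos: "\<And>x. 0 < m x"
begin

definition "M = density lebesgue (\<lambda>x. ennreal (w x))"
definition "\<Phi> f = (\<lambda>x. ennreal (cmod (f x) * m x))"
definition "\<Psi> g = (\<lambda>x. ennreal (cmod (g x) * (1 / (m x * w x))))"

lemma sets_M [measurable_cong, simp]: "sets M = sets lebesgue" by (simp add: M_def)

lemma space_M [simp]: "space M = UNIV" by (simp add: M_def)

lemma \<Phi>_measurable [measurable]: "f \<in> borel_measurable lebesgue \<Longrightarrow> \<Phi> f \<in> borel_measurable M"
  unfolding \<Phi>_def by (simp add: M_def)

lemma \<Psi>_measurable [measurable]: "g \<in> borel_measurable lebesgue \<Longrightarrow> \<Psi> g \<in> borel_measurable M"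
  unfolding \<Psi>_def by (simp add: M_def)

lemma lam_\<Phi>: "lam b p q w m f = dlor b p q M (\<Phi> f)"
  by (simp add: lam_def M_def \<Phi>_def)

lemma lam_\<Psi>: "lam b p' q' w (\<lambda>x. 1 / (m x * w x)) g = dlor b p' q' M (\<Psi> g)"
  by (simp add: lam_def M_def \<Psi>_def)

lemma pairing:
  assumes f: "f \<in> borel_measurable lebesgue" and g: "g \<in> borel_measurable lebesgue"
  shows "(\<integral>\<^sup>+x. ennreal (cmod (f x * g x)) \<partial>lebesgue) = (\<integral>\<^sup>+x. \<Phi> f x * \<Psi> g x \<partial>M)"
proof -
  have [measurable]: "\<Phi> f \<in> borel_measurable lebesgue" "\<Psi> g \<in> borel_measurable lebesgue"
    using \<Phi>_measurable[OF f] \<Psi>_measurable[OF g] by (simp_all add: M_def)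
  have "(\<integral>\<^sup>+x. \<Phi> f x * \<Psi> g x \<partial>M) = (\<integral>\<^sup>+x. ennreal (w x) * (\<Phi> f x * \<Psi> g x) \<partial>lebesgue)"
    unfolding M_def by (rule nn_integral_density) measurable
  also have "\<dots> = (\<integral>\<^sup>+x. ennreal (cmod (f x * g x)) \<partial>lebesgue)"
  proof (rule nn_integral_cong)
    fix x
    have "w x * ((cmod (f x) * m x) * (cmod (g x) * (1 / (m x * w x)))) = cmod (f x * g x)"
      using wpos[of x] mpos[of x] by (simp add: norm_mult)
    then show "ennreal (w x) * (\<Phi> f x * \<Psi> g x) = ennreal (cmod (f x * g x))"
      using wpos[of x] mpos[of x] by (simp add: \<Phi>_def \<Psi>_def less_imp_le flip: ennreal_mult)
  qed
  finally show ?thesis by simp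
qed

lemma elems_E: "f \<in> elems E \<longleftrightarrow> f \<in> borel_measurable lebesgue \<and> dlor b p q M (\<Phi> f) < top"
  using E unfolding lor_eq_def lam_\<Phi> by simp

lemma hom_E: "f \<in> borel_measurable lebesgue \<Longrightarrow> 0 < c \<Longrightarrow> qnorm E (\<lambda>x. complex_of_real c * f x) = ennreal c * qnorm E f"
  using E unfolding lor_eq_def by blast

lemma pairing_le_norm:
  obtains C where "C < top" "\<And>f g. f \<in> borel_measurable lebesgue \<Longrightarrow> g \<in> borel_measurable lebesgue \<Longrightarrow>
    (\<integral>\<^sup>+x. ennreal (cmod (f x * g x)) \<partial>lebesgue) \<le> C * (ennpowr (dlor b p q M (\<Phi> f)) (1/q) * ennpowr (dlor b p' q' M (\<Psi> g)) (1/q'))"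
proof -
  obtain C where C: "C < top" "\<And>\<phi> \<psi>. \<phi> \<in> borel_measurable M \<Longrightarrow> \<psi> \<in> borel_measurable M \<Longrightarrow>
    (\<integral>\<^sup>+x. \<phi> x * \<psi> x \<partial>M) \<le> C * (ennpowr (dlor b p q M \<phi>) (1/q) * ennpowr (dlor b p' q' M \<psi>) (1/q'))"
    using dlor_Hoelder[OF b p q, where M=M] by blast
  show thesis
    by (rule that[OF C(1)]) (simp add: pairing C(2) \<Phi>_measurable \<Psi>_measurable)
qed

lemma norm_equiv:
  obtains C where "C < top"
    "\<And>f. f \<in> borel_measurable lebesgue \<Longrightarrow> qnorm E f \<le> C * ennpowr (dlor b p q M (\<Phi> f)) (1/q)"
    "\<And>f. f \<in> borel_measurable lebesgue \<Longrightarrow> ennpowr (dlor b p q M (\<Phi> f)) (1/q) \<le> C * qnorm E f"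
  using E unfolding lor_eq_def lam_\<Phi> by blast

lemma qnorm_dual: "qnorm (koethe_dual E) g = (SUP f\<in>{f \<in> elems E. qnorm E f = 1}. \<integral>\<^sup>+x. ennreal (cmod (f x * g x)) \<partial>lebesgue)"
  by (simp add: koethe_dual_def)

text \<open>The dual norm only sees functions of norm exactly 1, so f is normalised; norm 0 is
  covered by Hoelder and the norm equivalence.\<close>

lemma pairing_le_dual_norm:
  assumes f: "f \<in> elems E" and g: "g \<in> borel_measurable lebesgue"
  shows "(\<integral>\<^sup>+x. ennreal (cmod (f x * g x)) \<partial>lebesgue) \<le> qnorm E f * qnorm (koethe_dual E) g"
proof -
  have fm[measurable]: "f \<in> borel_measurable lebesgue" using f elems_E by blast
  note g[measurable]
  obtain C where C: "C < top"
    "\<And>f. f \<in> borel_measurable lebesgue \<Longrightarrow> qnorm E f \<le> C * ennpowr (dlor b p q M (\<Phi> f)) (1/q)"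
    "\<And>f. f \<in> borel_measurable lebesgue \<Longrightarrow> ennpowr (dlor b p q M (\<Phi> f)) (1/q) \<le> C * qnorm E f"
    using norm_equiv by blast
  show ?thesis
  proof (cases "qnorm E f = 0")
    case True
    obtain D where D: "D < top" "\<And>f g. f \<in> borel_measurable lebesgue \<Longrightarrow> g \<in> borel_measurable lebesgue \<Longrightarrow>
      (\<integral>\<^sup>+x. ennreal (cmod (f x * g x)) \<partial>lebesgue) \<le> D * (ennpowr (dlor b p q M (\<Phi> f)) (1/q) * ennpowr (dlor b p' q' M (\<Psi> g)) (1/q'))"
      using pairing_le_norm by blast
    have "ennpowr (dlor b p q M (\<Phi> f)) (1/q) = 0" using C(3)[OF fm] True by simp
    then show ?thesis using D(2)[OF fm g] by simp
  next
    case False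
    have "qnorm E f < top"
      using C(2)[OF fm] C(1) f unfolding elems_E by (auto simp: ennreal_mult_less_top intro: le_less_trans)
    with False obtain N where N: "qnorm E f = ennreal N" "0 < N" by (cases "qnorm E f") auto
    \<comment> \<open>Exact homogeneity, part of \<open>lor_eq\<close>, is used here: an estimate up
      to constants would not put f1 on the unit sphere.\<close>
    define f1 where "f1 = (\<lambda>x. complex_of_real (1/N) * f x)"
    have f1m: "f1 \<in> borel_measurable lebesgue" unfolding f1_def by measurable
    have n1: "qnorm E f1 = 1" unfolding f1_def using hom_E[OF fm, of "1/N"] N by (simp flip: ennreal_mult)
    have "ennpowr (dlor b p q M (\<Phi> f1)) (1/q) \<le> C" using C(3)[OF f1m] n1 by simp
    then have "ennpowr (dlor b p q M (\<Phi> f1)) (1/q) < top" using C(1) by (rule le_less_trans)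
    then have "f1 \<in> elems E" using f1m by (simp add: elems_E)
    then have le: "(\<integral>\<^sup>+x. ennreal (cmod (f1 x * g x)) \<partial>lebesgue) \<le> qnorm (koethe_dual E) g"
      unfolding qnorm_dual using n1 by (intro SUP_upper) auto
    have "(\<integral>\<^sup>+x. ennreal (cmod (f x * g x)) \<partial>lebesgue) = (\<integral>\<^sup>+x. ennreal N * ennreal (cmod (f1 x * g x)) \<partial>lebesgue)"
      using N by (intro nn_integral_cong) (simp add: f1_def norm_mult norm_divide flip: ennreal_mult)
    also have "\<dots> = ennreal N * (\<integral>\<^sup>+x. ennreal (cmod (f1 x * g x)) \<partial>lebesgue)"
    proof (rule nn_integral_cmult)
      note f1m[measurable]
      show "(\<lambda>x. ennreal (cmod (f1 x * g x))) \<in> borel_measurable lebesgue" by measurable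
    qed
    also have "\<dots> \<le> qnorm E f * qnorm (koethe_dual E) g"
      unfolding N(1) by (rule mult_left_mono[OF le]) simp
    finally show ?thesis .
  qed
qed

text \<open>Test g with the function of \<open>dual_test_function\<close>, built on finitely many
  levels and on sets of finite measure. For the truncated functional S this gives S \<le> S^(1/q)
  times a multiple of the dual norm. As S is finite, division leaves S^(1/q'), and the truncation is
  removed by monotone convergence.\<close>

lemma dual_norm_lower:
  obtains C where "C < top" "\<And>g. g \<in> borel_measurable lebesgue \<Longrightarrow>
    ennpowr (dlor b p' q' M (\<Psi> g)) (1/q') \<le> C * qnorm (koethe_dual E) g"
proof -
  obtain C where C: "C < top"
    "\<And>f. f \<in> borel_measurable lebesgue \<Longrightarrow> qnorm E f \<le> C * ennpowr (dlor b p q M (\<Phi> f)) (1/q)"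
    "\<And>f. f \<in> borel_measurable lebesgue \<Longrightarrow> ennpowr (dlor b p q M (\<Phi> f)) (1/q) \<le> C * qnorm E f"
    using norm_equiv by blast
  define D where "D = geosum b 1 * (C * ennpowr (geosum b q) (1/q))"
  have "D < top" using C(1) b q by (simp add: D_def ennreal_mult_less_top geosum_less_top)
  moreover have "ennpowr (dlor b p' q' M (\<Psi> g)) (1/q') \<le> D * qnorm (koethe_dual E) g"
    if g[measurable]: "g \<in> borel_measurable lebesgue" for g
  proof -
    have q0: "0 < 1/q" "0 < 1/q'" using q by auto
    \<comment> \<open>Bounding w as well as x makes the measure of \<open>B N\<close> under w dx
      finite.\<close>
    define B where "B N = {x. norm x \<le> real N \<and> w x \<le> real N}" for N :: nat
    have B[measurable]: "B N \<in> sets M" for N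
    proof -
      have "w -` {..real N} \<inter> space lebesgue \<in> sets lebesgue" by (rule measurable_sets[OF w]) simp
      moreover have "cball (0::'a) (real N) \<in> sets lebesgue" by simp
      ultimately have "cball (0::'a) (real N) \<inter> (w -` {..real N} \<inter> space lebesgue) \<in> sets lebesgue" by blast
      moreover have "B N = cball (0::'a) (real N) \<inter> (w -` {..real N} \<inter> space lebesgue)" by (auto simp: B_def)
      ultimately show ?thesis by simp
    qed
    have Bfin: "emeasure M (B N) < top" for N
    proof -
      have "emeasure M (B N) = (\<integral>\<^sup>+x\<in>B N. ennreal (w x) \<partial>lebesgue)"
        unfolding M_def using B[of N] by (subst emeasure_density) auto
      also have "\<dots> \<le> (\<integral>\<^sup>+x. ennreal (real N) * indicator (cball (0::'a) (real N)) x \<partial>lebesgue)"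
      proof (rule nn_integral_mono)
        fix x
        show "ennreal (w x) * indicator (B N) x \<le> ennreal (real N) * indicator (cball (0::'a) (real N)) x"
          by (cases "x \<in> B N") (auto simp: B_def intro!: ennreal_leI)
      qed
      also have "\<dots> = ennreal (real N) * emeasure lebesgue (cball (0::'a) (real N))"
        by (rule nn_integral_cmult_indicator) simp
      also have "\<dots> < top"
        using emeasure_compact_finite[of "cball (0::'a) (real N)"] by (simp add: ennreal_mult_less_top)
      finally show ?thesis .
    qed
    define H where "H N k = (if \<bar>k\<bar> \<le> int N then {x. lev b k < \<Psi> g x} \<inter> B N else {})" for N :: nat and k :: int
    have Lev[measurable]: "{x. lev b k < \<Psi> g x} \<in> sets M" for k
    proof -
      have "{x \<in> space M. lev b k < \<Psi> g x} \<in> sets M" by measurable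
      then show ?thesis by (simp only: space_M UNIV_I simp_thms)
    qed
    have H[measurable]: "H N k \<in> sets M" for N k
    proof (cases "\<bar>k\<bar> \<le> int N")
      case True
      then show ?thesis unfolding H_def if_P[OF True] by (intro sets.Int Lev B)
    next
      case False
      show ?thesis unfolding H_def if_not_P[OF False] by (rule sets.empty_sets)
    qed
    have Hfin: "emeasure M (H N k) < top" for N k
    proof -
      have "H N k \<subseteq> B N" by (simp add: H_def)
      then have "emeasure M (H N k) \<le> emeasure M (B N)" using B by (rule emeasure_mono)
      then show ?thesis using Bfin[of N] by (rule le_less_trans)
    qed
    define S where "S N = (\<Sum>\<^sup>+k. levp b k q' * ennpowr (emeasure M (H N k)) (q'/p'))" for N
    have SN: "S N = (\<Sum>k\<in>{- int N..int N}. levp b k q' * ennpowr (emeasure M (H N k)) (q'/p'))" for N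
    proof -
      have "S N = (\<integral>\<^sup>+k. levp b k q' * ennpowr (emeasure M (H N k)) (q'/p') \<partial>count_space {- int N..int N})"
        unfolding S_def by (rule nn_integral_count_space_eq) (auto simp: H_def)
      then show ?thesis by (simp add: nn_integral_count_space_finite)
    qed
    have bound: "ennpowr (S N) (1/q') \<le> D * qnorm (koethe_dual E) g" for N
    proof -
      obtain \<phi> where \<phi>: "\<phi> \<in> borel_measurable M" "\<And>x. 0 \<le> \<phi> x"
        "dlor b p q M (\<lambda>x. ennreal (\<phi> x)) \<le> geosum b q * S N"
        "S N \<le> geosum b 1 * (\<integral>\<^sup>+x. ennreal (\<phi> x) * \<Psi> g x \<partial>M)"
      proof -
        have nested: "H N k \<subseteq> H N j" if "j \<in> {- int N..int N}" "k \<in> {- int N..int N}" "j \<le> k" for j k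
        proof -
          have "lev b j \<le> lev b k"
            using that b by (intro ennreal_leI powr_mono) auto
          then have "lev b k < y \<Longrightarrow> lev b j < y" for y
            by (rule le_less_trans)
          then show ?thesis using that by (auto simp: H_def)
        qed
        have level: "lev b k < \<Psi> g x" if "x \<in> H N k" for k x
          using that by (auto simp: H_def split: if_splits)
        have ne: "finite {- int N..int N}" "{- int N..int N} \<noteq> {}" by auto
        have "\<exists>\<phi>. \<phi> \<in> borel_measurable M \<and> (\<forall>x. 0 \<le> \<phi> x) \<and>
            dlor b p q M (\<lambda>x. ennreal (\<phi> x)) \<le> geosum b q * S N \<and>
            S N \<le> geosum b 1 * (\<integral>\<^sup>+x. ennreal (\<phi> x) * \<Psi> g x \<partial>M)"
          unfolding SN
          by (rule dual_test_function[OF b p q \<Psi>_measurable[OF g] H Hfin ne nested level]) (assumption | blast)+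
        then show thesis using that by blast
      qed
      define f where "f x = complex_of_real (\<phi> x / m x)" for x
      have f[measurable]: "f \<in> borel_measurable lebesgue"
        using \<phi>(1) unfolding f_def by (simp add: M_def)
      have \<Phi>f: "\<Phi> f = (\<lambda>x. ennreal (\<phi> x))"
        using \<phi>(2) mpos by (simp add: \<Phi>_def f_def fun_eq_iff norm_divide less_imp_le order.strict_implies_not_eq[OF mpos, symmetric])
      have Sfin: "S N < top"
        unfolding SN using Hfin by (simp add: ennreal_mult_less_top)
      have "dlor b p q M (\<Phi> f) < top"
        unfolding \<Phi>f using \<phi>(3) Sfin b q by (auto simp: ennreal_mult_less_top geosum_less_top intro: le_less_trans)
      then have fE: "f \<in> elems E" using f by (simp add: elems_E)
      have "S N \<le> geosum b 1 * (\<integral>\<^sup>+x. ennreal (cmod (f x * g x)) \<partial>lebesgue)"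
        using \<phi>(4) unfolding pairing[OF f g] \<Phi>f .
      also have "\<dots> \<le> geosum b 1 * (qnorm E f * qnorm (koethe_dual E) g)"
        by (intro mult_left_mono pairing_le_dual_norm fE g) simp
      also have "\<dots> \<le> geosum b 1 * ((C * ennpowr (geosum b q * S N) (1/q)) * qnorm (koethe_dual E) g)"
      proof (intro mult_left_mono mult_right_mono)
        have "qnorm E f \<le> C * ennpowr (dlor b p q M (\<Phi> f)) (1/q)" by (rule C(2)[OF f])
        also have "\<dots> \<le> C * ennpowr (geosum b q * S N) (1/q)"
          using \<phi>(3) q0 unfolding \<Phi>f by (intro mult_left_mono ennpowr_mono) auto
        finally show "qnorm E f \<le> C * ennpowr (geosum b q * S N) (1/q)" .
      qed auto
      also have "\<dots> = ennpowr (S N) (1/q) * (D * qnorm (koethe_dual E) g)"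
        unfolding D_def ennpowr_mult[OF q0(1)] by (simp only: mult_ac)
      finally have le: "S N \<le> ennpowr (S N) (1/q) * (D * qnorm (koethe_dual E) g)" .
      show ?thesis
      proof (cases "S N = 0")
        case False
        have "S N = ennpowr (S N) (1/q) * ennpowr (S N) (1/q')"
          using ennpowr_add[OF False, of "1/q" "1/q'"] q(3) by simp
        then have "ennpowr (S N) (1/q) * ennpowr (S N) (1/q') \<le> ennpowr (S N) (1/q) * (D * qnorm (koethe_dual E) g)"
          using le by simp
        then show ?thesis
          using False Sfin by (subst (asm) ennreal_mult_le_mult_iff) auto
      qed simp
    qed
    have Hinc: "H N k \<subseteq> H N' k" if "N \<le> N'" for N N' k
      using that by (auto simp: H_def B_def)
    have "dlor b p' q' M (\<Psi> g) = (\<Sum>\<^sup>+k. (SUP N. levp b k q' * ennpowr (emeasure M (H N k)) (q'/p')))"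
      unfolding dlor_def
    proof (rule nn_integral_cong)
      fix k :: int
      have "{x \<in> space M. lev b k < \<Psi> g x} = (\<Union>N. H N k)"
      proof
        show "{x \<in> space M. lev b k < \<Psi> g x} \<subseteq> (\<Union>N. H N k)"
        proof
          fix x assume x: "x \<in> {x \<in> space M. lev b k < \<Psi> g x}"
          obtain N where N: "max (norm x) (max (w x) (real_of_int \<bar>k\<bar>)) \<le> real N" using real_arch_simple by blast
          then have "x \<in> H N k" using x by (auto simp: H_def B_def)
          then show "x \<in> (\<Union>N. H N k)" by blast
        qed
        show "(\<Union>N. H N k) \<subseteq> {x \<in> space M. lev b k < \<Psi> g x}"
          by (auto simp: H_def split: if_splits)
      qed
      moreover have "emeasure M (\<Union>N. H N k) = (SUP N. emeasure M (H N k))"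
      proof (rule SUP_emeasure_incseq[symmetric])
        show "range (\<lambda>N. H N k) \<subseteq> sets M" using H by blast
        show "incseq (\<lambda>N. H N k)" using Hinc by (simp add: incseq_def)
      qed
      ultimately show "levp b k q' * ennpowr (emeasure M {x \<in> space M. lev b k < \<Psi> g x}) (q'/p')
         = (SUP N. levp b k q' * ennpowr (emeasure M (H N k)) (q'/p'))"
        using p q by (simp add: ennpowr_SUP SUP_mult_left_ennreal)
    qed
    also have "\<dots> = (SUP N. S N)"
      unfolding S_def
    proof (rule nn_integral_monotone_convergence_SUP)
      show "incseq (\<lambda>N k. levp b k q' * ennpowr (emeasure M (H N k)) (q'/p'))"
        using p q by (intro incseq_SucI le_funI mult_left_mono ennpowr_mono emeasure_mono H Hinc) auto
    qed simp
    finally have "ennpowr (dlor b p' q' M (\<Psi> g)) (1/q') = (SUP N. ennpowr (S N) (1/q'))"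
      using q0 by (simp add: ennpowr_SUP)
    then show ?thesis using bound by (simp add: SUP_least)
  qed
  ultimately show thesis by (rule that)
qed

text \<open>A gliding hump: if the dual norm of \<open>g\<close> were infinite, then \<open>g\<close> would not be integrable against
  \<open>sup\<^sub>n b\<^bsup>-n\<^esup> |f\<^sub>n|\<close> for suitable \<open>f\<^sub>n\<close> in the unit sphere of \<open>E\<close>.\<close>

lemma dual_elems_finite:
  assumes "g \<in> elems (koethe_dual E)"
  shows "dlor b p' q' M (\<Psi> g) < top"
proof (rule ccontr)
  assume inf: "\<not> ?thesis"
  have g[measurable]: "g \<in> borel_measurable lebesgue"
    and int: "\<And>f. f \<in> elems E \<Longrightarrow> integrable lebesgue (\<lambda>x. f x * g x)"
    using assms by (auto simp: koethe_dual_def)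
  obtain D where D: "D < top" "\<And>g. g \<in> borel_measurable lebesgue \<Longrightarrow>
    ennpowr (dlor b p' q' M (\<Psi> g)) (1/q') \<le> D * qnorm (koethe_dual E) g"
    using dual_norm_lower by blast
  obtain C where C: "C < top"
    "\<And>f. f \<in> borel_measurable lebesgue \<Longrightarrow> qnorm E f \<le> C * ennpowr (dlor b p q M (\<Phi> f)) (1/q)"
    "\<And>f. f \<in> borel_measurable lebesgue \<Longrightarrow> ennpowr (dlor b p q M (\<Phi> f)) (1/q) \<le> C * qnorm E f"
    using norm_equiv by blast
  have "ennpowr (dlor b p' q' M (\<Psi> g)) (1/q') = top" using inf by (simp add: less_top[symmetric])
  then have top: "qnorm (koethe_dual E) g = top"
    using D(2)[OF g] D(1) by (auto simp: top_unique ennreal_mult_eq_top_iff)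
  \<comment> \<open>The growth b^(2n) outweighs the damping b^(-n) in the supremum and leaves
    pairings of at least b^n.\<close>
  have "\<exists>f. f \<in> elems E \<and> qnorm E f = 1 \<and> ennreal (b powr (2 * real n)) < (\<integral>\<^sup>+x. ennreal (cmod (f x * g x)) \<partial>lebesgue)" for n :: nat
  proof -
    have "ennreal (b powr (2 * real n)) < qnorm (koethe_dual E) g" by (simp add: top)
    then show ?thesis unfolding qnorm_dual less_SUP_iff by blast
  qed
  then obtain F where F: "\<And>n. F n \<in> elems E" "\<And>n. qnorm E (F n) = 1"
    "\<And>n::nat. ennreal (b powr (2 * real n)) < (\<integral>\<^sup>+x. ennreal (cmod (F n x * g x)) \<partial>lebesgue)"
    by metis
  have Fm[measurable]: "F n \<in> borel_measurable lebesgue" for n using F(1) elems_E by blast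
  have le: "dlor b p q M (\<Phi> (F n)) \<le> ennpowr C q" for n
  proof -
    have "ennpowr (dlor b p q M (\<Phi> (F n))) (1/q) \<le> C" using C(3)[OF Fm[of n]] F(2)[of n] by simp
    then have "ennpowr (ennpowr (dlor b p q M (\<Phi> (F n))) (1/q)) q \<le> ennpowr C q" using q by (intro ennpowr_mono) auto
    then show ?thesis using q by (simp add: ennpowr_ennpowr)
  qed
  define \<phi> where "\<phi> x = (SUP n::nat. ennreal (b powr (- real n)) * \<Phi> (F n) x)" for x
  have fin: "dlor b p q M \<phi> < top"
    unfolding \<phi>_def using b p q C(1) by (intro dlor_SUP_less_top[OF _ _ _ _ le]) auto
  have \<phi>[measurable]: "\<phi> \<in> borel_measurable M" unfolding \<phi>_def by measurable
  have AEM: "AE x in M. \<phi> x < top"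
    using b p q by (intro dlor_finite_AE[OF _ _ _ \<phi> fin]) auto
  then have AEl: "AE x in lebesgue. \<phi> x < top"
    unfolding M_def using wpos by (simp add: AE_density)
  have \<phi>l[measurable]: "\<phi> \<in> borel_measurable lebesgue" using \<phi> by (simp add: M_def)
  \<comment> \<open>Infinite values occur on a null set only, where \<open>enn2real\<close> makes
    them 0; dividing by m undoes the multiplier in \<Phi>.\<close>
  define f where "f x = complex_of_real (enn2real (\<phi> x) / m x)" for x
  have f[measurable]: "f \<in> borel_measurable lebesgue" unfolding f_def by measurable
  have \<Phi>f: "\<Phi> f x = ennreal (enn2real (\<phi> x))" for x
    using mpos[of x] by (simp add: \<Phi>_def f_def norm_divide)
  have "dlor b p q M (\<Phi> f) = dlor b p q M \<phi>"
  proof (rule dlor_cong_AE)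
    show "AE x in M. \<Phi> f x = \<phi> x" using AEM by (rule eventually_mono) (simp add: \<Phi>f)
  qed (use p q in \<open>auto simp: \<Phi>_measurable\<close>)
  then have "f \<in> elems E" using fin f by (simp add: elems_E)
  then have "integrable lebesgue (\<lambda>x. f x * g x)" by (rule int)
  then have "(\<integral>\<^sup>+x. ennreal (cmod (f x * g x)) \<partial>lebesgue) < top" by (simp add: integrable_iff_bounded)
  then obtain R where R: "(\<integral>\<^sup>+x. ennreal (cmod (f x * g x)) \<partial>lebesgue) = ennreal R" "0 \<le> R"
    by (cases "\<integral>\<^sup>+x. ennreal (cmod (f x * g x)) \<partial>lebesgue") auto
  obtain n :: nat where n: "log b (R + 1) \<le> real n" using real_arch_simple by blast
  then have n': "R + 1 \<le> b powr real n" using b R by (subst le_powr_iff) auto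
  have "ennreal (b powr real n) = ennreal (b powr (- real n)) * ennreal (b powr (2 * real n))"
    unfolding ennreal_powr_add[symmetric] using b by simp
  also have "\<dots> \<le> ennreal (b powr (- real n)) * (\<integral>\<^sup>+x. ennreal (cmod (F n x * g x)) \<partial>lebesgue)"
    by (intro mult_left_mono less_imp_le[OF F(3)]) simp
  also have "\<dots> = (\<integral>\<^sup>+x. ennreal (b powr (- real n)) * ennreal (cmod (F n x * g x)) \<partial>lebesgue)"
    by (rule nn_integral_cmult[symmetric]) measurable
  also have "\<dots> \<le> (\<integral>\<^sup>+x. ennreal (cmod (f x * g x)) \<partial>lebesgue)"
  proof (rule nn_integral_mono_AE, rule eventually_mono[OF AEl])
    fix x assume x: "\<phi> x < top"
    have "ennreal (b powr (- real n)) * \<Phi> (F n) x \<le> \<phi> x" unfolding \<phi>_def by (intro SUP_upper) auto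
    also have "\<phi> x = ennreal (enn2real (\<phi> x))" using x by simp
    finally have "b powr (- real n) * (cmod (F n x) * m x) \<le> enn2real (\<phi> x)"
      using mpos[of x] by (simp add: \<Phi>_def less_imp_le flip: ennreal_mult)
    then have "b powr (- real n) * cmod (F n x) \<le> enn2real (\<phi> x) / m x"
      using mpos[of x] by (simp add: pos_le_divide_eq mult.assoc)
    moreover have "cmod (f x) = enn2real (\<phi> x) / m x" using mpos[of x] by (simp add: f_def norm_divide)
    ultimately have "b powr (- real n) * cmod (F n x) * cmod (g x) \<le> cmod (f x) * cmod (g x)"
      by (intro mult_right_mono) auto
    then show "ennreal (b powr (- real n)) * ennreal (cmod (F n x * g x)) \<le> ennreal (cmod (f x * g x))"
      by (simp add: norm_mult mult.assoc flip: ennreal_mult)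
  qed
  finally have "b powr real n \<le> R" unfolding R(1) using R(2) by simp
  with n' show False by simp
qed

text \<open>\<open>pairing_le_norm\<close> gives integrability and the upper bound,
  \<open>dual_norm_lower\<close> the lower bound, and \<open>dual_elems_finite\<close> excludes
  elements of infinite norm.\<close>

lemma lor_eq_koethe_dual: "lor_eq (koethe_dual E) b p' q' w (\<lambda>x. 1 / (m x * w x))"
proof -
  obtain H where H: "H < top" "\<And>f g. f \<in> borel_measurable lebesgue \<Longrightarrow> g \<in> borel_measurable lebesgue \<Longrightarrow>
    (\<integral>\<^sup>+x. ennreal (cmod (f x * g x)) \<partial>lebesgue) \<le> H * (ennpowr (dlor b p q M (\<Phi> f)) (1/q) * ennpowr (dlor b p' q' M (\<Psi> g)) (1/q'))"
    using pairing_le_norm by blast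
  obtain D where D: "D < top" "\<And>g. g \<in> borel_measurable lebesgue \<Longrightarrow>
    ennpowr (dlor b p' q' M (\<Psi> g)) (1/q') \<le> D * qnorm (koethe_dual E) g"
    using dual_norm_lower by blast
  obtain C where C: "C < top"
    "\<And>f. f \<in> borel_measurable lebesgue \<Longrightarrow> qnorm E f \<le> C * ennpowr (dlor b p q M (\<Phi> f)) (1/q)"
    "\<And>f. f \<in> borel_measurable lebesgue \<Longrightarrow> ennpowr (dlor b p q M (\<Phi> f)) (1/q) \<le> C * qnorm E f"
    using norm_equiv by blast
  show ?thesis
    unfolding lor_eq_def lam_\<Psi>
  proof (intro conjI exI[of _ "H * C + D"] ballI allI impI)
    show "H * C + D < top" using H C D by (simp add: ennreal_mult_less_top)
    show "elems (koethe_dual E) = {g \<in> borel_measurable lebesgue. dlor b p' q' M (\<Psi> g) < top}"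
    proof (intro set_eqI iffI)
      fix g assume g: "g \<in> elems (koethe_dual E)"
      then show "g \<in> {g \<in> borel_measurable lebesgue. dlor b p' q' M (\<Psi> g) < top}"
        using dual_elems_finite[OF g] by (auto simp: koethe_dual_def)
    next
      fix g assume "g \<in> {g \<in> borel_measurable lebesgue. dlor b p' q' M (\<Psi> g) < top}"
      then have g[measurable]: "g \<in> borel_measurable lebesgue" and fin: "dlor b p' q' M (\<Psi> g) < top" by auto
      have "integrable lebesgue (\<lambda>x. f x * g x)" if f: "f \<in> elems E" for f
      proof (rule integrableI_bounded)
        have fm[measurable]: "f \<in> borel_measurable lebesgue" using f elems_E by blast
        show "(\<lambda>x. f x * g x) \<in> borel_measurable lebesgue" by measurable
        have "(\<integral>\<^sup>+x. ennreal (cmod (f x * g x)) \<partial>lebesgue) \<le> H * (ennpowr (dlor b p q M (\<Phi> f)) (1/q) * ennpowr (dlor b p' q' M (\<Psi> g)) (1/q'))"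
          by (rule H(2)[OF fm g])
        also have "\<dots> < top" using H(1) f fin by (simp add: ennreal_mult_less_top elems_E)
        finally show "(\<integral>\<^sup>+x. ennreal (cmod (f x * g x)) \<partial>lebesgue) < \<infinity>" by simp
      qed
      then show "g \<in> elems (koethe_dual E)" by (simp add: koethe_dual_def)
    qed
    fix g :: "'a \<Rightarrow> complex" assume g[measurable]: "g \<in> borel_measurable lebesgue"
    have "qnorm (koethe_dual E) g \<le> H * (C * ennpowr (dlor b p' q' M (\<Psi> g)) (1/q'))"
      unfolding qnorm_dual
    proof (rule SUP_least)
      fix f assume f: "f \<in> {f \<in> elems E. qnorm E f = 1}"
      then have fm: "f \<in> borel_measurable lebesgue" using elems_E by blast
      have "ennpowr (dlor b p q M (\<Phi> f)) (1/q) \<le> C" using C(3)[OF fm] f by simp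
      then show "(\<integral>\<^sup>+x. ennreal (cmod (f x * g x)) \<partial>lebesgue) \<le> H * (C * ennpowr (dlor b p' q' M (\<Psi> g)) (1/q'))"
        by (intro order_trans[OF H(2)[OF fm g]] mult_left_mono mult_right_mono) auto
    qed
    also have "\<dots> \<le> (H * C + D) * ennpowr (dlor b p' q' M (\<Psi> g)) (1/q')"
      unfolding mult.assoc[symmetric] by (intro mult_right_mono) auto
    finally show "qnorm (koethe_dual E) g \<le> (H * C + D) * ennpowr (dlor b p' q' M (\<Psi> g)) (1/q')" .
    have "D * qnorm (koethe_dual E) g \<le> (H * C + D) * qnorm (koethe_dual E) g" by (intro mult_right_mono) auto
    with D(2)[OF g] show "ennpowr (dlor b p' q' M (\<Psi> g)) (1/q') \<le> (H * C + D) * qnorm (koethe_dual E) g" by (rule order_trans)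
    fix c :: real assume c: "0 < c"
    have "(\<integral>\<^sup>+x. ennreal (cmod (f x * (complex_of_real c * g x))) \<partial>lebesgue) = ennreal c * (\<integral>\<^sup>+x. ennreal (cmod (f x * g x)) \<partial>lebesgue)"
      if f: "f \<in> elems E" for f
    proof -
      have fm[measurable]: "f \<in> borel_measurable lebesgue" using f elems_E by blast
      have "(\<integral>\<^sup>+x. ennreal (cmod (f x * (complex_of_real c * g x))) \<partial>lebesgue) = (\<integral>\<^sup>+x. ennreal c * ennreal (cmod (f x * g x)) \<partial>lebesgue)"
        using c by (intro nn_integral_cong) (simp add: norm_mult mult_ac flip: ennreal_mult)
      also have "\<dots> = ennreal c * (\<integral>\<^sup>+x. ennreal (cmod (f x * g x)) \<partial>lebesgue)"
        by (rule nn_integral_cmult) measurable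
      finally show ?thesis .
    qed
    then show "qnorm (koethe_dual E) (\<lambda>x. complex_of_real c * g x) = ennreal c * qnorm (koethe_dual E) g"
      unfolding qnorm_dual SUP_mult_left_ennreal by (intro SUP_cong refl) auto
  qed
qed

end

section \<open>The maximal function on the scale \<open>X\<^bsub>r,s\<^esub>\<close>\<close>

text \<open>Finiteness of the functional makes the maximal function finite almost everywhere, so
  that passing through \<open>enn2real\<close> alters it on a null set only and the bound for
  \<open>maxf\<close> carries over.\<close>

lemma bounded_on_lor_eq:
  fixes E :: "(real^'n) fun_space"
  assumes E: "lor_eq E b p q w m" and b: "1 < b" and p: "0 < p" and q: "0 < q"
    and w[measurable]: "w \<in> borel_measurable lebesgue" and wpos: "\<And>x. 0 < w x"
    and m[measurable]: "m \<in> borel_measurable lebesgue" and mpos: "\<And>x. 0 < m x"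
    and D: "D < top" "\<And>\<phi>. \<phi> \<in> borel_measurable lebesgue \<Longrightarrow>
      dlor b p q (density lebesgue (\<lambda>x. ennreal (w x))) (\<lambda>x. maxf \<phi> x * ennreal (m x))
        \<le> D * dlor b p q (density lebesgue (\<lambda>x. ennreal (w x))) (\<lambda>x. \<phi> x * ennreal (m x))"
  shows "bounded_on maximal_fun E"
proof -
  let ?M = "density lebesgue (\<lambda>x. ennreal (w x))"
  obtain C where C: "C < top"
    "\<And>f. f \<in> borel_measurable lebesgue \<Longrightarrow> qnorm E f \<le> C * ennpowr (lam b p q w m f) (1/q)"
    "\<And>f. f \<in> borel_measurable lebesgue \<Longrightarrow> ennpowr (lam b p q w m f) (1/q) \<le> C * qnorm E f"
    using E unfolding lor_eq_def by blast
  have el: "elems E = {f \<in> borel_measurable lebesgue. lam b p q w m f < top}"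
    using E unfolding lor_eq_def by blast
  have q0: "0 < 1/q" using q by simp
  define K where "K = C * (ennpowr D (1/q) * C)"
  have "K < top" using C D by (simp add: K_def ennreal_mult_less_top)
  then obtain k where k: "K = ennreal k" by (cases K) auto
  show ?thesis
    unfolding bounded_on_def
  proof (intro exI[of _ k] ballI)
    fix f assume f: "f \<in> elems E"
    then have fm[measurable]: "f \<in> borel_measurable lebesgue" and lf: "lam b p q w m f < top" by (auto simp: el)
    let ?\<phi> = "\<lambda>x. ennreal (cmod (f x))"
    let ?G = "\<lambda>x. maxf ?\<phi> x * ennreal (m x)"
    have Gm: "?G \<in> borel_measurable ?M" by simp
    have lam_f: "lam b p q w m f = dlor b p q ?M (\<lambda>x. ?\<phi> x * ennreal (m x))"
      unfolding lam_def using mpos by (simp add: ennreal_mult less_imp_le)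
    have le: "dlor b p q ?M ?G \<le> D * lam b p q w m f"
      unfolding lam_f by (rule D(2)) measurable
    have "D * lam b p q w m f < top" using D(1) lf by (simp add: ennreal_mult_less_top)
    with le have "dlor b p q ?M ?G < top" by (rule le_less_trans)
    then have "AE x in ?M. ?G x < top" using b p q Gm by (intro dlor_finite_AE[of b p q]) auto
    then have "AE x in lebesgue. ?G x < top" using wpos by (simp add: AE_density)
    then have AE: "AE x in lebesgue. maximal_fun f x < top"
    proof (rule eventually_mono)
      fix x assume "?G x < top"
      moreover have "ennreal (m x) \<noteq> 0" using mpos[of x] by (simp add: ennreal_eq_0_iff)
      ultimately show "maximal_fun f x < top"
        unfolding maximal_fun_eq by (auto simp: ennreal_mult_less_top)
    qed
    define h where "h = (\<lambda>x. complex_of_real (enn2real (maximal_fun f x)))"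
    have hm[measurable]: "h \<in> borel_measurable lebesgue"
      unfolding h_def maximal_fun_eq by measurable
    have lam_h: "lam b p q w m h = dlor b p q ?M ?G"
      unfolding lam_def
    proof (rule dlor_cong_AE)
      have "AE x in lebesgue. ennreal (cmod (h x) * m x) = ?G x"
        using AE by (rule eventually_mono) (use mpos in \<open>auto simp: h_def maximal_fun_eq ennreal_mult less_imp_le\<close>)
      then show "AE x in ?M. ennreal (cmod (h x) * m x) = ?G x" by (auto simp: AE_density elim: eventually_mono)
    qed (use p q Gm in simp_all)
    have "h \<in> elems E"
      unfolding el using \<open>dlor b p q ?M ?G < top\<close> lam_h hm by simp
    moreover have "qnorm E h \<le> ennreal k * qnorm E f"
    proof -
      have "qnorm E h \<le> C * ennpowr (lam b p q w m h) (1/q)" by (rule C(2)[OF hm])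
      also have "\<dots> \<le> C * ennpowr (D * lam b p q w m f) (1/q)"
        unfolding lam_h using q0 le by (intro mult_left_mono ennpowr_mono) auto
      also have "\<dots> = C * (ennpowr D (1/q) * ennpowr (lam b p q w m f) (1/q))"
        by (simp only: ennpowr_mult[OF q0])
      also have "\<dots> \<le> C * (ennpowr D (1/q) * (C * qnorm E f))"
        by (intro mult_left_mono C(3) fm) auto
      also have "\<dots> = ennreal k * qnorm E f" unfolding k[symmetric] K_def by (simp only: mult.assoc)
      finally show ?thesis .
    qed
    ultimately show "(AE x in lebesgue. maximal_fun f x < \<infinity>) \<and>
        (\<lambda>x. complex_of_real (enn2real (maximal_fun f x))) \<in> elems E \<and>
        qnorm E (\<lambda>x. complex_of_real (enn2real (maximal_fun f x))) \<le> ennreal k * qnorm E f"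
      using AE unfolding h_def by simp
  qed
qed

text \<open>\<sigma> stands for 1/s and includes s = \<infinity> as \<sigma> = 0. Since 1/\<alpha> +
  1/\<beta> = 1/r - 1/s, the volume factor in \<open>A_const\<close> is exactly the power of l in
  \<open>Acond\<close>.\<close>

lemma Acond_A_const:
  fixes v :: "real^'n \<Rightarrow> real"
  assumes \<sigma>: "1/s = ereal \<sigma>" "\<sigma> < 1/p" and r: "0 < r" "r < p"
    and v[measurable]: "v \<in> borel_measurable lebesgue" and pos: "\<And>x. 0 < v x"
    and fin: "A_const (ereal p) (ereal r) s v < top"
  shows "Acond (1 / (1/p - \<sigma>)) (1 / (1/r - 1/p)) v"
proof -
  define \<alpha> where "\<alpha> = 1 / (1/p - \<sigma>)"
  define \<beta> where "\<beta> = 1 / (1/r - 1/p)"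
  have "1/p < 1/r" using r by (intro divide_strict_left_mono) auto
  then have ab: "0 < \<alpha>" "0 < \<beta>" using \<sigma> by (simp_all add: \<alpha>_def \<beta>_def)
  have inv: "1 / ereal x = ereal (1/x)" if "0 < x" for x using that by (simp add: one_ereal_def)
  have e1: "1 / (1 / ereal p - 1 / s) = ereal \<alpha>"
    using \<sigma> r inv[of p] inv[of "1/p - \<sigma>"] by (simp add: \<alpha>_def)
  have e2: "1 / (1 / ereal r - 1 / ereal p) = ereal \<beta>"
    using r inv[of p] inv[of r] inv[of "1/r - 1/p"] \<open>1/p < 1/r\<close> by (simp add: \<beta>_def)
  have e3: "real_of_ereal (1 / ereal r - 1 / s) = 1/r - \<sigma>"
    using \<sigma> r inv[of r] by simp
  have sum: "1/\<alpha> + 1/\<beta> = 1/r - \<sigma>" by (simp add: \<alpha>_def \<beta>_def)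
  have L1: "Lnorm lebesgue (ereal \<alpha>) (\<lambda>x. ennreal (v x) * indicator Q x) = ennpowr (wint v \<alpha> Q) (1/\<alpha>)" for Q
    using pos unfolding Lnorm_def wint_def by (simp add: ennpowr_indicator ennpowr_ennreal less_imp_le)
  have L2: "Lnorm lebesgue (ereal \<beta>) (\<lambda>x. ennreal (inverse (v x)) * indicator Q x) = ennpowr (wint v (- \<beta>) Q) (1/\<beta>)" for Q
    using pos unfolding Lnorm_def wint_def by (simp add: ennpowr_indicator ennpowr_ennreal less_imp_le powr_minus inverse_powr)
  have "Acond \<alpha> \<beta> v"
    unfolding Acond_def
  proof (intro exI[of _ "A_const (ereal p) (ereal r) s v"] conjI allI impI)
    show "A_const (ereal p) (ereal r) s v < top" by (rule fin)
    fix x :: "real^'n" and l :: real assume l: "0 < l"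
    let ?X = "ennpowr (wint v \<alpha> (cube x l)) (1/\<alpha>)" and ?Y = "ennpowr (wint v (- \<beta>) (cube x l)) (1/\<beta>)"
    let ?e = "real CARD('n) * (1/\<alpha> + 1/\<beta>)"
    have meas: "measure lebesgue (cube x l) = l powr real CARD('n)"
      using l emeasure_cube[of l x] by (simp add: measure_def powr_realpow)
    have ms: "measure lebesgue (cube x l) powr (- (1/r - \<sigma>)) = l powr (- ?e)"
      unfolding meas powr_powr sum by (simp only: mult_minus_right)
    have "ennreal (measure lebesgue (cube x l) powr (- real_of_ereal (1 / ereal r - 1/s)))
        * Lnorm lebesgue (1 / (1 / ereal p - 1/s)) (\<lambda>y. ennreal (v y) * indicator (cube x l) y)
        * Lnorm lebesgue (1 / (1 / ereal r - 1 / ereal p)) (\<lambda>y. ennreal (inverse (v y)) * indicator (cube x l) y)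
        \<le> A_const (ereal p) (ereal r) s v"
      unfolding A_const_def by (rule SUP_upper) (use l in \<open>auto simp: cubes_eq\<close>)
    then have le: "ennreal (l powr (- ?e)) * ?X * ?Y \<le> A_const (ereal p) (ereal r) s v"
      unfolding e1 e2 e3 L1 L2 ms .
    have "ennreal (l powr ?e) * ennreal (l powr (- ?e)) = 1"
      unfolding ennreal_powr_add[symmetric] using l by simp
    then have "?X * ?Y = (ennreal (l powr ?e) * ennreal (l powr (- ?e))) * (?X * ?Y)" by simp
    also have "\<dots> = ennreal (l powr ?e) * (ennreal (l powr (- ?e)) * ?X * ?Y)" by (simp only: mult.assoc)
    also have "\<dots> \<le> ennreal (l powr ?e) * A_const (ereal p) (ereal r) s v" using le by (rule mult_left_mono) simp
    finally show "?X * ?Y \<le> A_const (ereal p) (ereal r) s v * ennreal (l powr ?e)" by (simp only: mult.commute)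
  qed
  then show ?thesis by (simp only: \<alpha>_def \<beta>_def)
qed

text \<open>Each operation in \<open>space_rs\<close> acts on the parameters of
  \<open>lor_eq\<close>: a power divides both indices and raises the multiplier, a dual conjugates
  the indices and turns m into 1/(m w). It remains to recognise the Muckenhoupt weight at the
  diagonal exponent.\<close>

lemma bounded_on_space_rs:
  fixes v :: "real^'n \<Rightarrow> real"
  assumes v[measurable]: "v \<in> borel_measurable lebesgue" and pos: "\<And>x. 0 < v x"
    and r: "0 < r" "r < p" "r < q" and \<sigma>: "0 \<le> \<sigma>" "\<sigma> < 1/p" "\<sigma> < 1/q" "1/s = ereal \<sigma>" "real_of_ereal (ereal r / s) = r * \<sigma>"
    and fin: "A_const (ereal p) (ereal r) s v < top"
  shows "bounded_on maximal_fun (space_rs (lorentz_space p q v) r s)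
    \<and> bounded_on maximal_fun (koethe_dual (space_rs (lorentz_space p q v) r s))"
proof -
  define \<alpha> where "\<alpha> = 1 / (1/p - \<sigma>)"
  define \<beta> where "\<beta> = 1 / (1/r - 1/p)"
  define \<gamma> where "\<gamma> = 1 / (1 - r * \<sigma>)"
  define \<gamma>' where "\<gamma>' = 1 - r * \<sigma>"
  have p0: "0 < p" "0 < q" using r by auto
  have ps: "p * \<sigma> < 1" "q * \<sigma> < 1" using \<sigma> p0 by (simp_all add: field_simps)
  have "r * \<sigma> \<le> p * \<sigma>" using r \<sigma> by (intro mult_right_mono) auto
  then have rs: "r * \<sigma> < 1" using ps by simp
  have g: "0 < \<gamma>'" "\<gamma> = 1/\<gamma>'" "0 < \<gamma>" using rs by (simp_all add: \<gamma>'_def \<gamma>_def)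
  have "1/p < 1/r" using r by (intro divide_strict_left_mono) auto
  then have ab: "0 < \<alpha>" "0 < \<beta>" using \<sigma> by (simp_all add: \<alpha>_def \<beta>_def)
  have A: "Acond \<alpha> \<beta> v"
    unfolding \<alpha>_def \<beta>_def by (rule Acond_A_const[OF \<sigma>(4,2) r(1,2) v pos fin])
  \<comment> \<open>The indices p/r and q/r, conjugated and divided by \<gamma>. P exceeds 1 exactly
    if p \<sigma> < 1, that is p < s, and Q likewise; this legitimates the remaining
    dualities.\<close>
  define P where "P = p / (p - r) / \<gamma>"
  define Q where "Q = q / (q - r) / \<gamma>"
  have P1: "P = p * \<gamma>' / (p - r)" "Q = q * \<gamma>' / (q - r)" using g by (simp_all add: P_def Q_def)
  have PQ: "1 < P" "1 < Q"
    unfolding P1 using r ps by (simp_all add: \<gamma>'_def less_divide_eq algebra_simps)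
  define P' where "P' = P / (P - 1)"
  define Q' where "Q' = Q / (Q - 1)"
  have conj: "1 < x / (x - 1)" "1/x + 1/(x / (x - 1)) = 1" if "1 < x" for x :: real
    using that by (simp_all add: less_divide_eq field_simps)
  have conjr: "1 < x / r" "1 < x / (x - r)" "1/(x/r) + 1/(x/(x - r)) = 1" if "r < x" for x :: real
    using that r by (simp_all add: less_divide_eq field_simps)
  let ?w = "\<lambda>x. v x powr p"
  have wm: "?w \<in> borel_measurable lebesgue" by measurable
  have pw: "(\<lambda>x. v x powr c) \<in> borel_measurable lebesgue" for c by measurable
  have wpos: "0 < v x powr c" for x c using pos[of x] by simp
  \<comment> \<open>The base 2 after the powers r and \<gamma>.\<close>
  define b where "b = (2 powr r) powr \<gamma>"
  have b1: "1 < (2::real) powr r" using r by simp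
  have b: "1 < b" unfolding b_def by (rule gr_one_powr[OF b1 g(3)])
  let ?X = "lorentz_space p q v"
  let ?X1 = "space_power ?X r"
  let ?X2 = "koethe_dual ?X1"
  let ?X3 = "space_power ?X2 \<gamma>"
  let ?X4 = "koethe_dual ?X3"
  have rs_eq: "space_rs ?X r s = ?X4" by (simp add: space_rs_def \<gamma>_def \<sigma>(5))
  have X0: "lor_eq ?X 2 p q ?w (\<lambda>_. 1)"
    by (rule lor_eq_lorentz_space[OF v p0]) simp
  have X1: "lor_eq ?X1 (2 powr r) (p/r) (q/r) ?w (\<lambda>_. 1)"
    using lor_eq_space_power[OF X0 r(1)] p0 by simp
  interpret d1: lorentz_dual_setup ?X1 "2 powr r" "p/r" "q/r" "p/(p - r)" "q/(q - r)" ?w "\<lambda>_. 1"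
    using X1 b1 conjr[OF r(2)] conjr[OF r(3)] wm wpos by unfold_locales simp_all
  have e2: "(\<lambda>x. 1 / (1 * v x powr p)) = (\<lambda>x. v x powr (- p))"
    by (simp add: powr_minus divide_inverse)
  have X2: "lor_eq ?X2 (2 powr r) (p/(p - r)) (q/(q - r)) ?w (\<lambda>x. v x powr (- p))"
    using d1.lor_eq_koethe_dual unfolding e2 .
  have X3: "lor_eq ?X3 b P Q ?w (\<lambda>x. v x powr (- (p * \<gamma>)))"
    using lor_eq_space_power[OF X2 g(3) b1 wpos] r unfolding b_def P_def Q_def powr_powr by simp
  interpret d2: lorentz_dual_setup ?X3 b P Q P' Q' ?w "\<lambda>x. v x powr (- (p * \<gamma>))"
    using X3 b PQ conj[OF PQ(1)] conj[OF PQ(2)] wm pw wpos unfolding P'_def Q'_def by unfold_locales simp_all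
  have inv_powr: "1 / v x powr y = v x powr (- y)" for x y by (simp add: powr_minus divide_inverse)
  have e4: "(\<lambda>x. 1 / (v x powr (- (p * \<gamma>)) * v x powr p)) = (\<lambda>x. v x powr (p * (\<gamma> - 1)))"
  proof
    fix x
    have "1 / (v x powr (- (p * \<gamma>)) * v x powr p) = v x powr (- (- (p * \<gamma>) + p))"
      unfolding powr_add[symmetric] by (rule inv_powr)
    also have "- (- (p * \<gamma>) + p) = p * (\<gamma> - 1)" by (simp add: algebra_simps)
    finally show "1 / (v x powr (- (p * \<gamma>)) * v x powr p) = v x powr (p * (\<gamma> - 1))" .
  qed
  have X4: "lor_eq ?X4 b P' Q' ?w (\<lambda>x. v x powr (p * (\<gamma> - 1)))"
    using d2.lor_eq_koethe_dual unfolding e4 .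
  have PQ': "1 < P'" "1 < Q'" "1/P' + 1/P = 1" "1/Q' + 1/Q = 1"
    using d2.p d2.q by simp_all
  interpret d3: lorentz_dual_setup ?X4 b P' Q' P Q ?w "\<lambda>x. v x powr (p * (\<gamma> - 1))"
    using X4 b PQ PQ' wm pw wpos by unfold_locales simp_all
  have e5: "(\<lambda>x. 1 / (v x powr (p * (\<gamma> - 1)) * v x powr p)) = (\<lambda>x. inverse (v x) powr (p * \<gamma>))"
  proof
    fix x
    have "1 / (v x powr (p * (\<gamma> - 1)) * v x powr p) = v x powr (- (p * (\<gamma> - 1) + p))"
      unfolding powr_add[symmetric] by (rule inv_powr)
    also have "p * (\<gamma> - 1) + p = p * \<gamma>" by (simp add: algebra_simps)
    finally show "1 / (v x powr (p * (\<gamma> - 1)) * v x powr p) = inverse (v x) powr (p * \<gamma>)"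
      using pos[of x] by (simp add: powr_minus inverse_powr)
  qed
  have X5: "lor_eq (koethe_dual ?X4) b P Q ?w (\<lambda>x. inverse (v x) powr (p * \<gamma>))"
    using d3.lor_eq_koethe_dual unfolding e5 .
  have al: "\<alpha> = p / (1 - p * \<sigma>)" using p0 ps by (simp add: \<alpha>_def field_simps)
  have be: "\<beta> = p * r / (p - r)" using r by (simp add: \<beta>_def field_simps)
  have Pm: "P - 1 = r * (1 - p * \<sigma>) / (p - r)"
    unfolding P1 using r by (simp add: \<gamma>'_def field_simps)
  have P'_eq: "P' = p * \<gamma>' / (r * (1 - p * \<sigma>))"
    unfolding P'_def Pm by (subst P1(1)) (use r in simp)
  \<comment> \<open>1 + \<alpha>/\<beta> is the index of the Muckenhoupt class to which
    \<open>Acond \<alpha> \<beta> v\<close> assigns v^\<alpha>.\<close>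
  have c1: "P' = 1 + \<alpha> / \<beta>"
  proof -
    have "\<alpha> / \<beta> = (p - r) / (r * (1 - p * \<sigma>))" unfolding al be using r p0 by simp
    then have "1 + \<alpha> / \<beta> = (r * (1 - p * \<sigma>) + (p - r)) / (r * (1 - p * \<sigma>))"
      using r ps by (simp add: add_divide_distrib)
    also have "r * (1 - p * \<sigma>) + (p - r) = p * \<gamma>'" by (simp add: \<gamma>'_def algebra_simps)
    finally show ?thesis unfolding P'_eq by simp
  qed
  have c2: "P = 1 + \<beta> / \<alpha>"
  proof -
    have "\<beta> / \<alpha> = r * (1 - p * \<sigma>) / (p - r)" unfolding al be using r p0 ps by simp
    then show ?thesis using Pm by simp
  qed
  have gm: "\<gamma> - 1 = r * \<sigma> / \<gamma>'" using g by (simp add: \<gamma>'_def field_simps)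
  \<comment> \<open>At the diagonal exponent P' the weight w m^P' is v^\<alpha>, with w = v^p and m
    = v^(p (\<gamma> - 1)).\<close>
  have c3: "p + p * (\<gamma> - 1) * P' = \<alpha>"
  proof -
    have "p * (\<gamma> - 1) * P' = p * \<sigma> * p / (1 - p * \<sigma>)"
      unfolding gm P'_eq using g r by simp
    also have "p + p * \<sigma> * p / (1 - p * \<sigma>) = (p * (1 - p * \<sigma>) + p * \<sigma> * p) / (1 - p * \<sigma>)"
      using ps by (simp add: add_divide_distrib)
    finally show ?thesis unfolding al by (simp add: algebra_simps)
  qed
  \<comment> \<open>The same for the dual space with U = 1/v: the measure is U^(-p) dx, the
    multiplier U^(p \<gamma>), and the diagonal weight U^\<beta>.\<close>
  have c4: "- p + p * \<gamma> * P = \<beta>"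
  proof -
    have "p * \<gamma> * P = p * p / (p - r)" unfolding P1 using g by simp
    also have "- p + p * p / (p - r) = (- p * (p - r) + p * p) / (p - r)"
      using r by (simp add: add_divide_distrib diff_divide_distrib)
    finally show ?thesis unfolding be by (simp add: algebra_simps)
  qed
  obtain D1 where D1: "D1 < top" "\<And>\<phi>. \<phi> \<in> borel_measurable lebesgue \<Longrightarrow>
     dlor b P' Q' (density lebesgue (\<lambda>x. ennreal (v x powr p))) (\<lambda>x. maxf \<phi> x * ennreal (v x powr (p * (\<gamma> - 1))))
      \<le> D1 * dlor b P' Q' (density lebesgue (\<lambda>x. ennreal (v x powr p))) (\<lambda>x. \<phi> x * ennreal (v x powr (p * (\<gamma> - 1))))"
    using maxf_lorentz[OF v pos ab A c1 c3 _ b, of Q'] PQ' by auto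
  have "bounded_on maximal_fun ?X4"
    using PQ' by (intro bounded_on_lor_eq[OF X4 b _ _ wm wpos pw wpos D1]) auto
  moreover have "bounded_on maximal_fun (koethe_dual ?X4)"
  proof -
    have iv: "(\<lambda>x. inverse (v x)) \<in> borel_measurable lebesgue" by measurable
    have ipos: "0 < inverse (v x)" for x using pos[of x] by simp
    have eq: "inverse (v x) powr (- p) = v x powr p" for x
      using pos[of x] by (simp add: powr_minus inverse_powr)
    obtain D2 where D2: "D2 < top" "\<And>\<phi>. \<phi> \<in> borel_measurable lebesgue \<Longrightarrow>
     dlor b P Q (density lebesgue (\<lambda>x. ennreal (v x powr p))) (\<lambda>x. maxf \<phi> x * ennreal (inverse (v x) powr (p * \<gamma>)))
      \<le> D2 * dlor b P Q (density lebesgue (\<lambda>x. ennreal (v x powr p))) (\<lambda>x. \<phi> x * ennreal (inverse (v x) powr (p * \<gamma>)))"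
      using maxf_lorentz[OF iv ipos ab(2,1) Acond_inverse[OF pos A] c2 c4 _ b, of Q] PQ unfolding eq by auto
    have im: "(\<lambda>x. inverse (v x) powr (p * \<gamma>)) \<in> borel_measurable lebesgue" by measurable
    have ip: "0 < inverse (v x) powr c" for x c using pos[of x] by simp
    show ?thesis
      using PQ by (intro bounded_on_lor_eq[OF X5 b _ _ wm wpos im ip D2]) auto
  qed
  ultimately show ?thesis unfolding rs_eq by blast
qed

theorem theorem3p3:
  fixes r p q :: real and s :: ereal and v :: "real^'n \<Rightarrow> real"
    and X :: "(real^'n) fun_space"
  assumes "0 < r" and "ereal r < s"
    and "r < p" and "ereal p < s"
    and "r < q" and "ereal q < s"
    and "weight v"
    and "v \<in> A_class (ereal p) (ereal r) s"
    and "X = lorentz_space p q v"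
  shows "bounded_on maximal_fun (space_rs X r s)
       \<and> bounded_on maximal_fun (koethe_dual (space_rs X r s))"
proof -
  \<comment> \<open>Replaces s by its reciprocal, a real number that is 0 for s =
    \<infinity>.\<close>
  obtain \<sigma> where \<sigma>: "0 \<le> \<sigma>" "\<sigma> < 1/p" "\<sigma> < 1/q" "1/s = ereal \<sigma>" "real_of_ereal (ereal r / s) = r * \<sigma>"
  proof (cases s)
    case (real t)
    with assms have "0 < t" "p < t" "q < t" "0 < p" "0 < q" by auto
    then show ?thesis
      using real by (intro that[of "1/t"]) (auto simp: one_ereal_def intro!: divide_strict_left_mono)
  next
    case PInf
    then show ?thesis using assms by (intro that[of 0]) auto
  qed (use assms in auto)
  \<comment> \<open>A weight is positive only almost everywhere. Changing it to 1 on the exceptional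
    null set affects neither the Lorentz space nor the A-constant.\<close>
  define v' where "v' x = (if 0 < v x then v x else 1)" for x
  have v: "v \<in> borel_measurable lebesgue" and ae: "AE x in lebesgue. v x = v' x"
    using assms(7) by (auto simp: weight_def v'_def elim: eventually_mono)
  have v'[measurable]: "v' \<in> borel_measurable lebesgue"
    using v unfolding v'_def by measurable
  have pos: "0 < v' x" for x by (simp add: v'_def)
  have "(\<integral>\<^sup>+x\<in>S. ennreal (v x powr p) \<partial>lebesgue) = (\<integral>\<^sup>+x\<in>S. ennreal (v' x powr p) \<partial>lebesgue)" for S
    using ae by (intro nn_integral_cong_AE) (auto elim: eventually_mono)
  then have X: "X = lorentz_space p q v'"
    unfolding assms(9) lorentz_space_def lorentz_norm_def by simp
  \<comment> \<open>The strict inequalities between r, p and s make both exponents finite, so that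
    \<open>Lnorm\<close> is an integral here.\<close>
  have exps: "1 / (1 / ereal p - 1/s) \<noteq> \<infinity>" "1 / (1 / ereal r - 1 / ereal p) \<noteq> \<infinity>"
  proof -
    have inv: "1 / ereal x = ereal (1/x)" if "0 < x" for x using that by (simp add: one_ereal_def)
    have "1/p < 1/r" using assms by (intro divide_strict_left_mono) auto
    then have "1 / (1 / ereal p - 1/s) = ereal (1 / (1/p - \<sigma>))" "1 / (1 / ereal r - 1 / ereal p) = ereal (1 / (1/r - 1/p))"
      using \<sigma> assms inv[of p] inv[of r] inv[of "1/p - \<sigma>"] inv[of "1/r - 1/p"] by simp_all
    then show "1 / (1 / ereal p - 1/s) \<noteq> \<infinity>" "1 / (1 / ereal r - 1 / ereal p) \<noteq> \<infinity>" by simp_all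
  qed
  have Lcong: "Lnorm lebesgue e f = Lnorm lebesgue e g" if "e \<noteq> \<infinity>" "AE x in lebesgue. f x = g x" for e and f g :: "real^'n \<Rightarrow> ennreal"
  proof -
    have "(\<integral>\<^sup>+x. ennpowr (f x) (real_of_ereal e) \<partial>lebesgue) = (\<integral>\<^sup>+x. ennpowr (g x) (real_of_ereal e) \<partial>lebesgue)"
      using that(2) by (intro nn_integral_cong_AE) (auto elim: eventually_mono)
    then show ?thesis using that(1) by (simp add: Lnorm_def)
  qed
  have "Lnorm lebesgue (1 / (1 / ereal p - 1/s)) (\<lambda>x. ennreal (v x) * indicator Q x) = Lnorm lebesgue (1 / (1 / ereal p - 1/s)) (\<lambda>x. ennreal (v' x) * indicator Q x)"
    "Lnorm lebesgue (1 / (1 / ereal r - 1 / ereal p)) (\<lambda>x. ennreal (inverse (v x)) * indicator Q x) = Lnorm lebesgue (1 / (1 / ereal r - 1 / ereal p)) (\<lambda>x. ennreal (inverse (v' x)) * indicator Q x)" for Q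
    using ae by (auto intro!: Lcong exps elim: eventually_mono)
  then have "A_const (ereal p) (ereal r) s v = A_const (ereal p) (ereal r) s v'"
    unfolding A_const_def by simp
  then have "A_const (ereal p) (ereal r) s v' < top" using assms(8) by (simp add: A_class_def)
  then show ?thesis
    unfolding X using assms \<sigma> by (intro bounded_on_space_rs v' pos) auto
qed

end
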